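(* Consider the family of smooth closed manifolds with a compact torus action $$\mathcal F=\{\mathcal Z_P \mid P=P(n,s),\ n\ge 2,\ s\ge 1\}.$$ Then for any given $l,r\ge 2$ there is an $l$-connected manifold $M\in\mathcal F$ with a strictly defined nontrivial $r$-fold Massey product in $H^*(M)$.
   Context: Coefficients are in $\mathbf k$, a field of characteristic zero or $\mathbb Z$. Complexes and polytopes. $K$ denotes an abstract simplicial complex on $[m]=\{1,\dots,m\}$ with all $\{i\}\in K$; $K_I=K\cap2^I$ is the induced subcomplex on $I\subset[m]$; $\mathbf{MF}(K)$ is the set of minimal non-faces of $K$ (it determines $K$). For a simple polytope $P$ with facets $F_1,\dots,F_m$, the nerve complex $K_P$ on $[m]$ has as simplices those $I$ with $\bigcap_{i\in I}F_i\neq\varnothing$. For an $m$-tuple of positive integers $J=(j_1,\dots,j_m)$, with $d(J)=j_1+\cdots+j_m$, the simplicial multiwedge $K(J)$ is the complex on the $d(J)$ vertices $\{11,\dots,1j_1,\dots,m1,\dots,mj_m\}$ whose minimal non-faces are exactly the sets $\{i_11,\dots,i_1j_{i_1},\dots,i_k1,\dots,i_kj_{i_k}\}$ for $\{i_1,\dots,i_k\}\in\mathbf{MF}(K)$. For $K=K_P$ the complex $K_P(J)$ is the nerve complex of a simple polytope, denoted $P(J)$, so $K_{P(J)}=K_P(J)$. Moment-angle manifolds. $\mathcal Z_K=\bigcup_{\sigma\in K}\prod_{i=1}^m Y_i^\sigma$, with $Y_i^\sigma=\mathbb D^2$ if $i\in\sigma$ and $Y_i^\sigma=\mathbb S^1$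 otherwise; $\mathcal Z_P=\mathcal Z_{K_P}$, which is a smooth closed manifold with the coordinatewise action of the torus $\mathbb T^m$ ($m$ the number of facets of $P$). The polytopes $P(n,s)$. For $n\ge2$ let $K(n)$ be the complex on $[2n]$ with $\mathbf{MF}(K(n))=\{\{k,n+k+i\}: 0\le i\le n-2,\ 1\le k\le n-i\}$, and for $s\ge1$ let $K(n,s)=K(n)(s,\dots,s,1,\dots,1)$ ($n$ entries $s$ followed by $n$ entries $1$). $P(n)$ is an $n$-dimensional 2-truncated cube (a polytope obtained from a cube by a sequence of cuttings of codimension-2 faces by hyperplanes of general position) with $\mu=\frac{n(n+3)}2-1$ facets, obtained from the cube $I^n$ with facets $F_1,\dots,F_{2n}$, where $F_i\cap F_{n+i}=\varnothing$ for $1\le i\le n$, such that the induced subcomplex of $K_{P(n)}$ on $[2n]$ is combinatorially equivalent to $K(n)$. Then $P(n,s)=P(n)(J_{ns})$ is a simple polytope with $d(J_{ns})$ facets, where $$J_{ns}=(\underbrace{s,\dots,s}_n,\underbrace{1,\dots,1}_n,j_{2n+1,n,s},\dots,j_{\mu,n,s}),$$ the induced subcomplex of $K_{P(n,s)}$ on $\{11,\dots,1s,\dots,n1,\dots,ns,n+1,\dots,2n\}$ is combinatorially equivalent to $K(n,s)$, and the $j_{p,n,s}$ ($p>2n$) are arbitrary positive integers such that $j_{p,n,1}=1$ and every $I\in\mathbf{MF}(K_{P(n,s)})$ satisfies $|I|\ge s+1$. Massey products. Let $(A,d)$ be a differential graded algebra and $\alpha_i=[a_i]\in H^*[A,d]$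 with $a_i\in A^{n_i}$ for $1\le i\le k$. A defining system for $(\alpha_1,\dots,\alpha_k)$ is a $(k+1)\times(k+1)$ matrix $C=(c_{i,j})$ over $A$ with $c_{i,j}=0$ for $i\ge j$, $c_{i,i+1}=a_i$, and $a\cdot E_{1,k+1}=dC-\bar C\cdot C$ for some $a=a(C)\in A$, where $\bar c_{i,j}=(-1)^{\deg c_{i,j}}c_{i,j}$ and $E_{1,k+1}$ is the matrix with $1$ in position $(1,k+1)$ and zeros elsewhere; then $a(C)$ is a cocycle of degree $n_1+\dots+n_k-k+2$. The $k$-fold Massey product $\langle\alpha_1,\dots,\alpha_k\rangle$ is defined if a defining system exists, and it then consists of all classes $[a(C)]$, where $C$ runs over all defining systems. A defined Massey product is trivial if $[a(C)]=0$ for some $C$ (nontrivial otherwise), and strictly defined if $\langle\alpha_1,\dots,\alpha_k\rangle=\{[a(C)]\}$ for some $C$, i.e. it consists of exactly one element. Massey products in $H^*(\mathcal Z_K)\cong H^*[R^*(K),d]$ are taken with respect to the dga $R^*(K)=\Lambda[u_1,\dots,u_m]\otimes\mathbf k[K]/(v_i^2=u_iv_i=0,\ 1\le i\le m)$, which is quasi-isomorphic to the cellular cochain algebra of $\mathcal Z_K$; here $\mathbf k[K]=\mathbf k[v_1,\dots,v_m]/(\prod_{i\in I}v_i: I\in\mathbf{MF}(K))$, $\deg u_i=1$, $\deg v_i=2$, $du_i=v_i$, $dv_i=0$. *)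

theory Defs
  imports "HOL-Analysis.Analysis" "HOL-Library.Poly_Mapping"
begin

section \<open>Simplicial complexes\<close>

text \<open>
  A complex is given by its set of simplices (finite sets of natural numbers, including the empty
  simplex).  There are no ghost vertices, so the vertex set of \<open>K\<close> is \<open>\<Union>K\<close>.
\<close>

type_synonym complex_on_nat = "nat set set"

definition induced :: "complex_on_nat \<Rightarrow> nat set \<Rightarrow> complex_on_nat" where
  "induced K I = K \<inter> Pow I"

definition minimal_nonfaces :: "complex_on_nat \<Rightarrow> nat set set" where
  "minimal_nonfaces K = {N. N \<subseteq> \<Union>K \<and> N \<notin> K \<and> (\<forall>M. M \<subset> N \<longrightarrow> M \<in> K)}"

definition complex_of_nonfaces :: "nat set \<Rightarrow> nat set set \<Rightarrow> complex_on_nat" where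
  "complex_of_nonfaces V \<N> = {\<sigma>. \<sigma> \<subseteq> V \<and> (\<forall>N\<in>\<N>. \<not> N \<subseteq> \<sigma>)}"

text \<open>
  The \<open>k\<close>-th copy \<open>ik\<close> of the vertex \<open>i\<close> (with \<open>1 \<le> k \<le> j\<^sub>i\<close>) is encoded as \<open>prod_encode (i, k)\<close>;
  \<open>copies J N\<close> consists of all the copies of all the vertices in \<open>N\<close>.
\<close>

definition copies :: "(nat \<Rightarrow> nat) \<Rightarrow> nat set \<Rightarrow> nat set" where
  "copies J N = {prod_encode (i, k) |i k. i \<in> N \<and> 1 \<le> k \<and> k \<le> J i}"

definition multiwedge :: "complex_on_nat \<Rightarrow> (nat \<Rightarrow> nat) \<Rightarrow> complex_on_nat" where
  "multiwedge K J = complex_of_nonfaces (copies J (\<Union>K)) (copies J ` minimal_nonfaces K)"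

definition complex_Kn :: "nat \<Rightarrow> complex_on_nat" where
  "complex_Kn n = complex_of_nonfaces {1..2*n}
     {{k, n + k + i} |k i. i \<le> n - 2 \<and> 1 \<le> k \<and> k \<le> n - i}"


section \<open>Polytopes with an ordered set of facets\<close>

text \<open>
  A polytope in \<open>\<real>\<^sup>n\<close> is presented by the list of the half-spaces \<open>\<langle>a\<^sub>i, x\<rangle> \<le> c\<^sub>i\<close> bounded by its facet
  hyperplanes.  The list order numbers the facets as \<open>F\<^sub>1, \<dots>, F\<^sub>m\<close>.  As the dimension varies inside
  the statements, points of \<open>\<real>\<^sup>n\<close> are functions on \<open>{1..n}\<close>, extended by \<open>undefined\<close>.
\<close>

type_synonym halfspace = "(nat \<Rightarrow> real) \<times> real"

definition pairing :: "nat \<Rightarrow> (nat \<Rightarrow> real) \<Rightarrow> (nat \<Rightarrow> real) \<Rightarrow> real" where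
  "pairing n a x = (\<Sum>t=1..n. a t * x t)"

definition points :: "nat \<Rightarrow> halfspace list \<Rightarrow> (nat \<Rightarrow> real) set" where
  "points n hs = {x \<in> extensional {1..n}. \<forall>(a, c)\<in>set hs. pairing n a x \<le> c}"

definition facet :: "nat \<Rightarrow> halfspace list \<Rightarrow> nat \<Rightarrow> (nat \<Rightarrow> real) set" where
  "facet n hs i = {x \<in> points n hs. pairing n (fst (hs ! (i - 1))) x = snd (hs ! (i - 1))}"

definition vertices :: "nat \<Rightarrow> halfspace list \<Rightarrow> (nat \<Rightarrow> real) set" where
  "vertices n hs = {v \<in> points n hs. \<forall>x\<in>points n hs. \<forall>y\<in>points n hs.
     (\<forall>t\<in>{1..n}. v t = (x t + y t) / 2) \<longrightarrow> x = y}"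

definition nerve :: "nat \<Rightarrow> halfspace list \<Rightarrow> complex_on_nat" where
  "nerve n hs = {I. I \<subseteq> {1..length hs} \<and> (\<exists>x\<in>points n hs. \<forall>i\<in>I. x \<in> facet n hs i)}"

text \<open>The cube \<open>[0,1]\<^sup>n\<close>, with \<open>F\<^sub>i = {x\<^sub>i = 0}\<close> and \<open>F\<^sub>n\<^sub>+\<^sub>i = {x\<^sub>i = 1}\<close>.\<close>

definition cube :: "nat \<Rightarrow> halfspace list" where
  "cube n = map (\<lambda>i. (\<lambda>t. if t = i then -1 else 0, 0)) [1..<n+1]
          @ map (\<lambda>i. (\<lambda>t. if t = i then 1 else 0, 1)) [1..<n+1]"

text \<open>
  All the polytopes below are simple, so their codimension-2 faces are the nonempty intersections of
  two facets.  Cutting off such a face \<open>G\<close> means adding a half-space whose complement contains the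
  vertices of \<open>G\<close> and no others; the bounding hyperplane is in general position, i.e. it contains no
  vertex.  The facet that is created comes last in the numbering.
\<close>

inductive truncated_cube :: "nat \<Rightarrow> halfspace list \<Rightarrow> bool" for n :: nat where
  cube: "truncated_cube n (cube n)"
| cut: "\<lbrakk> truncated_cube n hs; i \<in> {1..length hs}; j \<in> {1..length hs}; i \<noteq> j;
          facet n hs i \<inter> facet n hs j \<noteq> {};
          \<forall>v\<in>vertices n hs. if v \<in> facet n hs i \<inter> facet n hs j
             then pairing n a v > c else pairing n a v < c \<rbrakk>
        \<Longrightarrow> truncated_cube n (hs @ [(a, c)])"

definition num_facets :: "nat \<Rightarrow> nat" where
  "num_facets n = n * (n + 3) div 2 - 1"

definition is_polytope_Pn :: "nat \<Rightarrow> halfspace list \<Rightarrow> bool" where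
  "is_polytope_Pn n hs \<longleftrightarrow> truncated_cube n hs \<and> length hs = num_facets n \<and>
     induced (nerve n hs) {1..2*n} = complex_Kn n"

text \<open>The tuples \<open>J\<^sub>n\<^sub>s\<close> that are allowed when \<open>K\<close> is the nerve complex of \<open>P(n)\<close>.\<close>

definition admissible_tuple :: "complex_on_nat \<Rightarrow> nat \<Rightarrow> nat \<Rightarrow> (nat \<Rightarrow> nat) \<Rightarrow> bool" where
  "admissible_tuple K n s J \<longleftrightarrow>
     (\<forall>i\<in>{1..n}. J i = s) \<and> (\<forall>i\<in>{n+1..2*n}. J i = 1) \<and>
     (\<forall>p\<in>{2*n+1..num_facets n}. J p \<ge> 1 \<and> (s = 1 \<longrightarrow> J p = 1)) \<and>
     (\<forall>I\<in>minimal_nonfaces (multiwedge K J). card I \<ge> s + 1)"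

text \<open>
  The nerve complexes of the polytopes \<open>P(n,s) = P(n)(J\<^sub>n\<^sub>s)\<close>, for all \<open>n \<ge> 2\<close>, \<open>s \<ge> 1\<close> and all
  admissible tuples: the nerve complex of \<open>P(J)\<close> is \<open>K\<^sub>P(J)\<close>.  The family of moment-angle manifolds
  consists of the \<open>moment_angle K\<close> with \<open>K\<close> in this set.
\<close>

definition nerves_of_family :: "(nat \<Rightarrow> halfspace list) \<Rightarrow> complex_on_nat set" where
  "nerves_of_family P = {multiwedge (nerve n (P n)) J |n s J.
     n \<ge> 2 \<and> s \<ge> 1 \<and> admissible_tuple (nerve n (P n)) n s J}"


section \<open>Moment-angle complexes and connectivity\<close>

definition moment_angle :: "complex_on_nat \<Rightarrow> (nat \<Rightarrow> complex) topology" where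
  "moment_angle K = subtopology (product_topology (\<lambda>_. euclidean) (\<Union>K))
     (\<Union>\<sigma>\<in>K. \<Pi>\<^sub>E i\<in>\<Union>K. if i \<in> \<sigma> then cball 0 1 else sphere 0 1)"

definition sphere_base :: "nat \<Rightarrow> real" where
  "sphere_base t = (if t = 0 then 1 else 0)"

text \<open>\<open>\<pi>\<^sub>i(X, x) = 0\<close>; all homotopies are relative to the base point.\<close>

definition trivial_homotopy_group :: "nat \<Rightarrow> 'a topology \<Rightarrow> 'a \<Rightarrow> bool" where
  "trivial_homotopy_group i X x \<longleftrightarrow>
     (\<forall>f. continuous_map (nsphere i) X f \<and> f sphere_base = x \<longrightarrow>
        homotopic_with (\<lambda>h. h sphere_base = x) (nsphere i) X f (\<lambda>_. x))"

definition n_connected :: "nat \<Rightarrow> 'a topology \<Rightarrow> bool" where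
  "n_connected l X \<longleftrightarrow> topspace X \<noteq> {} \<and> path_connected_space X \<and>
     (\<forall>i\<in>{1..l}. \<forall>x\<in>topspace X. trivial_homotopy_group i X x)"


section \<open>Massey products in a differential graded algebra\<close>

text \<open>\<open>grade A n\<close> is the group of homogeneous elements of degree \<open>n\<close>.\<close>

record 'a dga =
  grade :: "int \<Rightarrow> 'a set"
  mult :: "'a \<Rightarrow> 'a \<Rightarrow> 'a"
  diff :: "'a \<Rightarrow> 'a"

definition cocycles :: "('a::ab_group_add) dga \<Rightarrow> int \<Rightarrow> 'a set" where
  "cocycles A n = {x \<in> grade A n. diff A x = 0}"

definition coh_class :: "('a::ab_group_add) dga \<Rightarrow> int \<Rightarrow> 'a \<Rightarrow> 'a set" where
  "coh_class A n x = {y \<in> cocycles A n. y - x \<in> diff A ` grade A (n - 1)}"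

definition cohomology :: "('a::ab_group_add) dga \<Rightarrow> int \<Rightarrow> 'a set set" where
  "cohomology A n = coh_class A n ` cocycles A n"

text \<open>The conjugate \<open>(-1)\<^sup>n x\<close> of an element \<open>x\<close> of degree \<open>n\<close>.\<close>

definition bar :: "int \<Rightarrow> 'a \<Rightarrow> ('a::ab_group_add)" where
  "bar n x = (if even n then x else - x)"

text \<open>
  The degree of the entry \<open>c\<^sub>i\<^sub>,\<^sub>j\<close>, \<open>i < j\<close>, of a defining system for classes of degrees
  \<open>ns 1, \<dots>, ns k\<close>: it is forced by \<open>c\<^sub>i\<^sub>,\<^sub>i\<^sub>+\<^sub>1\<close> having degree \<open>ns i\<close> and by the matrix equation.
\<close>

definition entry_degree :: "(nat \<Rightarrow> int) \<Rightarrow> nat \<Rightarrow> nat \<Rightarrow> int" where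
  "entry_degree ns i j = (\<Sum>t=i..<j. ns t) - (int j - int i) + 1"

text \<open>
  The classes \<open>\<alpha> 1, \<dots>, \<alpha> k\<close> are cosets, so \<open>c i (i+1) \<in> \<alpha> i\<close> says that \<open>c i (i+1)\<close> is a cocycle
  representing \<open>\<alpha> i\<close>.  The last conjunct is the equation \<open>a \<cdot> E\<^sub>1\<^sub>,\<^sub>k\<^sub>+\<^sub>1 = dC - \<bar>C \<cdot> C\<close>, entry by entry.
\<close>

definition defining_system ::
  "('a::ab_group_add) dga \<Rightarrow> nat \<Rightarrow> (nat \<Rightarrow> int) \<Rightarrow> (nat \<Rightarrow> 'a set) \<Rightarrow> (nat \<Rightarrow> nat \<Rightarrow> 'a) \<Rightarrow> 'a \<Rightarrow> bool"
  where
  "defining_system A k ns \<alpha> c a \<longleftrightarrow>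
     (\<forall>i\<in>{1..k+1}. \<forall>j\<in>{1..k+1}. if i \<ge> j then c i j = 0 else c i j \<in> grade A (entry_degree ns i j)) \<and>
     (\<forall>i\<in>{1..k}. c i (i + 1) \<in> \<alpha> i) \<and>
     (\<forall>i\<in>{1..k+1}. \<forall>j\<in>{1..k+1}.
        (if i = 1 \<and> j = k + 1 then a else 0) =
        diff A (c i j) - (\<Sum>t=1..k+1. mult A (bar (entry_degree ns i t) (c i t)) (c t j)))"

definition massey_class ::
  "('a::ab_group_add) dga \<Rightarrow> nat \<Rightarrow> (nat \<Rightarrow> int) \<Rightarrow> 'a \<Rightarrow> 'a set" where
  "massey_class A k ns a = coh_class A ((\<Sum>t=1..k. ns t) - int k + 2) a"

definition massey_product ::
  "('a::ab_group_add) dga \<Rightarrow> nat \<Rightarrow> (nat \<Rightarrow> int) \<Rightarrow> (nat \<Rightarrow> 'a set) \<Rightarrow> 'a set set" where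
  "massey_product A k ns \<alpha> = {massey_class A k ns a |c a. defining_system A k ns \<alpha> c a}"

definition strictly_defined ::
  "('a::ab_group_add) dga \<Rightarrow> nat \<Rightarrow> (nat \<Rightarrow> int) \<Rightarrow> (nat \<Rightarrow> 'a set) \<Rightarrow> bool" where
  "strictly_defined A k ns \<alpha> \<longleftrightarrow>
     (\<exists>c a. defining_system A k ns \<alpha> c a \<and> massey_product A k ns \<alpha> = {massey_class A k ns a})"

definition trivial_massey ::
  "('a::ab_group_add) dga \<Rightarrow> nat \<Rightarrow> (nat \<Rightarrow> int) \<Rightarrow> (nat \<Rightarrow> 'a set) \<Rightarrow> bool" where
  "trivial_massey A k ns \<alpha> \<longleftrightarrow>
     (\<exists>c a. defining_system A k ns \<alpha> c a \<and> massey_class A k ns a = massey_class A k ns 0)"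


section \<open>The algebra \<open>R\<^sup>*(K)\<close>\<close>

text \<open>
  The ideal by which \<open>\<Lambda>[u\<^sub>1,\<dots>,u\<^sub>m] \<otimes> k[v\<^sub>1,\<dots>,v\<^sub>m]\<close> is divided is spanned by monomials, namely by those
  divisible by some \<open>v\<^sub>i\<^sup>2\<close>, some \<open>u\<^sub>i v\<^sub>i\<close> or some \<open>\<Prod>\<^sub>i\<^sub>\<in>\<^sub>N v\<^sub>i\<close> with \<open>N\<close> a minimal non-face.  Hence the quotient
  is the free module on the remaining monomials \<open>u\<^sub>J v\<^sub>I\<close>, with \<open>J \<inter> I = \<emptyset>\<close> and \<open>I \<in> K\<close>, multiplied by
  putting every other monomial equal to 0.  The monomial \<open>u\<^sub>J v\<^sub>I\<close> is represented by the pair \<open>(J, I)\<close>;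
  in \<open>u\<^sub>J\<close> the factors are taken in increasing order.
\<close>

type_synonym monomial = "nat set \<times> nat set"

definition R_basis :: "complex_on_nat \<Rightarrow> monomial set" where
  "R_basis K = {(J, I). J \<subseteq> \<Union>K \<and> I \<in> K \<and> J \<inter> I = {}}"

text \<open>\<open>u\<^sub>J u\<^sub>J\<^sub>' = \<plusminus> u\<^sub>J\<^sub>\<union>\<^sub>J\<^sub>'\<close> for disjoint \<open>J\<close>, \<open>J'\<close>; the sign counts the inversions.\<close>

definition shuffle_sign :: "nat set \<Rightarrow> nat set \<Rightarrow> 'k::comm_ring_1" where
  "shuffle_sign J J' = (-1) ^ card {(a, b). a \<in> J \<and> b \<in> J' \<and> b < a}"

definition monomial_mult ::
  "complex_on_nat \<Rightarrow> monomial \<Rightarrow> monomial \<Rightarrow> monomial \<Rightarrow>\<^sub>0 'k::comm_ring_1" where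
  "monomial_mult K p q = (case (p, q) of ((J, I), (J', I')) \<Rightarrow>
     if J \<inter> J' = {} \<and> I \<inter> I' = {} \<and> (J \<union> J', I \<union> I') \<in> R_basis K
     then Poly_Mapping.single (J \<union> J', I \<union> I') (shuffle_sign J J') else 0)"

definition monomial_diff :: "complex_on_nat \<Rightarrow> monomial \<Rightarrow> monomial \<Rightarrow>\<^sub>0 'k::comm_ring_1" where
  "monomial_diff K p = (case p of (J, I) \<Rightarrow>
     \<Sum>j\<in>J. if insert j I \<in> K
        then Poly_Mapping.single (J - {j}, insert j I) (shuffle_sign {j} J) else 0)"

definition scale :: "'k::comm_ring_1 \<Rightarrow> (monomial \<Rightarrow>\<^sub>0 'k) \<Rightarrow> (monomial \<Rightarrow>\<^sub>0 'k)" where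
  "scale r = Poly_Mapping.map (\<lambda>x. r * x)"

definition R_alg :: "complex_on_nat \<Rightarrow> (monomial \<Rightarrow>\<^sub>0 'k::comm_ring_1) dga" where
  "R_alg K = \<lparr>
     grade = (\<lambda>n. {x. Poly_Mapping.keys x \<subseteq> {(J, I) \<in> R_basis K. int (card J + 2 * card I) = n}}),
     mult = (\<lambda>x y. \<Sum>p\<in>Poly_Mapping.keys x. \<Sum>q\<in>Poly_Mapping.keys y.
        scale (Poly_Mapping.lookup x p * Poly_Mapping.lookup y q) (monomial_mult K p q)),
     diff = (\<lambda>x. \<Sum>p\<in>Poly_Mapping.keys x. scale (Poly_Mapping.lookup x p) (monomial_diff K p)) \<rparr>"

text \<open>
  The defining relations of \<open>R\<^sup>*(K)\<close>.  Every basis monomial is a product of generators by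
  \<open>u_mult_monomial\<close> and \<open>v_mult_monomial\<close>.
\<close>

definition R_u :: "nat \<Rightarrow> monomial \<Rightarrow>\<^sub>0 'k::comm_ring_1" where
  "R_u i = Poly_Mapping.single ({i}, {}) 1"

definition R_v :: "nat \<Rightarrow> monomial \<Rightarrow>\<^sub>0 'k::comm_ring_1" where
  "R_v i = Poly_Mapping.single ({}, {i}) 1"

lemma scale_1: "scale 1 x = x"
  unfolding scale_def by (rule poly_mapping_eqI) (simp add: map.rep_eq when_def)

lemma mult_monomials:
  "mult (R_alg K) (Poly_Mapping.single p 1) (Poly_Mapping.single q 1) =
     (monomial_mult K p q :: monomial \<Rightarrow>\<^sub>0 'k::comm_ring_1)"
  by (simp add: R_alg_def scale_1)

lemma diff_monomial:
  "diff (R_alg K) (Poly_Mapping.single p 1) = (monomial_diff K p :: monomial \<Rightarrow>\<^sub>0 'k::comm_ring_1)"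
  by (simp add: R_alg_def scale_1)

lemma shuffle_sign_single:
  "shuffle_sign {i} J = (-1) ^ card {b \<in> J. b < i}"
proof -
  have "{(a, b). a \<in> {i} \<and> b \<in> J \<and> b < a} = Pair i ` {b \<in> J. b < i}" by auto
  then show ?thesis unfolding shuffle_sign_def by (simp add: card_image inj_on_def)
qed

lemma shuffle_sign_singles: "shuffle_sign {i} {j} = (if j < i then -1 else 1)"
proof -
  have "{b \<in> {j}. b < i} = (if j < i then {j} else {})" by auto
  then show ?thesis by (simp add: shuffle_sign_single)
qed

lemma u_mult_monomial:
  assumes "(insert i J, I) \<in> R_basis K" "\<forall>j\<in>J. i < j"
  shows "mult (R_alg K) (R_u i) (Poly_Mapping.single (J, I) 1) =
     (Poly_Mapping.single (insert i J, I) 1 :: monomial \<Rightarrow>\<^sub>0 'k::comm_ring_1)"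
proof -
  have *: "{b \<in> J. b < i} = {}" using assms(2) by auto
  show ?thesis
    unfolding R_u_def mult_monomials monomial_mult_def
    using assms * by (auto simp: shuffle_sign_single simp del: Collect_empty_eq)
qed

lemma v_mult_monomial:
  assumes "(J, insert i I) \<in> R_basis K" "i \<notin> I"
  shows "mult (R_alg K) (R_v i) (Poly_Mapping.single (J, I) 1) =
     (Poly_Mapping.single (J, insert i I) 1 :: monomial \<Rightarrow>\<^sub>0 'k::comm_ring_1)"
  unfolding R_v_def mult_monomials monomial_mult_def using assms by (simp add: shuffle_sign_def)

lemma R_relations:
  shows "mult (R_alg K) (R_u i) (R_u i) = (0 :: monomial \<Rightarrow>\<^sub>0 'k::comm_ring_1)"
    and "mult (R_alg K) (R_v i) (R_v i) = (0 :: monomial \<Rightarrow>\<^sub>0 'k::comm_ring_1)"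
    and "mult (R_alg K) (R_u i) (R_v i) = (0 :: monomial \<Rightarrow>\<^sub>0 'k::comm_ring_1)"
    and "mult (R_alg K) (R_u i) (R_u j) = - mult (R_alg K) (R_u j) (R_u i :: monomial \<Rightarrow>\<^sub>0 'k::comm_ring_1)"
    and "mult (R_alg K) (R_u i) (R_v j) = mult (R_alg K) (R_v j) (R_u i :: monomial \<Rightarrow>\<^sub>0 'k::comm_ring_1)"
    and "mult (R_alg K) (R_v i) (R_v j) = mult (R_alg K) (R_v j) (R_v i :: monomial \<Rightarrow>\<^sub>0 'k::comm_ring_1)"
    and "{i} \<in> K \<Longrightarrow> diff (R_alg K) (R_u i) = (R_v i :: monomial \<Rightarrow>\<^sub>0 'k::comm_ring_1)"
    and "diff (R_alg K) (R_v i) = (0 :: monomial \<Rightarrow>\<^sub>0 'k::comm_ring_1)"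
proof -
  show "mult (R_alg K) (R_u i) (R_u j) = - mult (R_alg K) (R_u j) (R_u i :: monomial \<Rightarrow>\<^sub>0 'k)"
    by (cases i j rule: linorder_cases)
      (auto simp: R_u_def mult_monomials monomial_mult_def shuffle_sign_singles insert_commute single_uminus)
qed (auto simp: R_u_def R_v_def mult_monomials diff_monomial monomial_mult_def monomial_diff_def
      R_basis_def shuffle_sign_singles shuffle_sign_def[of "{}"] shuffle_sign_def[of _ "{}"] Un_commute insert_commute)

text \<open>
  The ring of coefficients is a field of characteristic 0 or the ring of integers: a ring of
  characteristic 0 all of whose elements are integers is isomorphic to the latter.
\<close>

definition coefficient_ring :: "'k::{comm_ring_1, ring_char_0} itself \<Rightarrow> bool" where
  "coefficient_ring _ \<longleftrightarrow>
     (\<forall>x::'k. x \<noteq> 0 \<longrightarrow> (\<exists>y. x * y = 1)) \<or> (UNIV :: 'k set) = \<int>"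

end

theory Submission
  imports Defs
begin

text \<open>
  Take \<open>n = r\<close>, \<open>s\<close> large, and give every facet \<open>F\<^sub>p\<close> of \<open>P(n)\<close> with \<open>p > 2n\<close> so many copies that it does not
  matter in the degrees considered.

  Every set of at most \<open>s\<close> vertices of \<open>K\<close> is a simplex, so a map from a sphere of dimension less than \<open>s\<close>
  extends over the disc to the polydisc in such a way that at most \<open>s\<close> coordinates are near 0 at each
  point; pushing the other coordinates radially to the unit circle moves the extension into
  \<open>\<Z>\<^sub>K\<close>.

  The classes \<open>\<alpha>\<^sub>i\<close> are represented by \<open>v\<^sub>i\<^sub>1 \<dots> v\<^sub>i\<^sub>s u\<^sub>n\<^sub>+\<^sub>i\<close>.  They have an explicit defining system, whose value
  is, up to sign, dual to the edge \<open>{1, 2n}\<close> of the 4-cycle \<open>1, 2, n + 1, 2n\<close> in \<open>K(n)\<close> and hence is not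
  exact.  Any other defining system can be gauge-transformed, without changing its value, so that it
  agrees with the explicit one up to elements of positive weight, for a grading by weights in which the
  entries of the explicit system have weight 0; and these elements do not contribute to the value.
\<close>

section \<open>Connectivity of moment-angle complexes\<close>

text \<open>The difficulty is uniqueness: cocycles of degree 2sk + 1 with 1 < k < n need not be
  coboundaries, so the entries of a defining system are not determined up to exact terms. The weight
  repairs this. Its values at i and n + i are opposite, so the standard entries have weight 0; it is
  additive, so multiplying by them preserves positivity. Its constant n^2 + 1 exceeds any sum of
  distinct indices up to n: the sign is decided first by the numbers of left vertices i and right
  vertices n + p, and by the sums of indices only when these numbers agree. Cohomology is not
  computed. Cocycles are moved to smaller supports by matchings that exchange u_v and v_v at one
  vertex v, until the degree excludes what remains. The matchings need a right vertex n + t and a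
  left vertex a with t < a, which the weight condition supplies; they leave only faces containing
  {1, 2n}, the one edge {i, n + p} with i \<le> p. The same exceptional edge makes the product
  nontrivial. Large s lets 2s dominate all corrections in the degree, which then reads off the
  number of left vertices.\<close>

definition clamp01 :: "real \<Rightarrow> real" where
  "clamp01 y = min 1 (max 0 y)"

text \<open>
  Off thin strips, \<open>collapse B M \<theta>\<close> takes values in the lattice of multiples of \<open>1/B\<close>, and the strips
  for different \<open>\<theta> < M\<close> are disjoint.  A point with \<open>d + 1\<close> coordinates therefore meets the strips of
  at most \<open>d + 1\<close> values of \<open>\<theta>\<close>.  This takes the place of a general position argument.
\<close>

definition collapse :: "nat \<Rightarrow> nat \<Rightarrow> nat \<Rightarrow> real \<Rightarrow> real" where
  "collapse B M \<theta> y =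
     ((\<Sum>k\<in>{- int B..<int B}. clamp01 (real M * (real B * y - k) - \<theta>)) - B) / B"

lemma continuous_on_clamp01 [continuous_intros]:
  "continuous_on S f \<Longrightarrow> continuous_on S (\<lambda>x. clamp01 (f x))"
  unfolding clamp01_def by (intro continuous_intros)

lemma continuous_on_collapse [continuous_intros]:
  "continuous_on S f \<Longrightarrow> continuous_on S (\<lambda>x. collapse B M \<theta> (f x))"
  unfolding collapse_def divide_inverse by (intro continuous_intros)

text \<open>With z = B y, every ramp with index below the floor of z is complete and every one above
  it has not begun, so a single summand is undecided and the sum differs from z + B by at most
  1.\<close>

lemma collapse_near:
  assumes B: "B > 0" and \<theta>: "\<theta> < M" and y: "\<bar>y\<bar> \<le> 1"
  shows "\<bar>collapse B M \<theta> y - y\<bar> \<le> 1 / B"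
proof -
  define z where "z = real B * y"
  define c where "c k = clamp01 (real M * (z - of_int k) - \<theta>)" for k :: int
  have yB: "\<bar>z\<bar> \<le> B"
    using y B by (simp add: z_def abs_mult mult_left_le)
  have c01: "0 \<le> c k" "c k \<le> 1" for k by (auto simp: c_def clamp01_def)
  have one: "c k = 1" if "k < \<lfloor>z\<rfloor>" for k
  proof -
    have "z - k \<ge> 1" using that by linarith
    then have "real M * (z - k) \<ge> real M * 1" by (intro mult_left_mono) auto
    with \<theta> have "real M * (z - k) - \<theta> \<ge> 1" by linarith
    then show ?thesis by (simp add: c_def clamp01_def)
  qed
  have zero: "c k = 0" if "k > \<lfloor>z\<rfloor>" for k
  proof -
    have "z - k \<le> 0" using that by linarith
    then have "real M * (z - k) \<le> real M * 0" by (intro mult_left_mono) auto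
    then show ?thesis by (simp add: c_def clamp01_def)
  qed
  \<comment> \<open>At y = 1 the floor is B, just outside the index range; the last ramp then takes
    its place and is complete.\<close>
  define f where "f = min \<lfloor>z\<rfloor> (int B - 1)"
  have f: "- int B \<le> \<lfloor>z\<rfloor>" "\<lfloor>z\<rfloor> \<le> int B" using yB by linarith+
  have split: "{- int B..<int B} = {- int B..<f} \<union> {f} \<union> {f<..<int B}"
    using f B unfolding f_def by auto
  have "(\<Sum>k\<in>{- int B..<int B}. c k) = (\<Sum>k\<in>{- int B..<f}. c k) + c f + (\<Sum>k\<in>{f<..<int B}. c k)"
    unfolding split by (subst sum.union_disjoint; auto)+
  also have "(\<Sum>k\<in>{- int B..<f}. c k) = (\<Sum>k\<in>{- int B..<f}. 1)"
    by (rule sum.cong) (auto simp: one f_def)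
  also have "\<dots> = f + B" using f B by (simp add: f_def of_nat_diff)
  also have "(\<Sum>k\<in>{f<..<int B}. c k) = 0"
    by (rule sum.neutral) (auto simp: zero f_def)
  finally have S: "(\<Sum>k\<in>{- int B..<int B}. c k) = f + B + c f" by simp
  have "\<bar>f + c f - z\<bar> \<le> 1"
  proof (cases "\<lfloor>z\<rfloor> = int B")
    case True
    then have "f = int B - 1" "z = B" using yB by (auto simp: f_def) linarith
    then show ?thesis using one[of f] True by simp
  next
    case False
    then have "f = \<lfloor>z\<rfloor>" using f by (simp add: f_def)
    then show ?thesis using c01[of f] by linarith
  qed
  moreover have "collapse B M \<theta> y - y = (f + c f - z) / B"
    using S B by (simp add: collapse_def c_def z_def field_simps)
  ultimately show ?thesis using B by (simp add: abs_divide divide_right_mono)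
qed

lemma collapse_lattice:
  assumes "\<And>k::int. \<not> (0 < real M * (real B * y - k) - \<theta> \<and> real M * (real B * y - k) - \<theta> < 1)"
  shows "\<exists>k\<in>{- int B..int B}. collapse B M \<theta> y = k / B"
proof -
  define c where "c k = (if 0 < real M * (real B * y - of_int k) - \<theta> then 1 else 0 :: int)" for k :: int
  have eq: "clamp01 (real M * (real B * y - k) - \<theta>) = c k" for k :: int
    using assms[of k] by (auto simp: c_def clamp01_def)
  have "sum c {- int B..<int B} \<le> sum (\<lambda>_. 1) {- int B..<int B}"
    by (rule sum_mono) (auto simp: c_def)
  moreover have "0 \<le> sum c {- int B..<int B}" by (rule sum_nonneg) (auto simp: c_def)
  ultimately have "sum c {- int B..<int B} - B \<in> {- int B..int B}" by simp
  moreover have "collapse B M \<theta> y = (sum c {- int B..<int B} - B :: int) / B"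
    unfolding collapse_def eq by simp
  ultimately show ?thesis by blast
qed

text \<open>The ramp of \<theta> sits where the fractional part of z lies between \<theta>/M and
  (\<theta> + 1)/M. In integers: \<open>D\<close> has modulus below 1, so it is 0, and a jump of k
  by one cannot be made up by a difference of residues below M.\<close>

lemma collapse_strips_disjoint:
  fixes z :: real and k k' :: int and \<theta> \<theta>' M :: nat
  assumes "0 < real M * (z - k) - \<theta>" "real M * (z - k) - \<theta> < 1"
    and "0 < real M * (z - k') - \<theta>'" "real M * (z - k') - \<theta>' < 1"
    and "\<theta> < M" "\<theta>' < M"
  shows "\<theta> = \<theta>'"
proof -
  define D where "D = int M * (k' - k) + (int \<theta>' - int \<theta>)"
  have "real_of_int D = (real M * (z - k) - \<theta>) - (real M * (z - k') - \<theta>')"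
    by (simp add: D_def algebra_simps)
  then have "\<bar>real_of_int D\<bar> < 1" using assms(1-4) by linarith
  then have D: "D = 0" by linarith
  have "k' = k"
  proof (rule ccontr)
    assume "k' \<noteq> k"
    then have "\<bar>k' - k\<bar> \<ge> 1" by linarith
    then have "int M * \<bar>k' - k\<bar> \<ge> int M * 1" by (intro mult_left_mono) auto
    then have "\<bar>int M * (k' - k)\<bar> \<ge> int M" by (simp add: abs_mult)
    moreover have "\<bar>int \<theta>' - int \<theta>\<bar> < int M" using assms(5,6) by linarith
    ultimately show False using D unfolding D_def by linarith
  qed
  with D show ?thesis by (simp add: D_def)
qed

section \<open>Uniform continuity on cubes and approximation by functions with few small
  values\<close>

lemma nat_cube_compact: "compact {x :: nat \<Rightarrow> real. \<forall>t. \<bar>x t\<bar> \<le> c}"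
proof -
  have "compactin (powertop_real UNIV) (PiE UNIV (\<lambda>_::nat. {-c..c}))"
    by (auto simp: compactin_PiE compactin_euclidean_iff)
  moreover have "PiE UNIV (\<lambda>_::nat. {-c..c}) = {x :: nat \<Rightarrow> real. \<forall>t. \<bar>x t\<bar> \<le> c}"
    by (auto simp: PiE_UNIV_domain abs_le_iff Pi_def; smt (verit))
  ultimately show ?thesis by (metis compactin_euclidean_iff euclidean_product_topology)
qed

text \<open>The weights of the product metric form a geometric series of sum 2, so a common bound on
  the coordinate distances bounds the distance.\<close>

lemma dist_fun_le:
  fixes x y :: "nat \<Rightarrow> real"
  assumes "\<And>t. \<bar>x t - y t\<bar> \<le> e"
  shows "dist x y \<le> 2 * e"
proof -
  have e: "e \<ge> 0" using assms[of 0] by linarith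
  have "dist x y = suminf (\<lambda>n. (1/2)^n * min (dist (x (from_nat n)) (y (from_nat n))) 1)"
    by (simp add: dist_fun_def)
  also have "\<dots> \<le> suminf (\<lambda>n. (1/2)^n * e)"
  proof (rule suminf_le)
    show "summable (\<lambda>n. (1/2)^n * e :: real)"
      by (intro summable_mult2) (simp add: summable_geometric_iff)
    show "summable (\<lambda>n. (1/2)^n * min (dist (x (from_nat n)) (y (from_nat n))) 1)"
      by (rule summable_comparison_test'[of "\<lambda>n. (1/2)^n"]) (auto simp: summable_geometric_iff)
  qed (use assms in \<open>auto simp: dist_real_def min_le_iff_disj\<close>)
  also have "\<dots> = 2 * e"
    using suminf_geometric[of "1/2::real"] by (subst suminf_mult2[symmetric]) (auto simp: summable_geometric_iff)
  finally show ?thesis .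
qed

text \<open>The bound 2 on the coordinates leaves room for points of the unit cube that rounding has
  moved by at most 1.\<close>

lemma uniform_shift:
  fixes F :: "(nat \<Rightarrow> real) \<Rightarrow> complex"
  assumes "continuous_on UNIV F" "e > 0"
  obtains d where "d > 0" "\<And>x y. \<lbrakk>\<And>t. \<bar>x t\<bar> \<le> 2; \<And>t. \<bar>y t\<bar> \<le> 2; \<And>t. \<bar>x t - y t\<bar> \<le> d\<rbrakk> \<Longrightarrow> cmod (F x - F y) < e"
proof -
  let ?Q = "{x :: nat \<Rightarrow> real. \<forall>t. \<bar>x t\<bar> \<le> 2}"
  have "uniformly_continuous_on ?Q F"
    by (rule compact_uniformly_continuous[OF continuous_on_subset[OF assms(1)] nat_cube_compact]) auto
  then obtain d where d: "d > 0" "\<And>x y. \<lbrakk>x \<in> ?Q; y \<in> ?Q; dist y x < d\<rbrakk> \<Longrightarrow> dist (F y) (F x) < e"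
    unfolding uniformly_continuous_on_def using assms(2) by meson
  show ?thesis
  proof (rule that[of "d/3"])
    fix x y :: "nat \<Rightarrow> real"
    assume a: "\<And>t. \<bar>x t\<bar> \<le> 2" "\<And>t. \<bar>y t\<bar> \<le> 2" "\<And>t. \<bar>x t - y t\<bar> \<le> d/3"
    have "dist x y \<le> 2 * (d/3)" by (rule dist_fun_le) (rule a)
    then have "dist x y < d" using d(1) by simp
    then show "cmod (F x - F y) < e" using d(2)[of y x] a by (simp add: dist_norm)
  qed (use d in simp)
qed

text \<open>Rounding the argument with a residue \<open>rk j\<close> of its own for each j makes
  \<open>G j x\<close> one of finitely many nonzero values, unless some coordinate of x lies in a
  strip of \<open>rk j\<close>. Each of the d + 1 coordinates can do so for one j only.\<close>

lemma generic_approximation: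
  fixes F :: "'j \<Rightarrow> (nat \<Rightarrow> real) \<Rightarrow> complex"
  assumes V: "finite V" and F: "\<And>j. j \<in> V \<Longrightarrow> continuous_on UNIV (F j)"
  obtains G \<delta> where "\<And>j. j \<in> V \<Longrightarrow> continuous_on UNIV (G j)" "0 < \<delta>" "\<delta> \<le> 1/2"
    "\<And>j x. \<lbrakk>j \<in> V; \<forall>t\<le>d. \<bar>x t\<bar> \<le> 1; \<forall>t>d. x t = 0\<rbrakk> \<Longrightarrow> cmod (G j x - F j x) \<le> 1/2"
    "\<And>x. card {j \<in> V. cmod (G j x) < \<delta>} \<le> d + 1"
proof -
  define M where "M = card V"
  obtain rk where "bij_betw rk V {..<M}"
    using ex_bij_betw_finite_nat[OF V] by (auto simp: M_def lessThan_atLeast0)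
  then have rk: "inj_on rk V" "\<And>j. j \<in> V \<Longrightarrow> rk j < M" by (auto simp: bij_betw_def)
  have "\<exists>e>0. \<forall>j\<in>V. \<forall>x y. (\<forall>t. \<bar>x t\<bar> \<le> 2) \<longrightarrow> (\<forall>t. \<bar>y t\<bar> \<le> 2) \<longrightarrow> (\<forall>t. \<bar>x t - y t\<bar> \<le> e) \<longrightarrow> cmod (F j x - F j y) < 1/4"
    using V F
  proof (induction V)
    case empty
    then show ?case by (auto intro: exI[of _ 1])
  next
    case (insert v V)
    then obtain e where e: "e > 0" "\<forall>j\<in>V. \<forall>x y. (\<forall>t. \<bar>x t\<bar> \<le> 2) \<longrightarrow> (\<forall>t. \<bar>y t\<bar> \<le> 2) \<longrightarrow> (\<forall>t. \<bar>x t - y t\<bar> \<le> e) \<longrightarrow> cmod (F j x - F j y) < 1/4"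
      by auto
    obtain e' where e': "e' > 0" "\<And>x y. \<lbrakk>\<And>t. \<bar>x t\<bar> \<le> 2; \<And>t. \<bar>y t\<bar> \<le> 2; \<And>t. \<bar>x t - y t\<bar> \<le> e'\<rbrakk> \<Longrightarrow> cmod (F v x - F v y) < 1/4"
      by (rule uniform_shift[of "F v" "1/4"]) (use insert in auto)
    show ?case using e e' by (intro exI[of _ "min e e'"]) auto
  qed
  then obtain e where e: "e > 0" and close: "\<And>j x y. \<lbrakk>j \<in> V; \<And>t. \<bar>x t\<bar> \<le> 2; \<And>t. \<bar>y t\<bar> \<le> 2; \<And>t. \<bar>x t - y t\<bar> \<le> e\<rbrakk> \<Longrightarrow> cmod (F j x - F j y) < 1/4"
    by blast
  obtain B :: nat where B: "B > 0" "1 / B < e" using e nat_approx_posE by (metis zero_less_Suc)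
  define \<kappa> where "\<kappa> j x = (\<lambda>t. if t \<le> d then collapse B M (rk j) (x t) else 0)" for j and x :: "nat \<Rightarrow> real"
  define \<Lambda> where "\<Lambda> = {x :: nat \<Rightarrow> real. \<forall>t. (t \<in> {..d} \<longrightarrow> x t \<in> (\<lambda>k::int. k / B) ` {- int B..int B}) \<and> (t \<notin> {..d} \<longrightarrow> x t = 0)}"
  have \<Lambda>: "finite \<Lambda>" unfolding \<Lambda>_def by (rule finite_set_of_finite_funs) auto
  have cont\<kappa>: "continuous_on UNIV (\<kappa> j)" for j
    unfolding \<kappa>_def
  proof (rule continuous_on_coordinatewise_then_product)
    show "continuous_on UNIV (\<lambda>x. if t \<le> d then collapse B M (rk j) (x t) else 0)" for t
      by (cases "t \<le> d") (auto intro!: continuous_intros continuous_on_product_coordinates)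
  qed
  \<comment> \<open>The rounded arguments form the finite set \<Lambda>, so a small shift avoids the
    finitely many values that would produce a zero.\<close>
  have "\<exists>w. cmod w < 1/4 \<and> (\<forall>p\<in>\<Lambda>. F j p + w \<noteq> 0)" for j
  proof -
    have "infinite (ball (0::complex) (1/4))"
      by (rule uncountable_infinite) (simp add: uncountable_ball)
    then have "\<not> ball (0::complex) (1/4) \<subseteq> (\<lambda>p. - F j p) ` \<Lambda>"
      using \<Lambda> finite_subset finite_imageI by blast
    then obtain w where w: "cmod w < 1/4" "w \<notin> (\<lambda>p. - F j p) ` \<Lambda>" by (auto simp: subset_iff)
    have "F j p + w \<noteq> 0" if "p \<in> \<Lambda>" for p
    proof
      assume "F j p + w = 0"
      then have "w = - F j p" by (simp add: eq_neg_iff_add_eq_0 add.commute)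
      with w(2) that show False by blast
    qed
    with w(1) show ?thesis by blast
  qed
  then obtain w where w: "\<And>j. cmod (w j) < 1/4" "\<And>j p. p \<in> \<Lambda> \<Longrightarrow> F j p + w j \<noteq> 0" by metis
  define G where "G j x = F j (\<kappa> j x) + w j" for j x
  \<comment> \<open>The 1/2 in the minimum gives \<open>1/2 \<le> 1 - \<delta>\<close>, the estimate
    used near the sphere when maps are extended over the disc.\<close>
  define \<delta> where "\<delta> = Min (insert (1/2) ((\<lambda>(j, p). cmod (F j p + w j)) ` (V \<times> \<Lambda>)))"
  show ?thesis
  proof (rule that[of G \<delta>])
    show "continuous_on UNIV (G j)" if "j \<in> V" for j
      unfolding G_def using continuous_on_compose[OF cont\<kappa> continuous_on_subset[OF F[OF that]]]
      by (auto intro!: continuous_intros simp: o_def)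
    show "0 < \<delta>" unfolding \<delta>_def using V \<Lambda> w(2) by (subst Min_gr_iff) auto
    show "\<delta> \<le> 1/2" unfolding \<delta>_def using V \<Lambda> by (intro Min_le) auto
  next
    fix j x
    assume j: "j \<in> V" and x: "\<forall>t\<le>d. \<bar>x t\<bar> \<le> (1::real)" "\<forall>t>d. x t = 0"
    have x1: "\<bar>x t\<bar> \<le> 1" for t using x by (cases "t \<le> d") auto
    have d: "\<bar>\<kappa> j x t - x t\<bar> \<le> 1 / B" for t
      using collapse_near[OF B(1) rk(2)[OF j] x1] x(2) by (auto simp: \<kappa>_def)
    have "1 / real B \<le> 1" using B(1) by simp
    then have "\<bar>\<kappa> j x t\<bar> \<le> 2" for t using d[of t] x1[of t] by linarith
    then have "cmod (F j (\<kappa> j x) - F j x) < 1/4"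
      using x1 d B(2) by (intro close[OF j]) (auto intro: order_trans[of _ 1] order_trans[of _ "1 / B"])
    moreover have "cmod (G j x - F j x) \<le> cmod (F j (\<kappa> j x) - F j x) + cmod (w j)"
      unfolding G_def by (metis add_diff_eq diff_add_eq norm_triangle_ineq)
    ultimately show "cmod (G j x - F j x) \<le> 1/2" using w(1)[of j] by linarith
  next
    fix x
    let ?S = "{j \<in> V. cmod (G j x) < \<delta>}"
    have "\<exists>t\<le>d. \<exists>k::int. 0 < real M * (real B * x t - k) - rk j \<and> real M * (real B * x t - k) - rk j < 1"
      if "j \<in> ?S" for j
    proof (rule ccontr)
      assume none: "\<not> ?thesis"
      have "\<exists>k\<in>{- int B..int B}. collapse B M (rk j) (x t) = k / B" if "t \<le> d" for t
        by (rule collapse_lattice) (use none that in blast)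
      then have "\<kappa> j x \<in> \<Lambda>" unfolding \<Lambda>_def \<kappa>_def by auto
      then have "\<delta> \<le> cmod (G j x)" unfolding \<delta>_def G_def using that V \<Lambda> by (intro Min_le) auto
      with that show False by simp
    qed
    then have "\<forall>j\<in>?S. \<exists>t. t \<le> d \<and> (\<exists>k::int. 0 < real M * (real B * x t - k) - rk j \<and> real M * (real B * x t - k) - rk j < 1)"
      by blast
    from bchoice[OF this] obtain \<tau> where \<tau>: "\<And>j. j \<in> ?S \<Longrightarrow> \<tau> j \<le> d"
      "\<And>j. j \<in> ?S \<Longrightarrow> \<exists>k::int. 0 < real M * (real B * x (\<tau> j) - k) - rk j \<and> real M * (real B * x (\<tau> j) - k) - rk j < 1"
      by auto
    \<comment> \<open>A coordinate lies in a strip of one residue only, so it accounts for the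
      smallness of one \<open>G j\<close>.\<close>
    have "inj_on \<tau> ?S"
    proof (rule inj_onI)
      fix i j assume ij: "i \<in> ?S" "j \<in> ?S" "\<tau> i = \<tau> j"
      obtain k k' :: int where "0 < real M * (real B * x (\<tau> i) - k) - rk i" "real M * (real B * x (\<tau> i) - k) - rk i < 1"
        "0 < real M * (real B * x (\<tau> i) - k') - rk j" "real M * (real B * x (\<tau> i) - k') - rk j < 1"
        using \<tau>(2)[OF ij(1)] \<tau>(2)[OF ij(2)] unfolding ij(3) by blast
      then have "rk i = rk j"
        by (rule collapse_strips_disjoint) (use ij rk(2) in auto)
      then show "i = j" using rk(1) ij by (auto dest: inj_onD)
    qed
    then have "card ?S \<le> card {..d}" by (rule card_inj_on_le) (use \<tau>(1) in auto)
    then show "card ?S \<le> d + 1" by simp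
  qed
qed

text \<open>The coordinates off the unit circle form the smallest \<sigma> whose polydisc contains
  z, so membership in the union is a condition on this one set.\<close>

lemma mem_moment_angle:
  assumes down: "\<forall>\<sigma>\<in>K. Pow \<sigma> \<subseteq> K"
  shows "z \<in> topspace (moment_angle K) \<longleftrightarrow>
    z \<in> extensional (\<Union>K) \<and> (\<forall>i\<in>\<Union>K. cmod (z i) \<le> 1) \<and> {i \<in> \<Union>K. cmod (z i) \<noteq> 1} \<in> K"
    (is "?L \<longleftrightarrow> ?R")
proof
  assume ?L
  then obtain \<sigma> where \<sigma>: "\<sigma> \<in> K" "z \<in> (\<Pi>\<^sub>E i\<in>\<Union>K. if i \<in> \<sigma> then cball 0 1 else sphere 0 1)"
    by (auto simp: moment_angle_def)
  have "cmod (z i) \<le> 1 \<and> (i \<notin> \<sigma> \<longrightarrow> cmod (z i) = 1)" if "i \<in> \<Union>K" for i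
    using PiE_mem[OF \<sigma>(2) that] by (auto split: if_splits)
  then have "{i \<in> \<Union>K. cmod (z i) \<noteq> 1} \<subseteq> \<sigma>" "\<forall>i\<in>\<Union>K. cmod (z i) \<le> 1" by blast+
  then have "{i \<in> \<Union>K. cmod (z i) \<noteq> 1} \<in> K" "\<forall>i\<in>\<Union>K. cmod (z i) \<le> 1" using \<sigma>(1) down by blast+
  moreover have "z \<in> extensional (\<Union>K)" using \<sigma>(2) by (simp add: PiE_def)
  ultimately show ?R by simp
next
  assume ?R
  then have "z \<in> (\<Pi>\<^sub>E i\<in>\<Union>K. if i \<in> {i \<in> \<Union>K. cmod (z i) \<noteq> 1} then cball 0 1 else sphere 0 1)"
    by (auto simp: PiE_def Pi_def)
  with \<open>?R\<close> show ?L by (auto simp: moment_angle_def PiE_def intro!: bexI[of _ "{i \<in> \<Union>K. cmod (z i) \<noteq> 1}"])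
qed

section \<open>Extension of maps from spheres over discs\<close>

definition disc :: "nat \<Rightarrow> (nat \<Rightarrow> real) set" where
  "disc d = {y. L2_set y {..d} \<le> 1 \<and> (\<forall>t>d. y t = 0)}"

lemma nsphere_eq: "nsphere d = top_of_set {y. L2_set y {..d} = 1 \<and> (\<forall>t>d. y t = 0)}"
proof -
  have "{x::nat \<Rightarrow> real. (\<Sum>i\<le>d. (x i)\<^sup>2) = 1 \<and> (\<forall>i>d. x i = 0)} = {y. L2_set y {..d} = 1 \<and> (\<forall>t>d. y t = 0)}"
    by (auto simp: L2_set_def)
  then show ?thesis by (simp add: nsphere euclidean_product_topology)
qed

lemma continuous_on_L2_set [continuous_intros]:
  fixes y :: "'a::topological_space \<Rightarrow> 'i \<Rightarrow> real"
  assumes "\<And>t. t \<in> A \<Longrightarrow> continuous_on S (\<lambda>x. y x t)"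
  shows "continuous_on S (\<lambda>x. L2_set (y x) A)"
  unfolding L2_set_def using assms by (intro continuous_intros)

lemma continuous_on_coordinate: "continuous_on S (\<lambda>y. y t)"
  by (rule continuous_on_subset[OF continuous_on_product_coordinates]) simp

lemma L2_set_ge: "\<lbrakk>finite A; t \<in> A\<rbrakk> \<Longrightarrow> \<bar>y t\<bar> \<le> L2_set y A"
  unfolding L2_set_def by (rule real_le_rsqrt) (auto intro!: member_le_sum[of t A "\<lambda>i. (y i)\<^sup>2"])

text \<open>Between radius 1 and 1/2 the approximation \<open>G\<close> is faded in, while the
  threshold \<open>s\<close>, below which a coordinate may stay off the circle, falls from 1 to
  \<delta>; there, only coordinates that f has off the circle at the projected point stay off it.
  Further inside, only the at most d + 1 coordinates with small \<open>G\<close> do. Both sets are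
  simplices.\<close>

lemma extend_over_disc:
  assumes down: "\<forall>\<sigma>\<in>K. Pow \<sigma> \<subseteq> K"
    and fin: "finite (\<Union>K)"
    and skeleton: "\<And>\<sigma>. \<lbrakk>\<sigma> \<subseteq> \<Union>K; card \<sigma> \<le> d + 1\<rbrakk> \<Longrightarrow> \<sigma> \<in> K"
    and f: "continuous_map (nsphere d) (moment_angle K) f"
  obtains E where "continuous_map (top_of_set (disc d)) (moment_angle K) E"
    "\<And>x. x \<in> topspace (nsphere d) \<Longrightarrow> E x = f x"
proof -
  define V where "V = \<Union>K"
  define S where "S = {y::nat \<Rightarrow> real. L2_set y {..d} = 1 \<and> (\<forall>t>d. y t = 0)}"
  have "closed {y :: nat \<Rightarrow> real. \<forall>t. t > d \<longrightarrow> y t = 0}"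
    by (intro closed_Collect_all closed_Collect_imp open_Collect_const closed_Collect_eq
        continuous_on_coordinate continuous_on_const)
  then have "closed S"
    unfolding S_def Collect_conj_eq
    by (intro closed_Int closed_Collect_eq continuous_on_L2_set continuous_on_coordinate continuous_on_const)
  have fS: "f x \<in> topspace (moment_angle K)" if "x \<in> S" for x
    using f that by (auto simp: continuous_map_def nsphere_eq S_def)
  \<comment> \<open>Each coordinate is extended separately with values in the whole plane; K is
    taken care of afterwards.\<close>
  have "\<exists>g. continuous_on UNIV g \<and> (\<forall>x\<in>S. g x = f x j)" if "j \<in> V" for j
  proof -
    have "continuous_on S (\<lambda>x. f x j)"
    proof -
      have "continuous_map (nsphere d) (product_topology (\<lambda>_. euclidean) V) f"
        using f unfolding moment_angle_def continuous_map_in_subtopology V_def by blast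
      then have "continuous_map (nsphere d) euclidean (\<lambda>x. f x j)"
        using that unfolding continuous_map_componentwise by blast
      then show ?thesis by (simp add: nsphere_eq S_def)
    qed
    moreover have "closedin (top_of_set UNIV) S" using \<open>closed S\<close> by simp
    ultimately obtain g where "continuous_on UNIV g" "\<And>x. x \<in> S \<Longrightarrow> g x = f x j"
      by (rule Tietze_unbounded) blast
    then show ?thesis by blast
  qed
  then have "\<forall>j\<in>V. \<exists>g. continuous_on UNIV g \<and> (\<forall>x\<in>S. g x = f x j)" by blast
  from bchoice[OF this] obtain F where F: "\<And>j. j \<in> V \<Longrightarrow> continuous_on UNIV (F j)" "\<And>j x. \<lbrakk>j \<in> V; x \<in> S\<rbrakk> \<Longrightarrow> F j x = f x j"
    by auto
  obtain G \<delta> where G: "\<And>j. j \<in> V \<Longrightarrow> continuous_on UNIV (G j)"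
    and \<delta>: "0 < \<delta>" "\<delta> \<le> 1/2"
    and near: "\<And>j x. \<lbrakk>j \<in> V; \<forall>t\<le>d. \<bar>x t\<bar> \<le> 1; \<forall>t>d. x t = 0\<rbrakk> \<Longrightarrow> cmod (G j x - F j x) \<le> 1/2"
    and few: "\<And>x. card {j \<in> V. cmod (G j x) < \<delta>} \<le> d + 1"
    by (rule generic_approximation[of V F d, OF _ F(1)]) (use fin in \<open>auto simp: V_def\<close>)
  \<comment> \<open>Dividing by \<open>m\<close> projects points of norm at least 1/2 to the sphere
    and doubles the others; the lower bound on \<open>m\<close> keeps this continuous at the
    origin.\<close>
  define m where "m y = max (1/2) (L2_set y {..d})" for y :: "nat \<Rightarrow> real"
  define \<pi> where "\<pi> y = (\<lambda>t. y t / m y)" for y :: "nat \<Rightarrow> real"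
  define \<tau> where "\<tau> y = min 1 (2 * (1 - L2_set y {..d}))" for y :: "nat \<Rightarrow> real"
  define s where "s y = 1 - \<tau> y * (1 - \<delta>)" for y
  define b where "b j y = of_real (1 - \<tau> y) * F j (\<pi> y) + of_real (\<tau> y) * G j (\<pi> y)" for j y
  \<comment> \<open>Coordinates with modulus of \<open>b\<close> at least \<open>s\<close> land on
    the circle, the others stay strictly inside.\<close>
  define E where "E y = (\<lambda>j\<in>V. b j y / of_real (max (s y) (cmod (b j y))))" for y
  have m0: "m y > 0" for y by (simp add: m_def)
  have \<tau>1: "\<tau> y \<le> 1" for y by (simp add: \<tau>_def)
  have s_ge: "s y \<ge> \<delta>" for y
  proof -
    have "\<tau> y * (1 - \<delta>) \<le> 1 * (1 - \<delta>)" using \<tau>1 \<delta> by (intro mult_right_mono) auto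
    then show ?thesis by (simp add: s_def)
  qed
  have [continuous_intros]: "continuous_on UNIV m"
    unfolding m_def by (intro continuous_intros continuous_on_coordinate)
  have [continuous_intros]: "continuous_on UNIV \<tau>"
    unfolding \<tau>_def by (intro continuous_intros continuous_on_coordinate)
  have [continuous_intros]: "continuous_on UNIV s"
    unfolding s_def by (intro continuous_intros)
  have \<pi>: "continuous_on UNIV \<pi>"
    unfolding \<pi>_def
    by (intro continuous_on_coordinatewise_then_product continuous_intros continuous_on_coordinate)
      (simp add: less_imp_neq[OF m0, symmetric])
  have [continuous_intros]: "continuous_on UNIV (b j)" if "j \<in> V" for j
    unfolding b_def
    using continuous_on_compose[OF \<pi> continuous_on_subset[OF F(1)[OF that]]]
      continuous_on_compose[OF \<pi> continuous_on_subset[OF G[OF that]]]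
    by (intro continuous_intros) (auto simp: o_def)
  have pos: "max (s y) (cmod (b j y)) > 0" for j y using s_ge[of y] \<delta> by (simp add: less_max_iff_disj)
  have contE: "continuous_on UNIV (\<lambda>y. E y j)" if "j \<in> V" for j
  proof -
    have "continuous_on UNIV (\<lambda>y. b j y / of_real (max (s y) (cmod (b j y))))"
      using that pos by (intro continuous_intros) (auto simp: less_imp_neq[symmetric])
    then show ?thesis using that by (simp add: E_def)
  qed
  have cmodE: "cmod (E y j) = cmod (b j y) / max (s y) (cmod (b j y))" if "j \<in> V" for y j
    using that pos[of y j] by (simp add: E_def norm_divide abs_of_pos)
  have E1: "cmod (E y j) = 1" if "j \<in> V" "cmod (b j y) \<ge> s y" for y j
    using that pos[of y j] by (simp add: cmodE max_def split: if_splits)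
  have E_mem: "E y \<in> topspace (moment_angle K)" if y: "y \<in> disc d" for y
  proof -
    have \<tau>0: "\<tau> y \<ge> 0" using y by (simp add: \<tau>_def disc_def)
    have small: "{j \<in> V. cmod (E y j) \<noteq> 1} \<subseteq> {j \<in> V. cmod (b j y) < s y}"
      using E1 by force
    have "{j \<in> V. cmod (b j y) < s y} \<in> K"
    proof (cases "L2_set y {..d} \<ge> 1/2")
      case True
      then have "L2_set (\<pi> y) {..d} = 1"
        using m0[of y] L2_set_right_distrib[of "1 / m y" y "{..d}"] by (simp add: \<pi>_def m_def field_simps)
      then have \<pi>S: "\<pi> y \<in> S" using y by (simp add: S_def disc_def \<pi>_def)
      \<comment> \<open>\<open>b\<close> differs from a value of modulus 1 by at most \<tau>/2, and
        \<tau>/2 \<le> \<tau> (1 - \<delta>) = 1 - s.\<close>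
      have "s y \<le> cmod (b j y)" if j: "j \<in> V" "cmod (f (\<pi> y) j) = 1" for j
      proof -
        have "cmod (G j (\<pi> y) - F j (\<pi> y)) \<le> 1/2"
          using \<pi>S L2_set_ge[of "{..d}" _ "\<pi> y"] by (intro near j) (auto simp: S_def)
        then have "cmod (of_real (\<tau> y) * (G j (\<pi> y) - F j (\<pi> y))) \<le> \<tau> y * (1/2)"
          unfolding norm_mult norm_of_real abs_of_nonneg[OF \<tau>0] using \<tau>0 by (rule mult_left_mono)
        moreover have "b j y = F j (\<pi> y) + of_real (\<tau> y) * (G j (\<pi> y) - F j (\<pi> y))"
          by (simp add: b_def algebra_simps)
        ultimately have "cmod (b j y) \<ge> cmod (F j (\<pi> y)) - \<tau> y * (1/2)"
          by (smt (verit) norm_diff_ineq)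
        moreover have "\<tau> y * (1/2) \<le> \<tau> y * (1 - \<delta>)" using \<tau>0 \<delta> by (intro mult_left_mono) auto
        ultimately show ?thesis using F(2)[OF j(1) \<pi>S] j(2) by (simp add: s_def)
      qed
      then have "{j \<in> V. cmod (b j y) < s y} \<subseteq> {j \<in> V. cmod (f (\<pi> y) j) \<noteq> 1}" by force
      moreover have "{j \<in> V. cmod (f (\<pi> y) j) \<noteq> 1} \<in> K"
        using fS[OF \<pi>S] mem_moment_angle[OF down] by (simp add: V_def)
      ultimately show ?thesis using down by blast
    next
      case False
      then have "\<tau> y = 1" by (simp add: \<tau>_def)
      then have "{j \<in> V. cmod (b j y) < s y} = {j \<in> V. cmod (G j (\<pi> y)) < \<delta>}"
        by (simp add: b_def s_def)
      then show ?thesis using few[of "\<pi> y"] by (intro skeleton) (auto simp: V_def)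
    qed
    then have "{j \<in> V. cmod (E y j) \<noteq> 1} \<in> K" using small down by blast
    moreover have "cmod (E y j) \<le> 1" if "j \<in> V" for j
      using pos[of y j] by (simp add: cmodE[OF that])
    moreover have "E y \<in> extensional V" by (simp add: E_def)
    ultimately show ?thesis unfolding mem_moment_angle[OF down] V_def by blast
  qed
  show ?thesis
  proof (rule that[of E])
    show "continuous_map (top_of_set (disc d)) (moment_angle K) E"
      unfolding moment_angle_def continuous_map_in_subtopology continuous_map_componentwise
    proof (intro conjI ballI)
      show "continuous_map (top_of_set (disc d)) euclidean (\<lambda>y. E y j)" if "j \<in> \<Union>K" for j
        using continuous_on_subset[OF contE] that by (auto simp: V_def)
      show "E ` topspace (top_of_set (disc d)) \<subseteq> extensional (\<Union>K)"
        by (auto simp: E_def V_def)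
      show "E \<in> topspace (top_of_set (disc d)) \<rightarrow> (\<Union>\<sigma>\<in>K. \<Pi>\<^sub>E i\<in>\<Union>K. if i \<in> \<sigma> then cball 0 1 else sphere 0 1)"
        using E_mem by (auto simp: moment_angle_def)
    qed
    show "E x = f x" if "x \<in> topspace (nsphere d)" for x
    proof
      fix j
      have xS: "x \<in> S" using that by (simp add: nsphere_eq S_def)
      then have 1: "L2_set x {..d} = 1" by (simp add: S_def)
      then have \<tau>: "\<tau> x = 0" by (simp add: \<tau>_def)
      have "\<pi> x = x" using 1 by (simp add: \<pi>_def m_def)
      then have b: "b j x = f x j" if "j \<in> V" using that F(2)[OF that xS] \<tau> by (simp add: b_def)
      have "cmod (f x j) \<le> 1" "f x \<in> extensional V" if "j \<in> V"
        using fS[OF xS] mem_moment_angle[OF down] that by (auto simp: V_def)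
      moreover have "f x \<in> extensional V" using fS[OF xS] mem_moment_angle[OF down] by (auto simp: V_def)
      ultimately show "E x j = f x j"
        using b \<tau> by (auto simp: E_def s_def extensional_def max_def)
    qed
  qed
qed

lemma disc_convex_combination:
  assumes "x \<in> disc d" "y \<in> disc d" "t \<in> {0..1}"
  shows "(\<lambda>i. (1 - t) * x i + t * y i) \<in> disc d"
proof -
  have "L2_set (\<lambda>i. (1 - t) * x i + t * y i) {..d} \<le> L2_set (\<lambda>i. (1 - t) * x i) {..d} + L2_set (\<lambda>i. t * y i) {..d}"
    by (rule L2_set_triangle_ineq)
  also have "\<dots> = (1 - t) * L2_set x {..d} + t * L2_set y {..d}"
    using assms(3) by (simp add: L2_set_right_distrib)
  also have "\<dots> \<le> (1 - t) * 1 + t * 1"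
    using assms by (intro add_mono mult_left_mono) (auto simp: disc_def)
  finally show ?thesis using assms by (simp add: disc_def)
qed

text \<open>Maps from spheres of dimension at most l extend over the disc; path-connectedness is the
  case of dimension 0. The straight-line contraction of the disc to the base point fixes that point,
  so the homotopy is relative to it.\<close>

theorem n_connected_moment_angle:
  assumes down: "\<forall>\<sigma>\<in>K. Pow \<sigma> \<subseteq> K"
    and fin: "finite (\<Union>K)"
    and skeleton: "\<And>\<sigma>. \<lbrakk>\<sigma> \<subseteq> \<Union>K; card \<sigma> \<le> l + 1\<rbrakk> \<Longrightarrow> \<sigma> \<in> K"
  shows "n_connected l (moment_angle K)"
  unfolding n_connected_def
proof (intro conjI ballI)
  have "{} \<in> K" by (rule skeleton) auto
  then have "(\<lambda>i\<in>\<Union>K. 1) \<in> topspace (moment_angle K)"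
    by (subst mem_moment_angle[OF down]) (auto cong: conj_cong)
  then show "topspace (moment_angle K) \<noteq> {}" by blast
next
  show "path_connected_space (moment_angle K)"
    unfolding path_connected_space_def
  proof (intro ballI)
    fix p q assume p: "p \<in> topspace (moment_angle K)" and q: "q \<in> topspace (moment_angle K)"
    \<comment> \<open>The formula is affine in the first coordinate, with value p at 1 and q at -1,
      the two points of the 0-sphere.\<close>
    define f where "f x = (\<lambda>j\<in>\<Union>K. of_real ((1 + x 0) / 2) * p j + of_real ((1 - x 0) / 2) * q j)" for x :: "nat \<Rightarrow> real"
    define e :: "nat \<Rightarrow> real" where "e = (\<lambda>i. if i = 0 then 1 else 0)"
    define e' :: "nat \<Rightarrow> real" where "e' = (\<lambda>i. if i = 0 then - 1 else 0)"
    have pq: "p \<in> extensional (\<Union>K)" "q \<in> extensional (\<Union>K)" using p q mem_moment_angle[OF down] by auto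
    have fe: "f e = p" "f e' = q"
      using pq by (auto simp: f_def e_def e'_def fun_eq_iff extensional_def)
    have sph: "x = e \<or> x = e'" if "x \<in> topspace (nsphere 0)" for x
      using that by (auto simp: nsphere_eq L2_set_def e_def e'_def fun_eq_iff abs_if split: if_splits)
    have ee: "e \<in> topspace (nsphere 0)" "e' \<in> topspace (nsphere 0)"
      by (auto simp: nsphere_eq L2_set_def e_def e'_def)
    have f: "continuous_map (nsphere 0) (moment_angle K) f"
      unfolding moment_angle_def continuous_map_in_subtopology continuous_map_componentwise
    proof (intro conjI ballI)
      show "continuous_map (nsphere 0) euclidean (\<lambda>y. f y j)" if "j \<in> \<Union>K" for j
        using that unfolding nsphere_eq f_def by (auto intro!: continuous_intros continuous_on_coordinate)
      show "f ` topspace (nsphere 0) \<subseteq> extensional (\<Union>K)" by (auto simp: f_def)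
      show "f \<in> topspace (nsphere 0) \<rightarrow> (\<Union>\<sigma>\<in>K. \<Pi>\<^sub>E i\<in>\<Union>K. if i \<in> \<sigma> then cball 0 1 else sphere 0 1)"
      proof
        fix x assume "x \<in> topspace (nsphere 0)"
        then have "f x \<in> topspace (moment_angle K)" using sph fe p q by metis
        then show "f x \<in> (\<Union>\<sigma>\<in>K. \<Pi>\<^sub>E i\<in>\<Union>K. if i \<in> \<sigma> then cball 0 1 else sphere 0 1)" by (auto simp: moment_angle_def)
      qed
    qed
    obtain E where E: "continuous_map (top_of_set (disc 0)) (moment_angle K) E"
      "\<And>x. x \<in> topspace (nsphere 0) \<Longrightarrow> E x = f x"
      by (rule extend_over_disc[OF down fin _ f]) (use skeleton in auto)
    define \<gamma> where "\<gamma> t = (\<lambda>i. (1 - t) * e i + t * e' i)" for t :: real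
    have sub: "e \<in> disc 0" "e' \<in> disc 0" using ee by (auto simp: nsphere_eq disc_def)
    have "continuous_map (top_of_set {0..1}) (top_of_set (disc 0)) \<gamma>"
      unfolding \<gamma>_def using disc_convex_combination[OF sub]
      by (auto intro!: continuous_on_coordinatewise_then_product continuous_intros)
    then have "pathin (moment_angle K) (E \<circ> \<gamma>)"
      unfolding pathin_def by (rule continuous_map_compose[OF _ E(1)])
    moreover have "\<gamma> 0 = e" "\<gamma> 1 = e'" by (auto simp: \<gamma>_def)
    ultimately show "\<exists>g. pathin (moment_angle K) g \<and> g 0 = p \<and> g 1 = q"
      using E(2) ee fe by (intro exI[of _ "E \<circ> \<gamma>"]) simp
  qed
next
  fix d x
  assume d: "d \<in> {1..l}" and x: "x \<in> topspace (moment_angle K)"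
  show "trivial_homotopy_group d (moment_angle K) x"
    unfolding trivial_homotopy_group_def
  proof (intro allI impI, elim conjE)
    fix f assume f: "continuous_map (nsphere d) (moment_angle K) f" and fx: "f sphere_base = x"
    obtain E where E: "continuous_map (top_of_set (disc d)) (moment_angle K) E"
      "\<And>x. x \<in> topspace (nsphere d) \<Longrightarrow> E x = f x"
      by (rule extend_over_disc[OF down fin _ f]) (use skeleton d in auto)
    have base: "sphere_base \<in> topspace (nsphere d)"
      unfolding sphere_base_def[abs_def] by (rule in_topspace_nsphere)
    have sub: "topspace (nsphere d) \<subseteq> disc d" by (auto simp: nsphere_eq disc_def)
    define \<phi> where "\<phi> = (\<lambda>(t, y). (\<lambda>i. (1 - t) * y i + t * sphere_base i))"
    have "continuous_map (prod_topology (top_of_set {0..1}) (nsphere d)) (top_of_set (disc d)) \<phi>"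
    proof -
      have "prod_topology (top_of_set {0..1::real}) (nsphere d) = top_of_set ({0..1} \<times> topspace (nsphere d))"
        unfolding nsphere_eq topspace_euclidean_subtopology subtopology_Times[symmetric] by simp
      moreover have "continuous_on S \<phi>" for S
      proof -
        have "continuous_on S (\<lambda>p. snd p i)" for i :: nat and S :: "(real \<times> (nat \<Rightarrow> real)) set"
          using continuous_on_compose2[OF continuous_on_coordinate[of UNIV i] continuous_on_snd[OF continuous_on_id]] by auto
        then show ?thesis
          unfolding \<phi>_def case_prod_beta
          by (intro continuous_on_coordinatewise_then_product continuous_intros)
      qed
      moreover have "\<phi> (t, y) \<in> disc d" if "t \<in> {0..1}" "y \<in> topspace (nsphere d)" for t y
        using disc_convex_combination[of y d sphere_base t] that base sub by (auto simp: \<phi>_def)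
      ultimately show ?thesis by auto
    qed
    then have cont: "continuous_map (prod_topology (top_of_set {0..1}) (nsphere d)) (moment_angle K) (E \<circ> \<phi>)"
      by (rule continuous_map_compose[OF _ E(1)])
    have \<phi>base: "\<phi> (t, sphere_base) = sphere_base" for t by (auto simp: \<phi>_def algebra_simps)
    have \<phi>1: "\<phi> (1, y) = sphere_base" "\<phi> (0, y) = y" for y by (auto simp: \<phi>_def)
    show "homotopic_with (\<lambda>h. h sphere_base = x) (nsphere d) (moment_angle K) f (\<lambda>_. x)"
    proof (subst homotopic_with)
      show "(h sphere_base = x) = (k sphere_base = x)" if "\<And>x. x \<in> topspace (nsphere d) \<Longrightarrow> h x = k x" for h k :: "(nat \<Rightarrow> real) \<Rightarrow> nat \<Rightarrow> complex"
        using that base by simp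
      show "\<exists>h. continuous_map (prod_topology (top_of_set {0..1::real}) (nsphere d)) (moment_angle K) h \<and>
          (\<forall>x\<in>topspace (nsphere d). h (0, x) = f x) \<and> (\<forall>xa\<in>topspace (nsphere d). h (1, xa) = x) \<and>
          (\<forall>t\<in>{0..1}. h (t, sphere_base) = x)"
        by (rule exI[of _ "E \<circ> \<phi>"]) (use cont E(2) base fx in \<open>simp add: \<phi>base \<phi>1\<close>)
    qed
  qed
qed

section \<open>Massey products in differential graded algebras\<close>

lemma bar_bar: "bar m (bar n x) = bar (m + n) (x :: 'a::ab_group_add)"
  by (auto simp: bar_def)

lemma bar_0: "bar n 0 = (0 :: 'a::ab_group_add)"
  by (simp add: bar_def)

lemma bar_add: "bar n (x + y) = bar n x + bar n (y :: 'a::ab_group_add)"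
  by (simp add: bar_def)

lemma bar_sum: "bar n (\<Sum>t\<in>T. f t) = (\<Sum>t\<in>T. bar n (f t :: 'a::ab_group_add))"
  by (simp add: bar_def sum_negf)

lemma bar_even: "even (m - n) \<Longrightarrow> bar m x = bar n x"
  by (simp add: bar_def)

lemma bar_odd: "odd (m - n) \<Longrightarrow> bar m x = - bar n (x :: 'a::ab_group_add)"
  by (auto simp: bar_def)

text \<open>A product of the entries (i, t) and (t, j) has the degree of the differential of entry
  (i, j). The signs in the sequel rest on the resulting parity.\<close>

lemma entry_degree_split:
  "\<lbrakk>i \<le> t; t \<le> j\<rbrakk> \<Longrightarrow> entry_degree ns i t + entry_degree ns t j = entry_degree ns i j + 1"
  unfolding entry_degree_def using sum.atLeastLessThan_concat[of i t j ns] by simp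

lemma entry_degree_Suc: "entry_degree ns i (Suc i) = ns i"
  by (simp add: entry_degree_def)

locale dg_algebra =
  fixes A :: "'a::ab_group_add dga"
  assumes mult_add_left: "mult A (x + y) z = mult A x z + mult A y z"
    and mult_add_right: "mult A x (y + z) = mult A x y + mult A x z"
    and mult_assoc: "mult A (mult A x y) z = mult A x (mult A y z)"
    and diff_add: "diff A (x + y) = diff A x + diff A y"
    and diff_diff: "x \<in> grade A n \<Longrightarrow> diff A (diff A x) = 0"
    and Leibniz: "\<lbrakk>x \<in> grade A m; y \<in> grade A n\<rbrakk> \<Longrightarrow>
      diff A (mult A x y) = mult A (diff A x) y + bar m (mult A x (diff A y))"
    and grade_0: "0 \<in> grade A n"
    and grade_add: "\<lbrakk>x \<in> grade A n; y \<in> grade A n\<rbrakk> \<Longrightarrow> x + y \<in> grade A n"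
    and grade_uminus: "x \<in> grade A n \<Longrightarrow> - x \<in> grade A n"
    and grade_mult: "\<lbrakk>x \<in> grade A m; y \<in> grade A n\<rbrakk> \<Longrightarrow> mult A x y \<in> grade A (m + n)"
    and grade_diff: "x \<in> grade A n \<Longrightarrow> diff A x \<in> grade A (n + 1)"
begin

abbreviation mul (infixl "\<cdot>" 70) where "x \<cdot> y \<equiv> mult A x y"
abbreviation d where "d \<equiv> diff A"

lemma mult_0_left: "0 \<cdot> x = 0" using mult_add_left[of 0 0 x] by simp
lemma mult_0_right: "x \<cdot> 0 = 0" using mult_add_right[of x 0 0] by simp
lemma diff_0: "d 0 = 0" using diff_add[of 0 0] by simp

lemma mult_minus_left: "(- x) \<cdot> y = - (x \<cdot> y)"
  using mult_add_left[of x "- x" y] by (simp add: mult_0_left eq_neg_iff_add_eq_0 add.commute)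

lemma mult_minus_right: "x \<cdot> (- y) = - (x \<cdot> y)"
  using mult_add_right[of x y "- y"] by (simp add: mult_0_right eq_neg_iff_add_eq_0 add.commute)

lemma diff_minus: "d (- x) = - d x"
  using diff_add[of x "- x"] by (simp add: diff_0 eq_neg_iff_add_eq_0 add.commute)

lemma diff_minus2: "d (x - y) = d x - d y"
  using diff_add[of x "- y"] by (simp add: diff_minus)

lemma mult_sum_left: "(\<Sum>t\<in>T. f t) \<cdot> x = (\<Sum>t\<in>T. f t \<cdot> x)"
  by (induction T rule: infinite_finite_induct) (auto simp: mult_0_left mult_add_left)

lemma mult_sum_right: "x \<cdot> (\<Sum>t\<in>T. f t) = (\<Sum>t\<in>T. x \<cdot> f t)"
  by (induction T rule: infinite_finite_induct) (auto simp: mult_0_right mult_add_right)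

lemma diff_sum: "d (\<Sum>t\<in>T. f t) = (\<Sum>t\<in>T. d (f t))"
  by (induction T rule: infinite_finite_induct) (auto simp: diff_0 diff_add)

lemma bar_mult_left: "bar n x \<cdot> y = bar n (x \<cdot> y)"
  by (simp add: bar_def mult_minus_left)

lemma bar_mult_right: "x \<cdot> bar n y = bar n (x \<cdot> y)"
  by (simp add: bar_def mult_minus_right)

lemma diff_bar: "d (bar n x) = bar n (d x)"
  by (simp add: bar_def diff_minus)

lemma grade_bar: "x \<in> grade A n \<Longrightarrow> bar m x \<in> grade A n"
  by (simp add: bar_def grade_uminus)

lemma grade_minus: "\<lbrakk>x \<in> grade A n; y \<in> grade A n\<rbrakk> \<Longrightarrow> x - y \<in> grade A n"
  using grade_add[of x n "- y"] grade_uminus by simp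

lemma grade_sum: "(\<And>t. t \<in> T \<Longrightarrow> f t \<in> grade A n) \<Longrightarrow> (\<Sum>t\<in>T. f t) \<in> grade A n"
  by (induction T rule: infinite_finite_induct) (auto simp: grade_0 grade_add)

lemma coh_class_self: "x \<in> cocycles A n \<Longrightarrow> x \<in> coh_class A n x"
  unfolding coh_class_def using grade_0[of "n - 1"] diff_0 by (auto intro!: image_eqI[of _ _ 0])

lemma coh_class_shift:
  assumes "x - y = d z" "z \<in> grade A (n - 1)"
  shows "coh_class A n x = coh_class A n y"
proof -
  have "v - x \<in> d ` grade A (n - 1) \<longleftrightarrow> v - y \<in> d ` grade A (n - 1)" for v
  proof
    assume "v - x \<in> d ` grade A (n - 1)"
    then obtain u where u: "v - x = d u" "u \<in> grade A (n - 1)" by blast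
    have "v - y = d (u + z)" using u(1) assms(1) by (simp add: diff_add algebra_simps)
    then show "v - y \<in> d ` grade A (n - 1)" using grade_add[OF u(2) assms(2)] by blast
  next
    assume "v - y \<in> d ` grade A (n - 1)"
    then obtain u where u: "v - y = d u" "u \<in> grade A (n - 1)" by blast
    have "v - x = d (u - z)" using u(1) assms(1) by (simp add: diff_minus2 algebra_simps)
    then show "v - x \<in> d ` grade A (n - 1)" using grade_minus[OF u(2) assms(2)] by blast
  qed
  then show ?thesis by (simp add: coh_class_def)
qed

lemma coh_class_diff:
  assumes "\<alpha> \<in> cohomology A n" "x \<in> \<alpha>" "y \<in> \<alpha>"
  obtains z where "z \<in> grade A (n - 1)" "x - y = d z"
proof -
  obtain w where "\<alpha> = coh_class A n w" using assms(1) by (auto simp: cohomology_def)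
  then obtain u v where "x - w = d u" "y - w = d v" "u \<in> grade A (n - 1)" "v \<in> grade A (n - 1)"
    using assms(2,3) by (auto simp: coh_class_def)
  then have "x - y = d (u - v)" "u - v \<in> grade A (n - 1)"
    by (auto simp: diff_minus2 grade_minus algebra_simps)
  with that show ?thesis by blast
qed

lemma coh_class_add_diff:
  assumes "\<alpha> \<in> cohomology A n" "x \<in> \<alpha>" "z \<in> grade A (n - 1)"
  shows "x + d z \<in> \<alpha>"
proof -
  obtain w where w: "\<alpha> = coh_class A n w" using assms(1) by (auto simp: cohomology_def)
  then obtain u where u: "x - w = d u" "u \<in> grade A (n - 1)" "x \<in> cocycles A n"
    using assms(2) by (auto simp: coh_class_def)
  have "x + d z - w = d (u + z)" using u(1) by (simp add: diff_add algebra_simps)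
  moreover have "x + d z \<in> cocycles A n"
    using u(3) assms(3) grade_diff[OF assms(3)] diff_diff[OF assms(3)] by (auto simp: cocycles_def grade_add diff_add)
  ultimately show ?thesis unfolding w coh_class_def using grade_add[OF u(2) assms(3)] by blast
qed

text \<open>Strict triangularity confines the matrix product to i < t < j. On and below the diagonal
  the equations are void, except that for k = 0 the corner (1, k + 1) is on the diagonal and forces
  a = 0.\<close>

lemma defining_system_iff:
  "defining_system A k ns \<alpha> c a \<longleftrightarrow>
    (\<forall>i\<in>{1..k+1}. \<forall>j\<in>{1..k+1}. if i \<ge> j then c i j = 0 else c i j \<in> grade A (entry_degree ns i j)) \<and>
    (\<forall>i\<in>{1..k}. c i (i + 1) \<in> \<alpha> i) \<and>
    (\<forall>i\<in>{1..k+1}. \<forall>j\<in>{1..k+1}. i < j \<longrightarrow> (if i = 1 \<and> j = k + 1 then a else 0) =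
        d (c i j) - (\<Sum>t\<in>{i<..<j}. bar (entry_degree ns i t) (c i t) \<cdot> c t j)) \<and> (k = 0 \<longrightarrow> a = 0)"
    (is "_ \<longleftrightarrow> ?G \<and> ?M \<and> ?E \<and> ?Z")
proof -
  let ?s = "\<lambda>i t j. bar (entry_degree ns i t) (c i t) \<cdot> c t j"
  let ?E' = "\<forall>i\<in>{1..k+1}. \<forall>j\<in>{1..k+1}. (if i = 1 \<and> j = k + 1 then a else 0) =
        d (c i j) - (\<Sum>t=1..k+1. ?s i t j)"
  have eq: "?E' \<longleftrightarrow> ?E \<and> ?Z" if G: ?G
  proof -
    have *: "(\<Sum>t=1..k+1. ?s i t j) = (\<Sum>t\<in>{i<..<j}. ?s i t j)" if "i \<in> {1..k+1}" "j \<in> {1..k+1}" for i j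
    proof (rule sum.mono_neutral_right)
      show "\<forall>t\<in>{1..k+1} - {i<..<j}. ?s i t j = 0"
      proof
        fix t assume t: "t \<in> {1..k+1} - {i<..<j}"
        then consider "t \<le> i" | "t \<ge> j" by fastforce
        then show "?s i t j = 0"
          using G that t by cases (auto simp: bar_0 mult_0_left mult_0_right)
      qed
    qed (use that in auto)
    let ?Q = "\<lambda>i j. (if i = 1 \<and> j = k + 1 then a else 0) = d (c i j) - (\<Sum>t=1..k+1. ?s i t j)"
    have low: "?Q i j \<longleftrightarrow> (k = 0 \<longrightarrow> a = 0)" if "i \<in> {1..k+1}" "j \<in> {1..k+1}" "j \<le> i" for i j
      using G that unfolding *[OF that(1,2)] by (auto simp: diff_0)
    have one: "1 \<in> {1..k+1}" by simp
    show ?thesis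
    proof (intro iffI conjI)
      assume Q: ?E'
      show ?E
      proof (intro ballI impI)
        fix i j assume ij: "i \<in> {1..k+1}" "j \<in> {1..k+1}"
        show "(if i = 1 \<and> j = k + 1 then a else 0) = d (c i j) - (\<Sum>t\<in>{i<..<j}. ?s i t j)"
          using bspec[OF bspec[OF Q ij(1)] ij(2)] unfolding *[OF ij] .
      qed
      have "?Q 1 1" by (rule bspec[OF bspec[OF Q one] one])
      then show ?Z using low[OF one one] by blast
    next
      assume E: "?E \<and> ?Z"
      show ?E'
      proof (intro ballI)
        fix i j assume ij: "i \<in> {1..k+1}" "j \<in> {1..k+1}"
        show "?Q i j"
        proof (cases "j \<le> i")
          case True
          then show ?thesis using low[OF ij] E by blast
        next
          case False
          then show ?thesis unfolding *[OF ij] using E ij by simp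
        qed
      qed
    qed
  qed
  have conj: "(G \<Longrightarrow> E' \<longleftrightarrow> X) \<Longrightarrow> (G \<and> M \<and> E' \<longleftrightarrow> G \<and> M \<and> X)" for G M E' X :: bool by blast
  show ?thesis unfolding defining_system_def by (rule conj) (rule eq)
qed

lemma defining_system_grade:
  "\<lbrakk>defining_system A k ns \<alpha> c a; 1 \<le> i; i < j; j \<le> k + 1\<rbrakk> \<Longrightarrow> c i j \<in> grade A (entry_degree ns i j)"
  unfolding defining_system_iff by (auto split: if_splits)

lemma defining_system_equation:
  assumes "defining_system A k ns \<alpha> c a" "1 \<le> i" "i < j" "j \<le> k + 1"
  shows "(if i = 1 \<and> j = k + 1 then a else 0) =
    d (c i j) - (\<Sum>t\<in>{i<..<j}. bar (entry_degree ns i t) (c i t) \<cdot> c t j)"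
proof -
  have "i \<in> {1..k+1}" "j \<in> {1..k+1}" using assms by auto
  from bspec[OF bspec[OF assms(1)[unfolded defining_system_iff, THEN conjunct2, THEN conjunct2, THEN conjunct1] this(1)] this(2)]
  show ?thesis using assms(3) by blast
qed

lemma defining_system_diff:
  assumes "defining_system A k ns \<alpha> c a" "1 \<le> i" "i < j" "j \<le> k + 1" "\<not> (i = 1 \<and> j = k + 1)"
  shows "d (c i j) = (\<Sum>t\<in>{i<..<j}. bar (entry_degree ns i t) (c i t) \<cdot> c t j)"
  using defining_system_equation[OF assms(1-4)] unfolding if_not_P[OF assms(5)] by simp

lemma defining_system_value:
  assumes "defining_system A k ns \<alpha> c a" "k \<ge> 1"
  shows "a = d (c 1 (k + 1)) - (\<Sum>t\<in>{1<..<k+1}. bar (entry_degree ns 1 t) (c 1 t) \<cdot> c t (k + 1))"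
  using defining_system_equation[OF assms(1), of 1 "k + 1"] assms(2) by simp

lemma grade_product_term:
  assumes "defining_system A k ns \<alpha> c a" "1 \<le> i" "i < t" "t < j" "j \<le> k + 1"
  shows "bar (entry_degree ns i t) (c i t) \<cdot> c t j \<in> grade A (entry_degree ns i j + 1)"
proof -
  have "bar (entry_degree ns i t) (c i t) \<cdot> c t j \<in> grade A (entry_degree ns i t + entry_degree ns t j)"
    by (intro grade_mult grade_bar defining_system_grade[OF assms(1)]) (use assms in auto)
  then show ?thesis using entry_degree_split[of i t j ns] assms by simp
qed

text \<open>Differentiating the sum produces each triple product over 1 < u < t < k + 1 twice, from
  the left factor and from the right one. The signs are opposite, since the degrees of (1, u) and
  (u, t) add up to that of (1, t) plus one.\<close>

lemma defining_system_cocycle: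
  assumes ds: "defining_system A k ns \<alpha> c a" and k: "k \<ge> 1"
  shows "d a = 0" "a \<in> grade A (entry_degree ns 1 (k + 1) + 1)"
proof -
  let ?e = "entry_degree ns"
  let ?n = "k + 1"
  have g: "c i j \<in> grade A (?e i j)" if "1 \<le> i" "i < j" "j \<le> ?n" for i j
    using defining_system_grade[OF ds that] .
  show "a \<in> grade A (?e 1 ?n + 1)"
    unfolding defining_system_value[OF ds k]
    by (intro grade_minus grade_diff g grade_sum grade_product_term[OF ds]) (use k in auto)
  have d: "d (bar (?e 1 t) (c 1 t) \<cdot> c t ?n) =
      (\<Sum>u\<in>{1<..<t}. bar (?e 1 t + ?e 1 u) (c 1 u \<cdot> (c u t \<cdot> c t ?n))) +
      (\<Sum>u\<in>{t<..<?n}. bar (?e t u) (c 1 t \<cdot> (c t u \<cdot> c u ?n)))" if "t \<in> {1<..<?n}" for t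
  proof -
    have "d (bar (?e 1 t) (c 1 t) \<cdot> c t ?n) =
       bar (?e 1 t) (d (c 1 t)) \<cdot> c t ?n + bar (?e 1 t) (bar (?e 1 t) (c 1 t) \<cdot> d (c t ?n))"
      using that by (subst Leibniz[OF grade_bar[OF g] g]) (auto simp: diff_bar)
    also have "d (c 1 t) = (\<Sum>u\<in>{1<..<t}. bar (?e 1 u) (c 1 u) \<cdot> c u t)"
      by (rule defining_system_diff[OF ds]) (use that in auto)
    also have "d (c t ?n) = (\<Sum>u\<in>{t<..<?n}. bar (?e t u) (c t u) \<cdot> c u ?n)"
      by (rule defining_system_diff[OF ds]) (use that in auto)
    finally show ?thesis
      by (simp add: bar_sum mult_sum_left mult_sum_right bar_mult_left bar_mult_right bar_bar mult_assoc)
        (intro sum.cong refl bar_even; simp)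
  qed
  have "(\<Sum>t\<in>{1<..<?n}. d (bar (?e 1 t) (c 1 t) \<cdot> c t ?n)) =
     (\<Sum>t\<in>{1<..<?n}. \<Sum>u\<in>{1<..<t}. bar (?e 1 t + ?e 1 u) (c 1 u \<cdot> (c u t \<cdot> c t ?n))) +
     (\<Sum>t\<in>{1<..<?n}. \<Sum>u\<in>{t<..<?n}. bar (?e t u) (c 1 t \<cdot> (c t u \<cdot> c u ?n)))"
    by (simp only: d sum.distrib cong: sum.cong)
  \<comment> \<open>The order of summation is changed so that both double sums run over the same
    pairs.\<close>
  also have "(\<Sum>t\<in>{1<..<?n}. \<Sum>u\<in>{t<..<?n}. bar (?e t u) (c 1 t \<cdot> (c t u \<cdot> c u ?n))) =
      (\<Sum>u\<in>{1<..<?n}. \<Sum>t\<in>{1<..<u}. bar (?e t u) (c 1 t \<cdot> (c t u \<cdot> c u ?n)))"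
    unfolding sum.Sigma[OF finite_greaterThanLessThan ballI[OF finite_greaterThanLessThan]]
    by (rule sum.reindex_bij_witness[of _ "\<lambda>(a, b). (b, a)" "\<lambda>(a, b). (b, a)"]) auto
  also have "\<dots> = (\<Sum>t\<in>{1<..<?n}. \<Sum>u\<in>{1<..<t}. - bar (?e 1 t + ?e 1 u) (c 1 u \<cdot> (c u t \<cdot> c t ?n)))"
  proof (intro sum.cong refl)
    fix t u assume "t \<in> {1<..<?n}" "u \<in> {1<..<t}"
    then have "?e 1 u + ?e u t = ?e 1 t + 1" by (intro entry_degree_split) auto
    then have "odd (?e u t - (?e 1 t + ?e 1 u))" by presburger
    then show "bar (?e u t) (c 1 u \<cdot> (c u t \<cdot> c t ?n)) = - bar (?e 1 t + ?e 1 u) (c 1 u \<cdot> (c u t \<cdot> c t ?n))"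
      by (rule bar_odd)
  qed
  finally have "(\<Sum>t\<in>{1<..<?n}. d (bar (?e 1 t) (c 1 t) \<cdot> c t ?n)) = 0"
    by (simp add: sum_negf)
  then show "d a = 0"
    unfolding defining_system_value[OF ds k]
    using diff_diff[OF g[of 1 ?n]] k by (simp add: diff_minus2 diff_sum)
qed

end

section \<open>Gauge transformations of defining systems\<close>

context dg_algebra
begin

text \<open>Up to signs, C is conjugated by 1 + b E with E the elementary matrix at (p, q):
  \<open>d b\<close> enters at (p, q), multiples of b enter row p to the right of q and column q
  above p. Terms quadratic in b vanish because p < q. Every equation survives, that of the corner
  included, so the value is unchanged; entries on shorter diagonals are untouched.\<close>

lemma defining_system_gauge:
  assumes ds: "defining_system A k ns \<alpha> c a"
    and \<alpha>: "\<And>i. i \<in> {1..k} \<Longrightarrow> \<alpha> i \<in> cohomology A (ns i)"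
    and pq: "1 \<le> p" "p < q" "q \<le> k + 1" "\<not> (p = 1 \<and> q = k + 1)"
    and b: "b \<in> grade A (entry_degree ns p q - 1)"
  obtains c' where "defining_system A k ns \<alpha> c' a" "c' p q = c p q + d b"
    "\<And>i j. (i, j) \<noteq> (p, q) \<Longrightarrow> j - i \<le> q - p \<Longrightarrow> i < j \<Longrightarrow> c' i j = c i j"
proof -
  let ?e = "entry_degree ns"
  define g where "g i j = (if i = p then if j = q then d b else if q < j then bar (?e p q) (b \<cdot> c q j) else 0
    else if j = q \<and> i < p then c i p \<cdot> b else 0)" for i j
  define c' where "c' i j = c i j + g i j" for i j
  have G: "c i j \<in> grade A (?e i j)" if "1 \<le> i" "i < j" "j \<le> k + 1" for i j
    using defining_system_grade[OF ds that] .
  have E: "d (c i j) = (\<Sum>t\<in>{i<..<j}. bar (?e i t) (c i t) \<cdot> c t j)"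
    if "1 \<le> i" "i < j" "j \<le> k + 1" "\<not> (i = 1 \<and> j = k + 1)" for i j
    using defining_system_diff[OF ds that] .
  have b_left: "b \<cdot> c q j \<in> grade A (?e p j)" if "q < j" "j \<le> k + 1" for j
  proof -
    have "?e p q - 1 + ?e q j = ?e p j" using entry_degree_split[of p q j ns] that pq by simp
    then show ?thesis using grade_mult[OF b G[of q j]] that pq by simp
  qed
  have b_right: "c i p \<cdot> b \<in> grade A (?e i q)" if "1 \<le> i" "i < p" for i
  proof -
    have "?e i p + (?e p q - 1) = ?e i q" using entry_degree_split[of i p q ns] that pq by simp
    then show ?thesis using grade_mult[OF G[of i p] b] that pq by simp
  qed
  have db: "d b \<in> grade A (?e p q)" using grade_diff[OF b] by simp
  have gG: "g i j \<in> grade A (?e i j)" if "1 \<le> i" "i < j" "j \<le> k + 1" for i j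
    unfolding g_def using that db b_left b_right by (auto simp: grade_0 grade_bar)
  have g0: "g i j = 0" if "i \<in> {1..k+1}" "j \<in> {1..k+1}" "j \<le> i" for i j
    using that pq by (auto simp: g_def)
  have eq: "d (c' i j) - (\<Sum>t\<in>{i<..<j}. bar (?e i t) (c' i t) \<cdot> c' t j) =
      d (c i j) - (\<Sum>t\<in>{i<..<j}. bar (?e i t) (c i t) \<cdot> c t j)"
    if ij: "1 \<le> i" "i < j" "j \<le> k + 1" for i j
  proof -
    have expand: "(\<Sum>t\<in>{i<..<j}. bar (?e i t) (c' i t) \<cdot> c' t j) = (\<Sum>t\<in>{i<..<j}. bar (?e i t) (c i t) \<cdot> c t j) +
        ((\<Sum>t\<in>{i<..<j}. bar (?e i t) (g i t) \<cdot> c t j) + (\<Sum>t\<in>{i<..<j}. bar (?e i t) (c i t) \<cdot> g t j) +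
         (\<Sum>t\<in>{i<..<j}. bar (?e i t) (g i t) \<cdot> g t j))"
      by (simp add: c'_def bar_add mult_add_left mult_add_right sum.distrib)
    have gg: "(\<Sum>t\<in>{i<..<j}. bar (?e i t) (g i t) \<cdot> g t j) = 0"
      by (rule sum.neutral) (use pq in \<open>auto simp: g_def bar_0 mult_0_left mult_0_right\<close>)
    have "d (g i j) = (\<Sum>t\<in>{i<..<j}. bar (?e i t) (g i t) \<cdot> c t j) + (\<Sum>t\<in>{i<..<j}. bar (?e i t) (c i t) \<cdot> g t j)"
    proof -
      consider (A) "i = p" "j = q" | (B) "i = p" "q < j" | (C) "i < p" "j = q" | (D) "i < p" "q < j"
        | (E) "i > p \<or> (i = p \<and> j < q) \<or> (i < p \<and> j < q)" by linarith
      then show ?thesis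
      proof cases
        case A
        have "(\<Sum>t\<in>{i<..<j}. bar (?e i t) (g i t) \<cdot> c t j) = 0" "(\<Sum>t\<in>{i<..<j}. bar (?e i t) (c i t) \<cdot> g t j) = 0"
          using A by (auto intro!: sum.neutral simp: g_def bar_0 mult_0_left mult_0_right)
        then show ?thesis using A diff_diff[OF b] by (simp add: g_def)
      next
        case B
        have r: "(\<Sum>t\<in>{i<..<j}. bar (?e i t) (c i t) \<cdot> g t j) = 0"
          using B by (auto intro!: sum.neutral simp: g_def mult_0_right)
        have "(\<Sum>t\<in>{i<..<j}. bar (?e i t) (g i t) \<cdot> c t j) = (\<Sum>t\<in>insert q {q<..<j}. bar (?e i t) (g i t) \<cdot> c t j)"
          by (rule sum.mono_neutral_right) (use B pq in \<open>auto simp: g_def bar_0 mult_0_left\<close>)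
        also have "\<dots> = bar (?e p q) (d b) \<cdot> c q j + (\<Sum>t\<in>{q<..<j}. bar (?e p t) (bar (?e p q) (b \<cdot> c q t)) \<cdot> c t j)"
          using B by (simp add: g_def)
        also have "(\<Sum>t\<in>{q<..<j}. bar (?e p t) (bar (?e p q) (b \<cdot> c q t)) \<cdot> c t j) =
            (\<Sum>t\<in>{q<..<j}. bar (?e p q) (bar (?e p q - 1) (bar (?e q t) (b \<cdot> (c q t \<cdot> c t j)))))"
        proof (rule sum.cong[OF refl])
          fix t assume "t \<in> {q<..<j}"
          then have "?e p q + ?e q t = ?e p t + 1" using pq by (intro entry_degree_split) auto
          then have "even (?e p t + ?e p q - (?e p q + (?e p q - 1 + ?e q t)))" "even (?e p t + ?e p q - (?e p q + (?e p q - 1) + ?e q t))"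
            by presburger+
          then show "bar (?e p t) (bar (?e p q) (b \<cdot> c q t)) \<cdot> c t j =
              bar (?e p q) (bar (?e p q - 1) (bar (?e q t) (b \<cdot> (c q t \<cdot> c t j))))"
            unfolding bar_bar bar_mult_left mult_assoc by (intro bar_even)
        qed
        also have "\<dots> = bar (?e p q) (bar (?e p q - 1) (b \<cdot> d (c q j)))"
          using B pq ij by (subst E) (auto simp: mult_sum_right bar_sum bar_mult_left bar_mult_right)
        also have "bar (?e p q) (d b) \<cdot> c q j + \<dots> = d (g i j)"
          using B pq Leibniz[OF b G[of q j]] ij
          by (simp add: g_def diff_bar bar_add bar_mult_left)
        finally show ?thesis using r by simp
      next
        case C
        have l: "(\<Sum>t\<in>{i<..<j}. bar (?e i t) (g i t) \<cdot> c t j) = 0"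
          using C by (auto intro!: sum.neutral simp: g_def bar_0 mult_0_left)
        have "(\<Sum>t\<in>{i<..<j}. bar (?e i t) (c i t) \<cdot> g t j) = (\<Sum>t\<in>insert p {i<..<p}. bar (?e i t) (c i t) \<cdot> g t j)"
          by (rule sum.mono_neutral_right) (use C pq in \<open>auto simp: g_def mult_0_right\<close>)
        also have "\<dots> = bar (?e i p) (c i p) \<cdot> d b + (\<Sum>t\<in>{i<..<p}. bar (?e i t) (c i t) \<cdot> (c t p \<cdot> b))"
          using C pq by (simp add: g_def)
        also have "(\<Sum>t\<in>{i<..<p}. bar (?e i t) (c i t) \<cdot> (c t p \<cdot> b)) = d (c i p) \<cdot> b"
          using C pq ij by (subst E) (auto simp: mult_sum_left mult_assoc)
        also have "bar (?e i p) (c i p) \<cdot> d b + d (c i p) \<cdot> b = d (g i j)"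
          using C pq ij Leibniz[OF G[of i p] b] by (simp add: g_def bar_mult_left)
        finally show ?thesis using l by simp
      next
        \<comment> \<open>Here g vanishes, but each sum has one term, at t = q and at t = p. Both
          are \<open>c i p\<close>, b, \<open>c q j\<close> multiplied together, with opposite signs
          by the degree relation.\<close>
        case D
        have "(\<Sum>t\<in>{i<..<j}. bar (?e i t) (g i t) \<cdot> c t j) = (\<Sum>t\<in>{q}. bar (?e i t) (g i t) \<cdot> c t j)"
          by (rule sum.mono_neutral_right) (use D pq in \<open>auto simp: g_def bar_0 mult_0_left\<close>)
        moreover have "(\<Sum>t\<in>{i<..<j}. bar (?e i t) (c i t) \<cdot> g t j) = (\<Sum>t\<in>{p}. bar (?e i t) (c i t) \<cdot> g t j)"
          by (rule sum.mono_neutral_right) (use D pq in \<open>auto simp: g_def mult_0_right\<close>)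
        moreover have "?e i p + ?e p q = ?e i q + 1" using D pq by (intro entry_degree_split) auto
        then have "odd (?e i q - (?e p q + ?e i p))" by presburger
        then have "bar (?e i q) (c i p \<cdot> (b \<cdot> c q j)) = - bar (?e p q + ?e i p) (c i p \<cdot> (b \<cdot> c q j))"
          by (rule bar_odd)
        moreover have "g i j = 0" using D pq by (simp add: g_def)
        ultimately show ?thesis
          using D pq by (simp add: g_def diff_0 bar_bar bar_mult_left bar_mult_right mult_assoc)
      next
        case E
        have "(\<Sum>t\<in>{i<..<j}. bar (?e i t) (g i t) \<cdot> c t j) = 0" "(\<Sum>t\<in>{i<..<j}. bar (?e i t) (c i t) \<cdot> g t j) = 0"
          using E pq by (auto intro!: sum.neutral simp: g_def bar_0 mult_0_left mult_0_right)
        moreover have "g i j = 0" using E pq by (auto simp: g_def)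
        ultimately show ?thesis by (simp add: diff_0)
      qed
    qed
    then show ?thesis unfolding expand gg by (simp add: c'_def diff_add)
  qed
  have "defining_system A k ns \<alpha> c' a"
    unfolding defining_system_iff
  proof (intro conjI ballI impI)
    fix i j assume ij: "i \<in> {1..k+1}" "j \<in> {1..k+1}"
    have "j \<le> i \<Longrightarrow> c i j = 0" using ds ij unfolding defining_system_def by (auto split: if_splits)
    then show "if j \<le> i then c' i j = 0 else c' i j \<in> grade A (?e i j)"
      using ij G[of i j] gG[of i j] g0[OF ij] by (auto simp: c'_def grade_add)
  next
    fix i assume i: "i \<in> {1..k}"
    have ci: "c i (i + 1) \<in> \<alpha> i" using ds i unfolding defining_system_def by blast
    show "c' i (i + 1) \<in> \<alpha> i"
    proof (cases "i = p \<and> i + 1 = q")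
      case True
      \<comment> \<open>On the first diagonal, adding \<open>d b\<close> only changes the
        representative of the class.\<close>
      then have "b \<in> grade A (ns i - 1)" using b entry_degree_Suc[of ns i] by auto
      then show ?thesis using coh_class_add_diff[OF \<alpha>[OF i] ci] True by (simp add: c'_def g_def)
    next
      case False
      then have "g i (i + 1) = 0" using pq by (auto simp: g_def)
      then show ?thesis using ci by (simp add: c'_def)
    qed
  next
    fix i j assume ij: "i \<in> {1..k+1}" "j \<in> {1..k+1}" "i < j"
    then show "(if i = 1 \<and> j = k + 1 then a else 0) = d (c' i j) - (\<Sum>t\<in>{i<..<j}. bar (?e i t) (c' i t) \<cdot> c' t j)"
      using defining_system_equation[OF ds, of i j] eq[of i j] by simp
  next
    assume "k = 0"
    then show "a = 0" using pq by simp
  qed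
  then show ?thesis
  proof (rule that)
    show "c' p q = c p q + d b" by (simp add: c'_def g_def)
    show "c' i j = c i j" if "(i, j) \<noteq> (p, q)" "j - i \<le> q - p" "i < j" for i j
      using that pq by (auto simp: c'_def g_def)
  qed
qed

text \<open>
  \<open>N\<close> plays the role of the elements of positive weight.  Gauge transformations, performed one
  diagonal after the other, make the second defining system congruent to the first one modulo \<open>N\<close>.
\<close>

theorem massey_unique_modulo:
  assumes ds: "defining_system A k ns \<alpha> c a" and ds': "defining_system A k ns \<alpha> c' a'"
    and \<alpha>: "\<And>i. i \<in> {1..k} \<Longrightarrow> \<alpha> i \<in> cohomology A (ns i)"
    and k: "k \<ge> 2"
    and N0: "0 \<in> N" and Nadd: "\<And>x y. \<lbrakk>x \<in> N; y \<in> N\<rbrakk> \<Longrightarrow> x + y \<in> N" and Nminus: "\<And>x. x \<in> N \<Longrightarrow> - x \<in> N"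
    and Nmult: "\<And>x y. \<lbrakk>x \<in> N; y \<in> N\<rbrakk> \<Longrightarrow> x \<cdot> y \<in> N"
    and Nc: "\<And>i j x. \<lbrakk>1 \<le> i; i < j; j \<le> k + 1; \<not> (i = 1 \<and> j = k + 1); x \<in> N\<rbrakk> \<Longrightarrow> c i j \<cdot> x \<in> N \<and> x \<cdot> c i j \<in> N"
    and vanish: "\<And>i j x. \<lbrakk>1 \<le> i; i + 1 < j; j \<le> k + 1; \<not> (i = 1 \<and> j = k + 1); x \<in> grade A (entry_degree ns i j); d x \<in> N\<rbrakk>
      \<Longrightarrow> \<exists>b\<in>grade A (entry_degree ns i j - 1). x - d b \<in> N"
    and top: "\<And>x. \<lbrakk>x \<in> N; x \<in> grade A (entry_degree ns 1 (k + 1) + 1); d x = 0\<rbrakk>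
      \<Longrightarrow> \<exists>b\<in>grade A (entry_degree ns 1 (k + 1)). x = d b"
  shows "\<exists>b\<in>grade A (entry_degree ns 1 (k + 1)). a' - a = d b"
proof -
  let ?e = "entry_degree ns"
  have Nbar: "bar n x \<in> N" if "x \<in> N" for n x using that Nminus by (simp add: bar_def)
  have Nsum: "(\<Sum>t\<in>T. f t) \<in> N" if "\<And>t. t \<in> T \<Longrightarrow> f t \<in> N" for f :: "nat \<Rightarrow> 'a" and T
    using that by (induction T rule: infinite_finite_induct) (auto simp: N0 Nadd)
  \<comment> \<open>Orders the entries by diagonal and, within a diagonal, by row; the row index is
    at most k + 1 and so below the base k + 2.\<close>
  define rank where "rank i j = (j - i) * (k + 2) + i" for i j :: nat
  \<comment> \<open>Congruence modulo N passes from entries to sums of products, as N absorbs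
    multiplication by the entries of c and by its own elements.\<close>
  have diffN: "(\<Sum>t\<in>{i<..<j}. bar (?e i t) (x i t) \<cdot> x t j) - (\<Sum>t\<in>{i<..<j}. bar (?e i t) (c i t) \<cdot> c t j) \<in> N"
    if "1 \<le> i" "j \<le> k + 1" and x: "\<And>i' j'. \<lbrakk>1 \<le> i'; i' < j'; j' \<le> k + 1; j' - i' < j - i\<rbrakk> \<Longrightarrow> x i' j' - c i' j' \<in> N"
    for i j x
  proof -
    have "bar (?e i t) (x i t) \<cdot> x t j - bar (?e i t) (c i t) \<cdot> c t j \<in> N" if t: "t \<in> {i<..<j}" for t
    proof -
      define u v where "u = x i t - c i t" and "v = x t j - c t j"
      have uv: "u \<in> N" "v \<in> N" using x[of i t] x[of t j] t \<open>1 \<le> i\<close> \<open>j \<le> k + 1\<close> by (auto simp: u_def v_def)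
      have "x i t = c i t + u" "x t j = c t j + v" by (auto simp: u_def v_def)
      then have "bar (?e i t) (x i t) \<cdot> x t j - bar (?e i t) (c i t) \<cdot> c t j =
          bar (?e i t) (c i t \<cdot> v) + (bar (?e i t) (u \<cdot> c t j) + bar (?e i t) (u \<cdot> v))"
        by (simp add: bar_add mult_add_left mult_add_right bar_mult_left)
      also have "\<dots> \<in> N"
      proof (intro Nadd Nbar)
        show "c i t \<cdot> v \<in> N" using t \<open>1 \<le> i\<close> \<open>j \<le> k + 1\<close> uv Nc[of i t v] by auto
        show "u \<cdot> c t j \<in> N" using t \<open>1 \<le> i\<close> \<open>j \<le> k + 1\<close> uv Nc[of t j u] by auto
        show "u \<cdot> v \<in> N" using uv by (rule Nmult)
      qed
      finally show ?thesis .
    qed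
    then show ?thesis unfolding sum_subtractf[symmetric] by (rule Nsum)
  qed
  have "\<exists>x. defining_system A k ns \<alpha> x a' \<and> (\<forall>i j. 1 \<le> i \<and> i < j \<and> j \<le> k + 1 \<and> \<not> (i = 1 \<and> j = k + 1) \<and> rank i j < m
      \<longrightarrow> x i j - c i j \<in> N)" for m
  proof (induction m)
    case 0
    then show ?case using ds' by auto
  next
    case (Suc m)
    then obtain x where x: "defining_system A k ns \<alpha> x a'"
      and xN: "\<And>i j. \<lbrakk>1 \<le> i; i < j; j \<le> k + 1; \<not> (i = 1 \<and> j = k + 1); rank i j < m\<rbrakk> \<Longrightarrow> x i j - c i j \<in> N" by blast
    have inj: "i = p \<and> j = q" if "rank i j = rank p q" "i \<le> k + 1" "p \<le> k + 1" "i < j" "p < q" for i j p q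
    proof -
      have "rank i j mod (k + 2) = i" "rank p q mod (k + 2) = p"
        unfolding rank_def mod_mult_self3 using that by simp_all
      then have ip: "i = p" using that by simp
      then have "(j - i) * (k + 2) = (q - p) * (k + 2)" using that(1) by (simp add: rank_def)
      then have "j - i = q - p" by (metis add_is_0 mult_right_cancel zero_neq_numeral)
      with ip that show ?thesis by simp
    qed
    show ?case
    proof (cases "\<exists>p q. 1 \<le> p \<and> p < q \<and> q \<le> k + 1 \<and> \<not> (p = 1 \<and> q = k + 1) \<and> rank p q = m")
      case False
      then have "\<forall>i j. 1 \<le> i \<and> i < j \<and> j \<le> k + 1 \<and> \<not> (i = 1 \<and> j = k + 1) \<and> rank i j < Suc m \<longrightarrow> x i j - c i j \<in> N"
        using xN less_Suc_eq by auto
      with x show ?thesis by blast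
    next
      case True
      then obtain p q where pq: "1 \<le> p" "p < q" "q \<le> k + 1" "\<not> (p = 1 \<and> q = k + 1)" and m: "rank p q = m" by blast
      have small: "rank i j < m" if "1 \<le> i" "i < j" "j \<le> k + 1" "j - i < q - p" for i j
      proof -
        have "rank i j < (j - i) * (k + 2) + (k + 2)" using that by (simp add: rank_def)
        also have "\<dots> = Suc (j - i) * (k + 2)" by simp
        also have "\<dots> \<le> (q - p) * (k + 2)" using that by (intro mult_right_mono) auto
        also have "\<dots> \<le> m" using m unfolding rank_def by linarith
        finally show ?thesis .
      qed
      have span: "j - i \<le> q - p" if "rank i j < m" "1 \<le> i" "i < j" "j \<le> k + 1" for i j
      proof (rule ccontr)
        assume "\<not> ?thesis"
        then have "Suc (q - p) * (k + 2) \<le> (j - i) * (k + 2)" by (intro mult_right_mono) auto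
        then have "(q - p) * (k + 2) + (k + 2) \<le> (j - i) * (k + 2)" unfolding mult_Suc by linarith
        then show False using that m pq unfolding rank_def by linarith
      qed
      \<comment> \<open>On the first diagonal both entries represent the same class, so they differ
        by a coboundary. Further out, the differential of the difference lies in N because all
        shorter entries already agree modulo N, and \<open>vanish\<close> applies.\<close>
      have "\<exists>b\<in>grade A (?e p q - 1). x p q - c p q - d b \<in> N"
      proof (cases "q = p + 1")
        case True
        then have p: "p \<in> {1..k}" using pq by auto
        have "x p (p + 1) \<in> \<alpha> p" "c p (p + 1) \<in> \<alpha> p"
          using x ds p unfolding defining_system_def by blast+
        then obtain z where "z \<in> grade A (ns p - 1)" "x p (p + 1) - c p (p + 1) = d z"
          using coh_class_diff[OF \<alpha>[OF p]] by metis
        then show ?thesis using True N0 entry_degree_Suc[of ns p] by (intro bexI[of _ z]) auto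
      next
        case False
        then have "p + 1 < q" using pq by simp
        moreover have "x p q - c p q \<in> grade A (?e p q)"
          using pq by (intro grade_minus defining_system_grade[OF x] defining_system_grade[OF ds]) auto
        moreover have "d (x p q - c p q) \<in> N"
          unfolding diff_minus2 defining_system_diff[OF x pq] defining_system_diff[OF ds pq]
        proof (rule diffN)
          fix i' j' assume ij: "1 \<le> i'" "i' < j'" "j' \<le> k + 1" "j' - i' < q - p"
          then have "\<not> (i' = 1 \<and> j' = k + 1)" using pq by auto
          then show "x i' j' - c i' j' \<in> N" using xN small ij by blast
        qed (use pq in auto)
        ultimately show ?thesis using vanish pq by blast
      qed
      then obtain b where b: "b \<in> grade A (?e p q - 1)" "x p q - c p q - d b \<in> N" by blast
      \<comment> \<open>The transformation by -b preserves the other entries on this diagonal and on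
        shorter ones, hence everything treated before.\<close>
      obtain y where y: "defining_system A k ns \<alpha> y a'" "y p q = x p q + d (- b)"
        "\<And>i j. (i, j) \<noteq> (p, q) \<Longrightarrow> j - i \<le> q - p \<Longrightarrow> i < j \<Longrightarrow> y i j = x i j"
        using defining_system_gauge[OF x \<alpha> pq grade_uminus[OF b(1)]] by metis
      have "y i j - c i j \<in> N" if ij: "1 \<le> i" "i < j" "j \<le> k + 1" "\<not> (i = 1 \<and> j = k + 1)" "rank i j < Suc m" for i j
      proof (cases "rank i j = m")
        case True
        then have "i = p" "j = q" using inj[of i j p q] m ij pq by auto
        moreover have "y p q - c p q = x p q - c p q - d b" using y(2) by (simp add: diff_minus)
        ultimately show ?thesis using b(2) by (simp only:)
      next
        case False
        then have "rank i j < m" using ij by simp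
        moreover from this have "(i, j) \<noteq> (p, q)" using m by auto
        ultimately show ?thesis using xN[OF ij(1-4)] y(3) span ij by simp
      qed
      with y(1) show ?thesis by blast
    qed
  qed
  \<comment> \<open>This number exceeds every rank.\<close>
  from this[of "(k + 1) * (k + 2) + k + 2"] obtain x where x: "defining_system A k ns \<alpha> x a'"
    and xN0: "\<forall>i j. 1 \<le> i \<and> i < j \<and> j \<le> k + 1 \<and> \<not> (i = 1 \<and> j = k + 1) \<and> rank i j < (k + 1) * (k + 2) + k + 2
      \<longrightarrow> x i j - c i j \<in> N" by blast
  have xN: "x i j - c i j \<in> N" if "1 \<le> i" "i < j" "j \<le> k + 1" "\<not> (i = 1 \<and> j = k + 1)" for i j
  proof -
    have "(j - i) * (k + 2) \<le> (k + 1) * (k + 2)" using that by (intro mult_right_mono) auto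
    then have "rank i j < (k + 1) * (k + 2) + k + 2" using that by (simp add: rank_def)
    then show ?thesis using xN0 that by blast
  qed
  \<comment> \<open>The corner entry is arbitrary in its degree and enters the value only through
    its differential.\<close>
  define z where "z = x 1 (k + 1) - c 1 (k + 1)"
  have z: "z \<in> grade A (?e 1 (k + 1))"
    unfolding z_def by (intro grade_minus defining_system_grade[OF x] defining_system_grade[OF ds]) (use k in auto)
  have k1: "k \<ge> 1" using k by simp
  define w where "w = a' - a - d z"
  have "- w = (\<Sum>t\<in>{1<..<k+1}. bar (?e 1 t) (x 1 t) \<cdot> x t (k+1)) - (\<Sum>t\<in>{1<..<k+1}. bar (?e 1 t) (c 1 t) \<cdot> c t (k+1))"
  proof -
    have "- (a1 - a2 - (p - q)) = s - t" if "a1 = p - s" "a2 = q - t" for a1 a2 p q s t :: 'a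
      using that by simp
    from this[OF defining_system_value[OF x k1] defining_system_value[OF ds k1]]
    show ?thesis unfolding w_def z_def diff_minus2 .
  qed
  also have "\<dots> \<in> N" by (rule diffN) (auto intro: xN)
  finally have "w \<in> N" using Nminus[of "- w"] by simp
  moreover have "w \<in> grade A (?e 1 (k + 1) + 1)"
    unfolding w_def by (intro grade_minus grade_diff z defining_system_cocycle(2)[OF x k1] defining_system_cocycle(2)[OF ds k1])
  moreover have "d w = 0"
    unfolding w_def diff_minus2 using defining_system_cocycle(1)[OF x k1] defining_system_cocycle(1)[OF ds k1] diff_diff[OF z] by simp
  ultimately obtain y where y: "y \<in> grade A (?e 1 (k + 1))" "w = d y" using top by blast
  have "a' - a = d (y + z)" using y(2) by (simp add: w_def diff_add algebra_simps)
  with grade_add[OF y(1) z] show ?thesis by blast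
qed

end

section \<open>The algebra \<open>R\<^sup>*(K)\<close>\<close>

type_synonym 'k cochain = "monomial \<Rightarrow>\<^sub>0 'k"

abbreviation "keys \<equiv> Poly_Mapping.keys"
abbreviation "lookup \<equiv> Poly_Mapping.lookup"
abbreviation "single \<equiv> Poly_Mapping.single"

lemma lookup_scale: "lookup (scale r x) p = r * lookup x p"
  by (simp add: scale_def map.rep_eq when_def)

lemma scale_single: "scale r (single p s) = single p (r * s)"
  by (rule poly_mapping_eqI) (simp add: lookup_scale lookup_single when_def)

lemma scale_0: "scale r 0 = 0"
  by (rule poly_mapping_eqI) (simp add: lookup_scale)

lemma scale_scale: "scale r (scale s x) = scale (r * s) x"
  by (rule poly_mapping_eqI) (simp add: lookup_scale mult.assoc)

lemma scale_add: "scale r (x + y) = scale r x + scale r y"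
  by (rule poly_mapping_eqI) (simp add: lookup_scale lookup_add algebra_simps)

lemma scale_add_left: "scale (r + s) x = scale r x + scale s x"
  by (rule poly_mapping_eqI) (simp add: lookup_scale lookup_add algebra_simps)

lemma scale_sum: "scale r (\<Sum>t\<in>T. f t) = (\<Sum>t\<in>T. scale r (f t))"
  by (rule poly_mapping_eqI) (simp add: lookup_scale lookup_sum sum_distrib_left)

lemma keys_sum_subset: "keys (\<Sum>t\<in>T. f t) \<subseteq> (\<Union>t\<in>T. keys (f t))"
proof (induction T rule: infinite_finite_induct)
  case (insert t T)
  then show ?case using Poly_Mapping.keys_add[of "f t" "\<Sum>t\<in>T. f t"] by auto
qed auto

lemma poly_mapping_sum_singles:
  fixes x :: "'a \<Rightarrow>\<^sub>0 'b::comm_monoid_add"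
  shows "x = (\<Sum>p\<in>keys x. single p (lookup x p))"
  by (rule poly_mapping_eqI) (auto simp: lookup_sum lookup_single when_def in_keys_iff)

text \<open>Reduces statements additive in x to single monomials; S records what is known about the
  monomials that occur.\<close>

lemma poly_mapping_keys_induct:
  fixes x :: "'a \<Rightarrow>\<^sub>0 'b::comm_monoid_add"
  assumes "keys x \<subseteq> S" "P 0" "\<And>p r. p \<in> S \<Longrightarrow> P (single p r)"
    and "\<And>x y. \<lbrakk>P x; P y\<rbrakk> \<Longrightarrow> P (x + y)"
  shows "P x"
proof -
  have "P (\<Sum>p\<in>T. single p (lookup x p))" if "T \<subseteq> S" "finite T" for T
    using that(2,1) by (induction T rule: finite_induct) (auto intro: assms(2-4))
  from this[OF assms(1) finite_keys] show ?thesis unfolding poly_mapping_sum_singles[symmetric] .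
qed

text \<open>The differential of \<open>R_alg\<close>, and its product in each argument, have this
  form, so additivity is proved once.\<close>

definition linear_extension ::
  "(monomial \<Rightarrow> 'k::comm_ring_1 cochain) \<Rightarrow> ('k cochain) \<Rightarrow> ('k cochain)" where
  "linear_extension f x = (\<Sum>p\<in>keys x. scale (lookup x p) (f p))"

lemma linear_extension_superset:
  assumes "finite S" "keys x \<subseteq> S"
  shows "linear_extension f x = (\<Sum>p\<in>S. scale (lookup x p) (f p))"
  unfolding linear_extension_def
proof (rule sum.mono_neutral_left[OF assms])
  show "\<forall>p\<in>S - keys x. scale (lookup x p) (f p) = 0"
    by (auto simp: in_keys_iff intro: poly_mapping_eqI simp: lookup_scale)
qed

lemma linear_extension_add: "linear_extension f (x + y) = linear_extension f x + linear_extension f y"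
proof -
  let ?S = "keys x \<union> keys y"
  have "linear_extension f z = (\<Sum>p\<in>?S. scale (lookup z p) (f p))" if "z \<in> {x, y, x + y}" for z
    by (rule linear_extension_superset) (use that Poly_Mapping.keys_add[of x y] in auto)
  then show ?thesis by (simp add: lookup_add scale_add_left sum.distrib)
qed

lemma linear_extension_single: "linear_extension f (single p r) = scale r (f p)"
  by (subst linear_extension_superset[of "{p}"]) (auto simp: lookup_single)

lemma linear_extension_add_fun:
  "linear_extension (\<lambda>p. f p + g p) x = linear_extension f x + linear_extension g x"
  by (simp add: linear_extension_def scale_add sum.distrib)

lemma diff_R: "diff (R_alg K) = linear_extension (monomial_diff K)"
  by (simp add: R_alg_def linear_extension_def fun_eq_iff)

lemma mult_R: "mult (R_alg K) x y = linear_extension (\<lambda>p. linear_extension (monomial_mult K p) y) x"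
  by (simp add: R_alg_def linear_extension_def scale_sum scale_scale)

lemma grade_R: "grade (R_alg K) n =
    {x. keys x \<subseteq> {(J, I) \<in> R_basis K. int (card J + 2 * card I) = n}}"
  by (simp add: R_alg_def)

section \<open>Signs of exterior products\<close>

lemma shuffle_sign_Un_left:
  assumes "finite A" "finite B" "finite C" "A \<inter> B = {}"
  shows "shuffle_sign (A \<union> B) C = (shuffle_sign A C * shuffle_sign B C :: 'k::comm_ring_1)"
proof -
  have fin: "finite {(a, b). a \<in> X \<and> b \<in> C \<and> b < a}" if "finite X" for X
    by (rule finite_subset[of _ "X \<times> C"]) (use that assms(3) in auto)
  have "{(a, b). a \<in> A \<union> B \<and> b \<in> C \<and> b < a} = {(a, b). a \<in> A \<and> b \<in> C \<and> b < a} \<union> {(a, b). a \<in> B \<and> b \<in> C \<and> b < a}"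
    by auto
  moreover have "{(a, b). a \<in> A \<and> b \<in> C \<and> b < a} \<inter> {(a, b). a \<in> B \<and> b \<in> C \<and> b < a} = {}" using assms(4) by auto
  ultimately show ?thesis unfolding shuffle_sign_def
    by (simp add: card_Un_disjoint[OF fin[OF assms(1)] fin[OF assms(2)]] power_add)
qed

lemma shuffle_sign_Un_right:
  assumes "finite A" "finite B" "finite C" "A \<inter> B = {}"
  shows "shuffle_sign C (A \<union> B) = (shuffle_sign C A * shuffle_sign C B :: 'k::comm_ring_1)"
proof -
  have fin: "finite {(a, b). a \<in> C \<and> b \<in> X \<and> b < a}" if "finite X" for X
    by (rule finite_subset[of _ "C \<times> X"]) (use that assms(3) in auto)
  have "{(a, b). a \<in> C \<and> b \<in> A \<union> B \<and> b < a} = {(a, b). a \<in> C \<and> b \<in> A \<and> b < a} \<union> {(a, b). a \<in> C \<and> b \<in> B \<and> b < a}"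
    by auto
  moreover have "{(a, b). a \<in> C \<and> b \<in> A \<and> b < a} \<inter> {(a, b). a \<in> C \<and> b \<in> B \<and> b < a} = {}" using assms(4) by auto
  ultimately show ?thesis unfolding shuffle_sign_def
    by (simp add: card_Un_disjoint[OF fin[OF assms(1)] fin[OF assms(2)]] power_add)
qed

text \<open>Each pair of elements of A and B is an inversion in exactly one of the two
  orders.\<close>

lemma shuffle_sign_swap:
  assumes "finite A" "finite B" "A \<inter> B = {}"
  shows "shuffle_sign A B * shuffle_sign B A = ((-1) ^ (card A * card B) :: 'k::comm_ring_1)"
proof -
  let ?X = "{(a, b). a \<in> A \<and> b \<in> B \<and> b < a}" and ?Y = "{(a, b). a \<in> B \<and> b \<in> A \<and> b < a}"
  have fin: "finite ?X" "finite ?Y"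
    using assms by (auto intro: finite_subset[of _ "A \<times> B"] finite_subset[of _ "B \<times> A"])
  have "A \<times> B = ?X \<union> prod.swap ` ?Y" using assms(3) by (auto simp: image_iff)
  moreover have "?X \<inter> prod.swap ` ?Y = {}" by auto
  ultimately have "card A * card B = card ?X + card ?Y"
    using fin by (simp add: card_Un_disjoint card_image flip: card_cartesian_product)
  then show ?thesis by (simp add: shuffle_sign_def power_add)
qed

lemma shuffle_sign_square: "shuffle_sign A B * shuffle_sign A B = (1 :: 'k::comm_ring_1)"
  by (simp add: shuffle_sign_def flip: power_add)

locale finite_complex =
  fixes K :: complex_on_nat
  assumes finite_vertices: "finite (\<Union>K)"
    and down_closed: "\<forall>\<sigma>\<in>K. Pow \<sigma> \<subseteq> K"
begin

abbreviation bd :: "'k::comm_ring_1 cochain \<Rightarrow> 'k cochain" where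
  "bd \<equiv> diff (R_alg K)"

lemma subsimplex: "\<lbrakk>\<sigma> \<in> K; \<tau> \<subseteq> \<sigma>\<rbrakk> \<Longrightarrow> \<tau> \<in> K" using down_closed by blast

lemma R_basis_finite: "(J, I) \<in> R_basis K \<Longrightarrow> finite J \<and> finite I"
  using finite_vertices unfolding R_basis_def by (auto intro: finite_subset)

definition monomial_union :: "monomial \<Rightarrow> monomial \<Rightarrow> monomial" where
  "monomial_union p q = (fst p \<union> fst q, snd p \<union> snd q)"

definition compatible :: "monomial \<Rightarrow> monomial \<Rightarrow> bool" where
  "compatible p q \<longleftrightarrow> fst p \<inter> fst q = {} \<and> snd p \<inter> snd q = {} \<and> monomial_union p q \<in> R_basis K"

text \<open>A vanishing product is treated as a monomial with coefficient 0, which keeps case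
  distinctions out of the computations.\<close>

definition mult_coeff :: "monomial \<Rightarrow> monomial \<Rightarrow> 'k::comm_ring_1" where
  "mult_coeff p q = (if compatible p q then shuffle_sign (fst p) (fst q) else 0)"

lemma monomial_mult_eq: "monomial_mult K p q = single (monomial_union p q) (mult_coeff p q)"
  by (auto simp: monomial_mult_def mult_coeff_def compatible_def monomial_union_def split: prod.splits)

lemma mult_single_single:
  "mult (R_alg K) (single p r) (single q s) =
    single (monomial_union p q) (r * s * mult_coeff p q)"
  by (simp add: mult_R linear_extension_single monomial_mult_eq scale_single mult.assoc)

lemma mult_R_add_left: "mult (R_alg K) (x + y) z = mult (R_alg K) x z + mult (R_alg K) y (z :: 'k::comm_ring_1 cochain)"
  by (simp add: mult_R linear_extension_add)

lemma mult_R_add_right: "mult (R_alg K) z (x + y) = mult (R_alg K) z x + mult (R_alg K) z (y :: 'k::comm_ring_1 cochain)"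
  by (simp add: mult_R linear_extension_add linear_extension_add_fun)

lemma mult_R_0: "mult (R_alg K) 0 (x :: 'k::comm_ring_1 cochain) = 0" "mult (R_alg K) x (0 :: 'k cochain) = 0"
  by (simp_all add: R_alg_def)

lemma R_basis_mono: "\<lbrakk>(J, I) \<in> R_basis K; J' \<subseteq> J; I' \<subseteq> I\<rbrakk> \<Longrightarrow> (J', I') \<in> R_basis K"
  using subsimplex[of I I'] unfolding R_basis_def by auto

text \<open>Both sides say that the three monomials are pairwise disjoint in each kind of variable
  and that their union is a basis monomial; the partial unions then are too, since the basis is
  closed under passing to subsets.\<close>

lemma compatible_assoc:
  "compatible p q \<and> compatible (monomial_union p q) w \<longleftrightarrow> compatible q w \<and> compatible p (monomial_union q w)"
proof -
  let ?X = "fst p \<inter> fst q = {} \<and> fst p \<inter> fst w = {} \<and> fst q \<inter> fst w = {} \<and>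
    snd p \<inter> snd q = {} \<and> snd p \<inter> snd w = {} \<and> snd q \<inter> snd w = {} \<and>
    (fst p \<union> (fst q \<union> fst w), snd p \<union> (snd q \<union> snd w)) \<in> R_basis K"
  have "(fst p \<union> fst q, snd p \<union> snd q) \<in> R_basis K" "(fst q \<union> fst w, snd q \<union> snd w) \<in> R_basis K" if ?X
    by (rule R_basis_mono[of "fst p \<union> (fst q \<union> fst w)" "snd p \<union> (snd q \<union> snd w)"]; use that in blast)+
  then have "compatible p q \<and> compatible (monomial_union p q) w \<longleftrightarrow> ?X"
    "compatible q w \<and> compatible p (monomial_union q w) \<longleftrightarrow> ?X"
    by (simp_all add: compatible_def monomial_union_def Int_Un_distrib Int_Un_distrib2 Un_assoc) blast+
  then show ?thesis by blast
qed

lemma mult_coeff_assoc: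
  "mult_coeff p q * mult_coeff (monomial_union p q) w = (mult_coeff q w * mult_coeff p (monomial_union q w) :: 'k::comm_ring_1)"
proof (cases "compatible p q \<and> compatible (monomial_union p q) w")
  case True
  then have r: "compatible q w" "compatible p (monomial_union q w)" using compatible_assoc by auto
  have fin: "finite (fst p)" "finite (fst q)" "finite (fst w)"
    using True R_basis_finite by (auto simp: compatible_def monomial_union_def)
  have "fst p \<inter> fst q = {}" "fst q \<inter> fst w = {}" using True r by (auto simp: compatible_def)
  then show ?thesis
    using True r fin
    by (simp add: mult_coeff_def monomial_union_def shuffle_sign_Un_left shuffle_sign_Un_right mult_ac)
next
  case False
  then have "\<not> (compatible q w \<and> compatible p (monomial_union q w))" using compatible_assoc by auto
  then show ?thesis using False by (auto simp: mult_coeff_def)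
qed

lemma monomial_union_assoc: "monomial_union (monomial_union p q) w = monomial_union p (monomial_union q w)"
  by (simp add: monomial_union_def Un_assoc)

lemma mult_R_assoc:
  fixes x y z :: "'k::comm_ring_1 cochain"
  shows "mult (R_alg K) (mult (R_alg K) x y) z = mult (R_alg K) x (mult (R_alg K) y z)"
proof (rule poly_mapping_keys_induct[of x UNIV])
  fix p :: monomial and r :: 'k
  show "mult (R_alg K) (mult (R_alg K) (single p r) y) z =
      mult (R_alg K) (single p r) (mult (R_alg K) y z)"
  proof (rule poly_mapping_keys_induct[of y UNIV])
    fix q :: monomial and s :: 'k
    show "mult (R_alg K) (mult (R_alg K) (single p r) (single q s)) z =
      mult (R_alg K) (single p r) (mult (R_alg K) (single q s) z)"
    proof (rule poly_mapping_keys_induct[of z UNIV])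
      fix w :: monomial and t :: 'k
      have "r * s * mult_coeff p q * t * mult_coeff (monomial_union p q) w =
          r * s * t * (mult_coeff p q * mult_coeff (monomial_union p q) w)" by (simp add: mult_ac)
      also have "\<dots> = r * (s * t * mult_coeff q w) * mult_coeff p (monomial_union q w)"
        unfolding mult_coeff_assoc by (simp add: mult_ac)
      finally show "mult (R_alg K) (mult (R_alg K) (single p r) (single q s)) (single w t) =
        mult (R_alg K) (single p r) (mult (R_alg K) (single q s) (single w t))"
        by (simp add: mult_single_single monomial_union_assoc)
    qed (simp_all add: mult_R_add_left mult_R_add_right mult_R_0)
  qed (simp_all add: mult_R_add_left mult_R_add_right mult_R_0)
qed (simp_all add: mult_R_add_left mult_R_add_right mult_R_0)

end

section \<open>The differential: square zero and the Leibniz rule\<close>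

context finite_complex
begin

definition diff_coeff :: "nat \<Rightarrow> nat set \<Rightarrow> nat set \<Rightarrow> 'k::comm_ring_1" where
  "diff_coeff j J I = (if insert j I \<in> K then shuffle_sign {j} J else 0)"

lemma diff_single:
  "bd (single (J, I) r) =
    (\<Sum>j\<in>J. single (J - {j}, insert j I) (r * diff_coeff j J I))"
  by (simp add: diff_R linear_extension_single monomial_diff_def scale_sum if_distrib[of "scale r"] diff_coeff_def
      scale_single scale_0 if_distrib[of "\<lambda>x. r * x"] if_distrib[of "single _"] cong: if_cong)

lemma diff_R_add: "bd (x + y) = bd x + bd (y :: 'k::comm_ring_1 cochain)"
  by (simp add: diff_R linear_extension_add)

lemma diff_R_0: "bd (0 :: 'k::comm_ring_1 cochain) = 0"
  by (simp add: R_alg_def)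

lemma diff_R_sum: "bd (\<Sum>t\<in>T. f t :: 'k::comm_ring_1 cochain) = (\<Sum>t\<in>T. bd (f t))"
  by (induction T rule: infinite_finite_induct) (auto simp: diff_R_0 diff_R_add)

text \<open>Exchanging i and j in either order gives the same monomial. Removing the smaller index
  first shifts the position of the larger one by one, so the coefficients are opposite.\<close>

lemma diff_diff_single:
  assumes "finite J" "J \<inter> I = {}"
  shows "bd (bd (single (J, I) r)) = (0 :: 'k::comm_ring_1 cochain)"
proof -
  define f where "f j i = single (J - {j} - {i}, insert i (insert j I)) (r * diff_coeff j J I * diff_coeff i (J - {j}) (insert j I))" for j i
  have anti: "f j i = - (f i j :: 'k cochain)" if "j \<in> J" "i \<in> J" "i < j" for i j
  proof -
    have "J = insert j (J - {j})" "J = insert i (J - {i})" using that by auto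
    then have "{b \<in> J. b < i} = {b \<in> J - {j}. b < i}" "{b \<in> J. b < j} = insert i {b \<in> J - {i}. b < j}"
      using that by auto
    then have cards: "card {b \<in> J. b < i} = card {b \<in> J - {j}. b < i}" "card {b \<in> J. b < j} = Suc (card {b \<in> J - {i}. b < j})"
      using assms(1) by (auto simp: card_insert_if)
    then have "diff_coeff j J I * diff_coeff i (J - {j}) (insert j I) = - (diff_coeff i J I * diff_coeff j (J - {i}) (insert i I) :: 'k)"
    proof (cases "insert i (insert j I) \<in> K")
      case True
      then have K: "insert i I \<in> K" "insert j I \<in> K" "insert j (insert i I) \<in> K"
        by (auto intro: subsimplex simp: insert_commute)
      show ?thesis unfolding diff_coeff_def if_P[OF K(1)] if_P[OF K(2)] if_P[OF K(3)] if_P[OF True]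
        shuffle_sign_single cards by simp
    next
      case False
      then have "insert j (insert i I) \<notin> K" by (simp add: insert_commute)
      with False show ?thesis by (simp add: diff_coeff_def)
    qed
    moreover have "J - {j} - {i} = J - {i} - {j}" "insert i (insert j I) = insert j (insert i I)" by auto
    ultimately show ?thesis unfolding f_def mult.assoc by (simp only: mult_minus_right single_uminus)
  qed
  have "bd (bd (single (J, I) r)) = (\<Sum>j\<in>J. \<Sum>i\<in>J - {j}. f j i)"
    by (simp add: diff_single diff_R_sum f_def)
  also have "\<dots> = (\<Sum>j\<in>J. (\<Sum>i\<in>{i\<in>J. i < j}. f j i) + (\<Sum>i\<in>{i\<in>J. j < i}. f j i))"
  proof (intro sum.cong refl)
    fix j
    have "J - {j} = {i\<in>J. i < j} \<union> {i\<in>J. j < i}" by auto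
    then show "(\<Sum>i\<in>J - {j}. f j i) = (\<Sum>i\<in>{i\<in>J. i < j}. f j i) + (\<Sum>i\<in>{i\<in>J. j < i}. f j i)"
      using assms(1) by (simp add: sum.union_disjoint disjoint_iff)
  qed
  also have "\<dots> = (\<Sum>j\<in>J. \<Sum>i\<in>{i\<in>J. i < j}. f j i) + (\<Sum>j\<in>J. \<Sum>i\<in>{i\<in>J. j < i}. f j i)"
    by (rule sum.distrib)
  also have "(\<Sum>j\<in>J. \<Sum>i\<in>{i\<in>J. j < i}. f j i) = (\<Sum>i\<in>J. \<Sum>j\<in>{j\<in>J. j < i}. f j i)"
    by (rule sum.swap_restrict) (use assms in auto)
  also have "\<dots> = (\<Sum>i\<in>J. \<Sum>j\<in>{j\<in>J. j < i}. - f i j)"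
  proof (intro sum.cong refl)
    fix i j assume "i \<in> J" "j \<in> {j \<in> J. j < i}"
    then have "f i j = - f j i" by (intro anti) auto
    then show "f j i = - f i j" by simp
  qed
  finally show ?thesis by (simp add: sum_negf)
qed

text \<open>The terms are sorted by whether the exchanged index comes from J or from J'. Moving an
  index of J' past the factors of J costs one sign for each, and the parity of |J| is that of the
  degree.\<close>

lemma Leibniz_single:
  fixes r s :: "'k::comm_ring_1"
  assumes p: "(J, I) \<in> R_basis K" and q: "(J', I') \<in> R_basis K"
  shows "bd (mult (R_alg K) (single (J, I) r) (single (J', I') s)) =
    mult (R_alg K) (bd (single (J, I) r)) (single (J', I') s) +
    bar (int (card J + 2 * card I))
      (mult (R_alg K) (single (J, I) r) (bd (single (J', I') s)))"
proof -
  have sum_left: "mult (R_alg K) (\<Sum>t\<in>T. f t) x = (\<Sum>t\<in>T. mult (R_alg K) (f t) x)" for f :: "nat \<Rightarrow> 'k cochain" and T x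
    by (induction T rule: infinite_finite_induct) (auto simp: mult_R_0 mult_R_add_left)
  have sum_right: "mult (R_alg K) x (\<Sum>t\<in>T. f t) = (\<Sum>t\<in>T. mult (R_alg K) x (f t))" for f :: "nat \<Rightarrow> 'k cochain" and T x
    by (induction T rule: infinite_finite_induct) (auto simp: mult_R_0 mult_R_add_right)
  have fin: "finite J" "finite J'" using R_basis_finite p q by auto
  define X where "X j = single (J - {j} \<union> J', insert j I \<union> I') (r * diff_coeff j J I * s * mult_coeff (J - {j}, insert j I) (J', I'))" for j
  define Y where "Y j = single (J \<union> (J' - {j}), I \<union> insert j I') (r * (s * diff_coeff j J' I') * mult_coeff (J, I) (J' - {j}, insert j I'))" for j
  have left: "mult (R_alg K) (bd (single (J, I) r)) (single (J', I') s) = (\<Sum>j\<in>J. X j)"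
    by (simp add: diff_single sum_left mult_single_single X_def monomial_union_def)
  have right: "mult (R_alg K) (single (J, I) r) (bd (single (J', I') s)) = (\<Sum>j\<in>J'. Y j)"
    by (simp add: diff_single sum_right mult_single_single Y_def monomial_union_def)
  show ?thesis
  proof (cases "compatible (J, I) (J', I')")
    case False
    \<comment> \<open>An index used by both factors is still used by both after an exchange, and a
      nonface stays one when enlarged; so no term of the right-hand side survives either.\<close>
    have "\<not> compatible (J - {j}, insert j I) (J', I')" if "j \<in> J" for j
      using False p q that subsimplex[of "insert j I \<union> I'" "I \<union> I'"]
      unfolding compatible_def monomial_union_def R_basis_def by auto
    moreover have "\<not> compatible (J, I) (J' - {j}, insert j I')" if "j \<in> J'" for j
      using False p q that subsimplex[of "I \<union> insert j I'" "I \<union> I'"]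
      unfolding compatible_def monomial_union_def R_basis_def by auto
    ultimately have "(\<Sum>j\<in>J. X j) = 0" "(\<Sum>j\<in>J'. Y j) = 0"
      by (auto simp: X_def Y_def mult_coeff_def intro!: sum.neutral)
    then show ?thesis unfolding left right using False by (simp add: mult_single_single mult_coeff_def diff_R_0 bar_0)
  next
    case True
    then have disj: "J \<inter> J' = {}" "I \<inter> I' = {}" "J \<inter> I' = {}" "J' \<inter> I = {}" "J \<inter> I = {}" "J' \<inter> I' = {}" "I \<union> I' \<in> K" "J \<union> J' \<subseteq> \<Union>K"
      by (auto simp: compatible_def monomial_union_def R_basis_def)
    define Z where "Z j = single (J \<union> J' - {j}, insert j (I \<union> I')) (r * s * shuffle_sign J J' * diff_coeff j (J \<union> J') (I \<union> I'))" for j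
    have "bd (mult (R_alg K) (single (J, I) r) (single (J', I') s)) = (\<Sum>j\<in>J \<union> J'. Z j)"
      using True by (simp add: mult_single_single monomial_union_def diff_single mult_coeff_def Z_def)
    also have "\<dots> = (\<Sum>j\<in>J. Z j) + (\<Sum>j\<in>J'. Z j)" using fin disj by (simp add: sum.union_disjoint)
    also have "(\<Sum>j\<in>J. Z j) = (\<Sum>j\<in>J. X j)"
    proof (rule sum.cong[OF refl])
      fix j assume j: "j \<in> J"
      have split: "shuffle_sign J J' = (shuffle_sign {j} J' * shuffle_sign (J - {j}) J' :: 'k)"
        using shuffle_sign_Un_left[of "{j}" "J - {j}" J'] fin j by (simp add: insert_absorb)
      have sq: "shuffle_sign {j} J' * (shuffle_sign {j} J' * y) = (y :: 'k)" for y
        by (simp add: shuffle_sign_square flip: mult.assoc)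
      have "shuffle_sign J J' * diff_coeff j (J \<union> J') (I \<union> I') =
          (diff_coeff j J I * mult_coeff (J - {j}, insert j I) (J', I') :: 'k)"
      proof (cases "insert j (I \<union> I') \<in> K")
        case True
        then have "insert j I \<in> K" "compatible (J - {j}, insert j I) (J', I')"
          using subsimplex[of "insert j (I \<union> I')" "insert j I"] disj j
          by (auto simp: compatible_def monomial_union_def R_basis_def)
        then show ?thesis using True fin disj
          by (simp add: diff_coeff_def mult_coeff_def shuffle_sign_Un_right split sq mult_ac)
      next
        case False
        then have "\<not> compatible (J - {j}, insert j I) (J', I')"
          by (auto simp: compatible_def monomial_union_def R_basis_def)
        then show ?thesis using False by (simp add: diff_coeff_def mult_coeff_def)
      qed
      moreover have "J \<union> J' - {j} = J - {j} \<union> J'" using disj j by auto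
      ultimately show "Z j = X j" by (simp add: Z_def X_def mult_ac)
    qed
    also have "(\<Sum>j\<in>J'. Z j) = bar (int (card J + 2 * card I)) (\<Sum>j\<in>J'. Y j)"
      unfolding bar_sum
    proof (rule sum.cong[OF refl])
      fix j assume j: "j \<in> J'"
      have split: "shuffle_sign J J' = (shuffle_sign J {j} * shuffle_sign J (J' - {j}) :: 'k)"
        using shuffle_sign_Un_right[of "{j}" "J' - {j}" J] fin j by (simp add: insert_absorb)
      have sw: "shuffle_sign J {j} * shuffle_sign {j} J = ((-1) ^ card J :: 'k)"
        using shuffle_sign_swap[of J "{j}"] fin j disj by auto
      have "shuffle_sign J J' * diff_coeff j (J \<union> J') (I \<union> I') =
          ((-1) ^ card J * (diff_coeff j J' I' * mult_coeff (J, I) (J' - {j}, insert j I')) :: 'k)"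
      proof (cases "insert j (I \<union> I') \<in> K")
        case True
        then have "insert j I' \<in> K" "compatible (J, I) (J' - {j}, insert j I')"
          using subsimplex[of "insert j (I \<union> I')" "insert j I'"] disj j
          by (auto simp: compatible_def monomial_union_def R_basis_def)
        moreover have "shuffle_sign J {j} * shuffle_sign J (J' - {j}) * (shuffle_sign {j} J * shuffle_sign {j} J') =
           (shuffle_sign J {j} * shuffle_sign {j} J) * (shuffle_sign {j} J' * shuffle_sign J (J' - {j})  :: 'k)"
          by (simp add: mult_ac)
        ultimately show ?thesis using True fin disj
          by (simp add: diff_coeff_def mult_coeff_def shuffle_sign_Un_right split sw)
      next
        case False
        then have "\<not> compatible (J, I) (J' - {j}, insert j I')"
          by (auto simp: compatible_def monomial_union_def R_basis_def)
        then show ?thesis using False by (simp add: diff_coeff_def mult_coeff_def)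
      qed
      moreover have "J \<union> J' - {j} = J \<union> (J' - {j})" using disj j by auto
      ultimately show "Z j = bar (int (card J + 2 * card I)) (Y j)"
        by (simp add: Z_def Y_def bar_def mult_ac minus_one_power_iff flip: single_uminus)
    qed
    finally show ?thesis unfolding left right .
  qed
qed

lemma dg_algebra_R: "dg_algebra (R_alg K :: ('k::comm_ring_1 cochain) dga)"
proof
  fix x y z :: "'k cochain" and m n :: int
  let ?B = "\<lambda>n. {(J, I) \<in> R_basis K. int (card J + 2 * card I) = n}"
  show "mult (R_alg K) (x + y) z = mult (R_alg K) x z + mult (R_alg K) y z" by (rule mult_R_add_left)
  show "mult (R_alg K) x (y + z) = mult (R_alg K) x y + mult (R_alg K) x z" by (rule mult_R_add_right)
  show "mult (R_alg K) (mult (R_alg K) x y) z = mult (R_alg K) x (mult (R_alg K) y z)" by (rule mult_R_assoc)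
  show "bd (x + y) = bd x + bd y" by (rule diff_R_add)
  show g0: "0 \<in> grade (R_alg K :: ('k cochain) dga) n" for n by (simp add: grade_R)
  show gadd: "x + y \<in> grade (R_alg K) n" if "x \<in> grade (R_alg K) n" "y \<in> grade (R_alg K) n" for x y :: "'k cochain" and n
    using that Poly_Mapping.keys_add[of x y] unfolding grade_R by blast
  show "- x \<in> grade (R_alg K) n" if "x \<in> grade (R_alg K) n" using that by (simp add: grade_R)
  show "bd (bd x) = 0" if "x \<in> grade (R_alg K) n"
  proof (rule poly_mapping_keys_induct[of x "?B n"])
    fix p and r :: 'k assume "p \<in> ?B n"
    then show "bd (bd (single p r)) = 0"
      using diff_diff_single[of "fst p" "snd p" r] R_basis_finite[of "fst p" "snd p"] by (auto simp: R_basis_def)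
  qed (use that in \<open>auto simp: grade_R diff_R_0 diff_R_add\<close>)
  show "bd (mult (R_alg K) x y) = mult (R_alg K) (bd x) y + bar m (mult (R_alg K) x (bd y))"
    if x: "x \<in> grade (R_alg K) m" and y: "y \<in> grade (R_alg K) n"
  proof (rule poly_mapping_keys_induct[of x "?B m"])
    fix p and r :: 'k assume p: "p \<in> ?B m"
    show "bd (mult (R_alg K) (single p r) y) =
        mult (R_alg K) (bd (single p r)) y + bar m (mult (R_alg K) (single p r) (bd y))"
    proof (rule poly_mapping_keys_induct[of y "?B n"])
      fix q and s :: 'k assume q: "q \<in> ?B n"
      show "bd (mult (R_alg K) (single p r) (single q s)) =
        mult (R_alg K) (bd (single p r)) (single q s) +
        bar m (mult (R_alg K) (single p r) (bd (single q s)))"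
        using p q Leibniz_single[of "fst p" "snd p" "fst q" "snd q" r s] by auto
    qed (use y in \<open>auto simp: grade_R diff_R_0 diff_R_add mult_R_0 mult_R_add_right bar_0 bar_add\<close>)
  qed (use x in \<open>auto simp: grade_R diff_R_0 diff_R_add mult_R_0 mult_R_add_left bar_0 bar_add\<close>)
  show "mult (R_alg K) x y \<in> grade (R_alg K) (m + n)"
    if x: "x \<in> grade (R_alg K) m" and y: "y \<in> grade (R_alg K) n"
  proof (rule poly_mapping_keys_induct[of x "?B m"])
    fix p and r :: 'k assume p: "p \<in> ?B m"
    show "mult (R_alg K) (single p r) y \<in> grade (R_alg K) (m + n)"
    proof (rule poly_mapping_keys_induct[of y "?B n"])
      fix q and s :: 'k assume q: "q \<in> ?B n"
      show "mult (R_alg K) (single p r) (single q s) \<in> grade (R_alg K) (m + n)"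
      proof (cases "compatible p q")
        case True
        then have "monomial_union p q \<in> ?B (m + n)"
          using p q R_basis_finite
          by (auto simp: compatible_def monomial_union_def card_Un_disjoint algebra_simps)
        then show ?thesis by (auto simp: mult_single_single grade_R)
      next
        case False
        then show ?thesis by (simp add: mult_single_single mult_coeff_def g0)
      qed
    next
      show "keys y \<subseteq> ?B n" using y by (simp add: grade_R)
    next
      fix y1 y2 assume "mult (R_alg K) (single p r) y1 \<in> grade (R_alg K) (m + n)" "mult (R_alg K) (single p r) y2 \<in> grade (R_alg K) (m + n)"
      then show "mult (R_alg K) (single p r) (y1 + y2) \<in> grade (R_alg K) (m + n)"
        unfolding mult_R_add_right by (rule gadd)
    qed (simp add: mult_R_0 g0)
  next
    show "keys x \<subseteq> ?B m" using x by (simp add: grade_R)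
  next
    fix x1 x2 assume "mult (R_alg K) x1 y \<in> grade (R_alg K) (m + n)" "mult (R_alg K) x2 y \<in> grade (R_alg K) (m + n)"
    then show "mult (R_alg K) (x1 + x2) y \<in> grade (R_alg K) (m + n)"
      unfolding mult_R_add_left by (rule gadd)
  qed (simp add: mult_R_0 g0)
  show "bd x \<in> grade (R_alg K) (n + 1)" if x: "x \<in> grade (R_alg K) n"
  proof (rule poly_mapping_keys_induct[of x "?B n"])
    fix p and r :: 'k assume p: "p \<in> ?B n"
    obtain J I where JI: "p = (J, I)" by (cases p)
    have fin: "finite J" "finite I" using p JI R_basis_finite by auto
    have "single (J - {j}, insert j I) (r * diff_coeff j J I) \<in> grade (R_alg K) (n + 1)" if "j \<in> J" for j
    proof (cases "insert j I \<in> K")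
      case True
      have "j \<notin> I" using p JI that by (auto simp: R_basis_def)
      then have "(J - {j}, insert j I) \<in> ?B (n + 1)"
        using p JI that True fin card_Diff_singleton[OF that] card_gt_0_iff[of J] by (auto simp: R_basis_def)
      then show ?thesis by (auto simp: grade_R)
    qed (simp add: diff_coeff_def g0)
    then have "(\<Sum>j\<in>T. single (J - {j}, insert j I) (r * diff_coeff j J I)) \<in> grade (R_alg K) (n + 1)" if "T \<subseteq> J" for T
      using that by (induction T rule: infinite_finite_induct) (auto simp: g0 intro: gadd)
    then show "bd (single p r) \<in> grade (R_alg K) (n + 1)"
      by (simp add: JI diff_single)
  next
    show "keys x \<subseteq> ?B n" using x by (simp add: grade_R)
  next
    fix x1 x2 :: "'k cochain" assume "bd x1 \<in> grade (R_alg K) (n + 1)" "bd x2 \<in> grade (R_alg K) (n + 1)"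
    then show "bd (x1 + x2) \<in> grade (R_alg K) (n + 1)"
      unfolding diff_R_add by (rule gadd)
  qed (simp add: diff_R_0 g0)
qed

end

section \<open>The grading by multidegree and matchings of monomials\<close>

abbreviation "multidegree m \<equiv> fst m \<union> snd m"

definition restrict_keys :: "('a \<Rightarrow> bool) \<Rightarrow> ('a \<Rightarrow>\<^sub>0 'b::zero) \<Rightarrow> ('a \<Rightarrow>\<^sub>0 'b)" where
  "restrict_keys P x = Abs_poly_mapping (\<lambda>m. if P m then lookup x m else 0)"

lemma lookup_restrict_keys: "lookup (restrict_keys P x) m = (if P m then lookup x m else 0)"
proof -
  have "finite {m. (if P m then lookup x m else 0) \<noteq> 0}"
  proof (rule finite_subset[OF _ finite_keys[of x]], rule subsetI)
    fix m assume "m \<in> {m. (if P m then lookup x m else 0) \<noteq> 0}"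
    then show "m \<in> keys x" by (cases "P m") (auto simp: in_keys_iff)
  qed
  then show ?thesis by (simp add: restrict_keys_def)
qed

lemma keys_restrict_keys: "keys (restrict_keys P x) = {m \<in> keys x. P m}"
  by (auto simp: in_keys_iff lookup_restrict_keys split: if_split_asm)

lemma restrict_keys_add: "restrict_keys P (x + y) = restrict_keys P x + restrict_keys P (y :: 'a \<Rightarrow>\<^sub>0 'b::monoid_add)"
  by (rule poly_mapping_eqI) (simp add: lookup_restrict_keys lookup_add)

lemma restrict_keys_0: "restrict_keys P 0 = 0"
  by (rule poly_mapping_eqI) (simp add: lookup_restrict_keys)

lemma restrict_keys_single: "restrict_keys P (single m r) = (if P m then single m r else 0)"
  by (rule poly_mapping_eqI) (auto simp: lookup_restrict_keys lookup_single when_def)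

lemma shuffle_sign_single_insert:
  assumes "finite J" "v \<notin> J"
  shows "shuffle_sign {j} (insert v J) = (if v < j then - shuffle_sign {j} J else shuffle_sign {j} J :: 'k::comm_ring_1)"
proof -
  have "{b \<in> insert v J. b < j} = (if v < j then insert v {b \<in> J. b < j} else {b \<in> J. b < j})" by auto
  then show ?thesis using assms by (simp add: shuffle_sign_single)
qed

lemma shuffle_sign_single_self: "shuffle_sign {j} (insert j J) = (shuffle_sign {j} J :: 'k::comm_ring_1)"
proof -
  have "{b \<in> insert j J. b < j} = {b \<in> J. b < j}" by auto
  then show ?thesis by (simp add: shuffle_sign_single)
qed

context finite_complex
begin

lemma grade_keys: "x \<in> grade (R_alg K) n \<longleftrightarrow>
    (\<forall>m\<in>keys x. m \<in> R_basis K \<and> int (card (fst m) + 2 * card (snd m)) = n)"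
  by (auto simp: grade_R)

text \<open>The differential turns some u_j into v_j, which leaves J \<union> I unchanged; selecting
  monomials by multidegree is therefore a cochain map.\<close>

lemma restrict_keys_diff:
  fixes x :: "'k::comm_ring_1 cochain"
  shows "bd (restrict_keys (\<lambda>m. Q (multidegree m)) x) = restrict_keys (\<lambda>m. Q (multidegree m)) (bd x)"
proof (rule poly_mapping_keys_induct[of x UNIV])
  fix m :: monomial and r :: 'k
  obtain J I where m: "m = (J, I)" by (cases m)
  let ?f = "\<lambda>j. single (J - {j}, insert j I) (r * diff_coeff j J I) :: 'k cochain"
  have sum: "restrict_keys P (\<Sum>j\<in>T. f j) = (\<Sum>j\<in>T. restrict_keys P (f j))" for P and f :: "nat \<Rightarrow> 'k cochain" and T
    by (induction T rule: infinite_finite_induct) (auto simp: restrict_keys_0 restrict_keys_add)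
  have "restrict_keys (\<lambda>m. Q (multidegree m)) (?f j) = (if Q (J \<union> I) then ?f j else 0)" if "j \<in> J" for j
  proof -
    have "multidegree (J - {j}, insert j I) = J \<union> I" using that by auto
    then show ?thesis by (simp only: restrict_keys_single)
  qed
  then show "bd (restrict_keys (\<lambda>m. Q (multidegree m)) (single m r)) =
      restrict_keys (\<lambda>m. Q (multidegree m)) (bd (single m r))"
    by (simp add: m restrict_keys_single diff_single sum diff_R_0)
qed (simp_all add: restrict_keys_0 diff_R_0 restrict_keys_add diff_R_add)

lemma keys_diff_R:
  assumes "m \<in> keys (bd (x :: 'k::comm_ring_1 cochain))"
  shows "\<exists>J I j. (J, I) \<in> keys x \<and> j \<in> J \<and> insert j I \<in> K \<and> m = (J - {j}, insert j I)"
proof -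
  have "keys (bd x) \<subseteq>
      (\<Union>p\<in>keys x. keys (scale (lookup x p) (monomial_diff K p)))"
    unfolding diff_R linear_extension_def by (rule keys_sum_subset)
  then obtain p where p0: "p \<in> keys x" "m \<in> keys (scale (lookup x p) (monomial_diff K p))"
    using assms by blast
  then have p: "p \<in> keys x" "m \<in> keys (monomial_diff K p :: 'k cochain)"
    by (auto simp: in_keys_iff lookup_scale)
  obtain J I where JI: "p = (J, I)" by (cases p)
  have "m \<in> (\<Union>j\<in>J. keys (if insert j I \<in> K then single (J - {j}, insert j I) (shuffle_sign {j} J) else 0 :: 'k cochain))"
    using p(2) keys_sum_subset unfolding JI monomial_diff_def by fastforce
  then show ?thesis using p(1) JI by (auto split: if_splits)
qed

text \<open>The differential read backwards, as the matching arguments need it: a coefficient of the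
  coboundary collects the monomials in which one v_j of the target is still u_j.\<close>

lemma lookup_diff:
  fixes x :: "'k::comm_ring_1 cochain"
  assumes x: "keys x \<subseteq> R_basis K" and JI: "(J, I) \<in> R_basis K"
  shows "lookup (bd x) (J, I) =
    (\<Sum>j\<in>I. shuffle_sign {j} J * lookup x (insert j J, I - {j}))"
proof (rule poly_mapping_keys_induct[OF x])
  have IK: "I \<in> K" "J \<inter> I = {}" and fin: "finite I" "finite J" using JI R_basis_finite by (auto simp: R_basis_def)
  fix p and r :: 'k assume p: "p \<in> R_basis K"
  obtain J0 I0 where p0: "p = (J0, I0)" by (cases p)
  have disj: "J0 \<inter> I0 = {}" and fin0: "finite J0" using p p0 R_basis_finite by (auto simp: R_basis_def)
  have "lookup (bd (single p r)) (J, I) =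
      (\<Sum>j\<in>J0. r * diff_coeff j J0 I0 when (J0 - {j}, insert j I0) = (J, I))"
    by (simp add: p0 diff_single lookup_sum lookup_single)
  also have "\<dots> = (\<Sum>j\<in>J0 \<inter> I. r * diff_coeff j J0 I0 when (J0 - {j}, insert j I0) = (J, I))"
    by (rule sum.mono_neutral_right) (use fin0 in \<open>auto simp: when_def\<close>)
  also have "\<dots> = (\<Sum>j\<in>J0 \<inter> I. shuffle_sign {j} J * (r when (J0, I0) = (insert j J, I - {j})))"
  proof (rule sum.cong[OF refl])
    fix j assume j: "j \<in> J0 \<inter> I"
    have "(J0 - {j}, insert j I0) = (J, I) \<longleftrightarrow> (J0, I0) = (insert j J, I - {j})"
      using j disj IK by auto
    moreover have "diff_coeff j J0 I0 = (shuffle_sign {j} J :: 'k)" if "(J0 - {j}, insert j I0) = (J, I)"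
    proof -
      have "J0 = insert j J" using that j by auto
      then show ?thesis using that IK by (simp add: diff_coeff_def shuffle_sign_single_self)
    qed
    ultimately show "(r * diff_coeff j J0 I0 when (J0 - {j}, insert j I0) = (J, I)) =
        shuffle_sign {j} J * (r when (J0, I0) = (insert j J, I - {j}))"
      by (auto simp: when_def mult.commute)
  qed
  also have "\<dots> = (\<Sum>j\<in>I. shuffle_sign {j} J * (r when (J0, I0) = (insert j J, I - {j})))"
    by (rule sum.mono_neutral_left) (use fin in \<open>auto simp: when_def\<close>)
  finally show "lookup (bd (single p r)) (J, I) =
      (\<Sum>j\<in>I. shuffle_sign {j} J * lookup (single p r) (insert j J, I - {j}))"
    by (simp add: p0 lookup_single)
next
  fix x y :: "'k cochain"
  assume "lookup (bd x) (J, I) =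
        (\<Sum>j\<in>I. shuffle_sign {j} J * lookup x (insert j J, I - {j}))"
    "lookup (bd y) (J, I) =
        (\<Sum>j\<in>I. shuffle_sign {j} J * lookup y (insert j J, I - {j}))"
  then show "lookup (bd (x + y)) (J, I) =
        (\<Sum>j\<in>I. shuffle_sign {j} J * lookup (x + y) (insert j J, I - {j}))"
    by (simp add: diff_R_add lookup_add distrib_left sum.distrib)
qed (simp add: diff_R_0)

text \<open>
  One step of an algebraic discrete Morse reduction: exchanging \<open>u\<^sub>v\<close> and \<open>v\<^sub>v\<close> in a monomial is a perfect
  matching of \<open>U1\<close>, and the corresponding contracting homotopy removes \<open>U1\<close> from the support.
\<close>

lemma toggle_reduction:
  fixes x :: "'k::comm_ring_1 cochain"
  assumes x: "x \<in> grade (R_alg K) n" "keys x \<subseteq> U"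
    and U: "U1 \<subseteq> U" "U \<subseteq> R_basis K"
    and upper: "\<And>J I j. \<lbrakk>(J, I) \<in> U; j \<in> J; insert j I \<in> K\<rbrakk> \<Longrightarrow> (J - {j}, insert j I) \<in> U"
    and upper2: "\<And>J I j. \<lbrakk>(J, I) \<in> U - U1; j \<in> J; insert j I \<in> K\<rbrakk> \<Longrightarrow> (J - {j}, insert j I) \<notin> U1"
    and v: "\<And>J I. (J, I) \<in> U1 \<Longrightarrow> v \<in> J \<union> I"
    and down: "\<And>J I. \<lbrakk>(J, I) \<in> U1; v \<in> I\<rbrakk> \<Longrightarrow> (insert v J, I - {v}) \<in> U1"
    and up: "\<And>J I. \<lbrakk>(J, I) \<in> U1; v \<in> J\<rbrakk> \<Longrightarrow> (J - {v}, insert v I) \<in> U1"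
    and dx: "keys (bd x) \<inter> U1 = {}"
  obtains y where "y \<in> grade (R_alg K) (n - 1)" "keys (x - bd y) \<subseteq> U - U1"
proof -
  let ?l = "lookup"
  \<comment> \<open>A monomial containing u_v receives, up to sign, the coefficient of x at its
    partner, which contains v_v instead.\<close>
  define h where "h = (\<lambda>(J, I). if (J, I) \<in> U1 \<and> v \<in> J then shuffle_sign {v} (J - {v}) * ?l x (J - {v}, insert v I) else 0)"
  have "{m. h m \<noteq> 0} \<subseteq> (\<lambda>(J, I). (insert v J, I - {v})) ` keys x"
  proof
    fix m assume "m \<in> {m. h m \<noteq> 0}"
    then obtain J I where m: "m = (J, I)" "(J, I) \<in> U1" "v \<in> J"
        "shuffle_sign {v} (J - {v}) * ?l x (J - {v}, insert v I) \<noteq> 0"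
      by (cases m) (auto simp: h_def split: if_splits)
    then have l0: "?l x (J - {v}, insert v I) \<noteq> 0" by auto
    have "v \<notin> I" using m U by (auto simp: R_basis_def)
    then have "m = (\<lambda>(J, I). (insert v J, I - {v})) (J - {v}, insert v I)" using m by auto
    then show "m \<in> (\<lambda>(J, I). (insert v J, I - {v})) ` keys x"
      using l0 by (intro image_eqI) (auto simp: in_keys_iff)
  qed
  then have "finite {m. h m \<noteq> 0}" by (rule finite_subset) simp
  define y where "y = Abs_poly_mapping h"
  have y: "?l y = h" unfolding y_def using \<open>finite {m. h m \<noteq> 0}\<close> by simp
  have keys_y: "keys y \<subseteq> U1" by (auto simp: in_keys_iff y h_def split: if_splits)
  have kx: "keys x \<subseteq> R_basis K" "keys y \<subseteq> R_basis K" using x U keys_y by auto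
  have eq: "?l (bd y) (J, I) = ?l x (J, I)" if JI: "(J, I) \<in> U1" for J I
  proof -
    have B: "(J, I) \<in> R_basis K" and disj: "J \<inter> I = {}" and fin: "finite J" "finite I"
      using JI U R_basis_finite by (auto simp: R_basis_def)
    have d: "?l (bd y) (J, I) = (\<Sum>j\<in>I. shuffle_sign {j} J * h (insert j J, I - {j}))"
      using lookup_diff[OF kx(2) B] by (simp add: y)
    show ?thesis
    proof (cases "v \<in> I")
      case True
      then have vJ: "v \<notin> J" using disj by auto
      \<comment> \<open>When the target contains v_v, only j = v leads to a monomial with u_v, and
        the two equal signs cancel.\<close>
      have "(\<Sum>j\<in>I. shuffle_sign {j} J * h (insert j J, I - {j})) = (\<Sum>j\<in>{v}. shuffle_sign {j} J * h (insert j J, I - {j}))"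
        by (rule sum.mono_neutral_right) (use fin True vJ in \<open>auto simp: h_def\<close>)
      also have "\<dots> = (shuffle_sign {v} J * shuffle_sign {v} J) * ?l x (J, I)"
        using down[OF JI True] True vJ by (simp add: h_def insert_absorb mult.assoc)
      finally show ?thesis unfolding d by (simp add: shuffle_sign_square)
    next
      case False
      then have vJ: "v \<in> J" using v[OF JI] by auto
      define J1 where "J1 = J - {v}"
      have J1: "J = insert v J1" "v \<notin> J1" "finite J1" using vJ fin by (auto simp: J1_def)
      have t: "(J1, insert v I) \<in> U1" using up[OF JI vJ] by (simp add: J1_def)
      have hval: "h (insert j J, I - {j}) = shuffle_sign {v} (insert j J1) * ?l x (insert j J1, insert v (I - {j}))" if j: "j \<in> I" for j
      proof -
        have jv: "j \<noteq> v" "j \<notin> J" using j False disj by auto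
        have eq: "insert j J - {v} = insert j J1" using jv by (auto simp: J1_def)
        show ?thesis
        proof (cases "(insert j J, I - {j}) \<in> U1")
          case True
          then show ?thesis using vJ eq by (simp add: h_def)
        next
          case no: False
          \<comment> \<open>Otherwise this monomial lies in U and exchanging j leads into U1, so by
            \<open>upper2\<close> it lies in U1, and so does its partner.\<close>
          have "?l x (insert j J1, insert v (I - {j})) = 0"
          proof (rule ccontr)
            assume "\<not> ?thesis"
            then have inU: "(insert j J1, insert v (I - {j})) \<in> U" using x(2) by (auto simp: in_keys_iff)
            have e1: "insert j J1 - {j} = J1" "insert j (insert v (I - {j})) = insert v I"
              using j jv by (auto simp: J1_def)
            have "insert v I \<in> K" using t U by (auto simp: R_basis_def)
            then have "(insert j J1, insert v (I - {j})) \<in> U1"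
              using upper2[of "insert j J1" "insert v (I - {j})" j] inU t by (auto simp: e1)
            from down[OF this] have "(insert v (insert j J1), insert v (I - {j}) - {v}) \<in> U1" by simp
            moreover have "insert v (insert j J1) = insert j J" "insert v (I - {j}) - {v} = I - {j}"
              using False J1 by auto
            ultimately show False using no by simp
          qed
          then show ?thesis using no by (simp add: h_def)
        qed
      qed
      \<comment> \<open>When the target contains u_v, the vanishing of \<open>bd x\<close> at its
        partner expresses the coefficient at (J, I) through the coefficients in
        \<open>hval\<close>.\<close>
      have "?l (bd x) (J1, insert v I) = 0"
        using dx t by (auto simp: in_keys_iff)
      moreover have "(J1, insert v I) \<in> R_basis K" using t U by auto
      ultimately have "0 = (\<Sum>j\<in>insert v I. shuffle_sign {j} J1 * ?l x (insert j J1, insert v I - {j}))"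
        using lookup_diff[OF kx(1)] by simp
      also have "\<dots> = shuffle_sign {v} J1 * ?l x (J, I) + (\<Sum>j\<in>I. shuffle_sign {j} J1 * ?l x (insert j J1, insert v (I - {j})))"
      proof -
        have "insert v I - {v} = I" using False by auto
        moreover have "insert v I - {j} = insert v (I - {j})" if "j \<in> I" for j using that False by auto
        ultimately show ?thesis using False fin J1 by simp
      qed
      finally have z: "shuffle_sign {v} J1 * ?l x (J, I) = - (\<Sum>j\<in>I. shuffle_sign {j} J1 * ?l x (insert j J1, insert v (I - {j})))"
        by (simp add: eq_neg_iff_add_eq_0)
      have "?l x (J, I) = (shuffle_sign {v} J1 * shuffle_sign {v} J1) * ?l x (J, I)" by (simp add: shuffle_sign_square)
      also have "\<dots> = (\<Sum>j\<in>I. - (shuffle_sign {v} J1 * (shuffle_sign {j} J1 * ?l x (insert j J1, insert v (I - {j})))))"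
        unfolding mult.assoc z by (simp add: sum_distrib_left sum_negf)
      also have "\<dots> = (\<Sum>j\<in>I. shuffle_sign {j} J * h (insert j J, I - {j}))"
      proof (rule sum.cong[OF refl])
        fix j assume j: "j \<in> I"
        then have jv: "j \<noteq> v" "j \<notin> J1" using False disj by (auto simp: J1_def)
        have sJ: "shuffle_sign {j} J = (if v < j then - shuffle_sign {j} J1 else shuffle_sign {j} J1 :: 'k)"
          unfolding J1(1) by (rule shuffle_sign_single_insert[OF J1(3,2)])
        have sv: "shuffle_sign {v} (insert j J1) = (if j < v then - shuffle_sign {v} J1 else shuffle_sign {v} J1 :: 'k)"
          by (rule shuffle_sign_single_insert[OF J1(3) jv(2)])
        \<comment> \<open>Exactly one of v < j and j < v holds, so exactly one of the two signs
          changes.\<close>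
        from jv show "- (shuffle_sign {v} J1 * (shuffle_sign {j} J1 * ?l x (insert j J1, insert v (I - {j})))) =
            shuffle_sign {j} J * h (insert j J, I - {j})"
          unfolding hval[OF j] sJ sv by (cases "v < j"; cases "j < v"; simp add: mult_ac)
      qed
      finally show ?thesis unfolding d by simp
    qed
  qed
  show ?thesis
  proof (rule that[of y])
    show "y \<in> grade (R_alg K) (n - 1)"
      unfolding grade_keys
    proof
      fix m assume "m \<in> keys y"
      then obtain J I where JI: "m = (J, I)" "(J, I) \<in> U1" "v \<in> J"
        "shuffle_sign {v} (J - {v}) * ?l x (J - {v}, insert v I) \<noteq> 0"
        by (cases m) (auto simp: in_keys_iff y h_def split: if_splits)
      then have "?l x (J - {v}, insert v I) \<noteq> 0" by auto
      with JI have m: "m = (J, I)" "(J, I) \<in> U1" "v \<in> J" "(J - {v}, insert v I) \<in> keys x"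
        by (auto simp: in_keys_iff)
      have B: "(J, I) \<in> R_basis K" using m U by auto
      then have fin: "finite J" "finite I" "v \<notin> I" using m R_basis_finite by (auto simp: R_basis_def)
      have "int (card (J - {v}) + 2 * card (insert v I)) = n" using x(1) m(4) by (auto simp: grade_keys)
      moreover have "Suc (card (J - {v})) = card J" by (rule card_Suc_Diff1[OF fin(1) m(3)])
      moreover have "card (insert v I) = Suc (card I)" using fin by simp
      ultimately have "int (card J + 2 * card I) = n - 1" by linarith
      then show "m \<in> R_basis K \<and> int (card (fst m) + 2 * card (snd m)) = n - 1"
        using B m(1) by (simp only: fst_conv snd_conv)
    qed
    show "keys (x - bd y) \<subseteq> U - U1"
    proof
      fix m assume m: "m \<in> keys (x - bd y)"
      then have "m \<in> keys x \<or> m \<in> keys (bd y)"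
        using Poly_Mapping.keys_diff[of x "bd y"] by auto
      then have "m \<in> U"
      proof
        assume "m \<in> keys (bd y)"
        then obtain J I j where "(J, I) \<in> keys y" "j \<in> J" "insert j I \<in> K" "m = (J - {j}, insert j I)"
          using keys_diff_R by blast
        then show "m \<in> U" using upper keys_y U by blast
      qed (use x in auto)
      moreover have "m \<notin> U1"
      proof
        assume "m \<in> U1"
        then have "?l (bd y) m = ?l x m" using eq by (cases m) simp
        then show False using m by (simp add: in_keys_iff lookup_minus)
      qed
      ultimately show "m \<in> U - U1" by simp
    qed
  qed
qed

text \<open>The parts of x in the finitely many multidegrees that occur are themselves cocycles, and
  primitives of them add up to one of x.\<close>

lemma exact_by_multidegree:
  fixes x :: "'k::comm_ring_1 cochain"
  assumes x: "x \<in> grade (R_alg K) n" "bd x = 0"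
    and exact: "\<And>m (z :: 'k cochain). \<lbrakk>m \<in> keys x; z \<in> grade (R_alg K) n; bd z = 0;
      \<And>m'. m' \<in> keys z \<Longrightarrow> multidegree m' = multidegree m\<rbrakk> \<Longrightarrow> \<exists>y\<in>grade (R_alg K) (n - 1). z = bd y"
  shows "\<exists>y\<in>grade (R_alg K) (n - 1). x = bd y"
proof -
  interpret dg_algebra "R_alg K :: ('k cochain) dga" by (rule dg_algebra_R)
  define part where "part S = restrict_keys (\<lambda>m. multidegree m = S) x" for S
  have "\<exists>y\<in>grade (R_alg K) (n - 1). part (multidegree m) = bd y" if m: "m \<in> keys x" for m
  proof (rule exact[OF m])
    show "part (multidegree m) \<in> grade (R_alg K) n"
      using x(1) by (auto simp: grade_keys part_def keys_restrict_keys)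
    show "bd (part (multidegree m)) = 0"
      unfolding part_def by (subst restrict_keys_diff) (simp add: x(2) restrict_keys_0)
  qed (auto simp: part_def keys_restrict_keys)
  then have "\<exists>y. \<forall>S\<in>multidegree ` keys x. y S \<in> grade (R_alg K) (n - 1) \<and> part S = bd (y S)"
    by (intro bchoice) blast
  then obtain y where y: "\<And>S. S \<in> multidegree ` keys x \<Longrightarrow> y S \<in> grade (R_alg K) (n - 1) \<and> part S = bd (y S)"
    by blast
  have "x = (\<Sum>S\<in>multidegree ` keys x. part S)"
  proof (rule poly_mapping_eqI)
    fix m
    have "lookup (\<Sum>S\<in>multidegree ` keys x. part S) m =
        (\<Sum>S\<in>multidegree ` keys x. if multidegree m = S then lookup x m else 0)"
      by (simp add: lookup_sum part_def lookup_restrict_keys)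
    also have "\<dots> = lookup x m"
      by (subst sum.delta') (auto simp: in_keys_iff)
    finally show "lookup x m = lookup (\<Sum>S\<in>multidegree ` keys x. part S) m" ..
  qed
  also have "\<dots> = (\<Sum>S\<in>multidegree ` keys x. bd (y S))"
    using y by (intro sum.cong) auto
  also have "\<dots> = bd (\<Sum>S\<in>multidegree ` keys x. y S)"
    by (rule diff_sum[symmetric])
  finally show ?thesis
    using grade_sum[of "multidegree ` keys x" y "n - 1"] y by blast
qed

end

section \<open>Simplicial multiwedges\<close>

lemma exists_minimal_nonface:
  assumes "finite N" "N \<subseteq> \<Union>K" "N \<notin> K"
  shows "\<exists>N'\<in>minimal_nonfaces K. N' \<subseteq> N"
  using assms
proof (induction N rule: finite_psubset_induct)
  case (psubset N)
  show ?case
  proof (cases "N \<in> minimal_nonfaces K")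
    case False
    then obtain N' where "N' \<subset> N" "N' \<notin> K" using psubset.prems by (auto simp: minimal_nonfaces_def)
    then show ?thesis using psubset by (metis order.trans psubset_imp_subset)
  qed auto
qed

locale multiwedge_complex = base: finite_complex K0 for K0 +
  fixes J :: "nat \<Rightarrow> nat"
  assumes pos: "i \<in> \<Union>K0 \<Longrightarrow> J i \<ge> 1" and nonempty: "{} \<in> K0"
begin

abbreviation W where "W \<equiv> multiwedge K0 J"

text \<open>Once all lower copies of a vertex are present, its first copy alone decides whether the
  block is full; hence the division of the copies into first and later ones.\<close>

definition top_copies :: "nat set \<Rightarrow> nat set" where
  "top_copies X = (\<lambda>i. prod_encode (i, 1)) ` X"

definition lower_copies :: "nat set \<Rightarrow> nat set" where
  "lower_copies X = {prod_encode (i, k) |i k. i \<in> X \<and> 2 \<le> k \<and> k \<le> J i}"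

definition full_blocks :: "nat set \<Rightarrow> nat set" where
  "full_blocks \<sigma> = {i \<in> \<Union>K0. copies J {i} \<subseteq> \<sigma>}"

lemma mem_copies: "prod_encode (i, k) \<in> copies J X \<longleftrightarrow> i \<in> X \<and> 1 \<le> k \<and> k \<le> J i"
  by (auto simp: copies_def)

lemma mem_top: "prod_encode (i, k) \<in> top_copies X \<longleftrightarrow> i \<in> X \<and> k = 1"
  by (auto simp: top_copies_def)

lemma mem_lower: "prod_encode (i, k) \<in> lower_copies X \<longleftrightarrow> i \<in> X \<and> 2 \<le> k \<and> k \<le> J i"
  by (auto simp: lower_copies_def)

lemma subset_codes: "(A \<subseteq> B) \<longleftrightarrow> (\<forall>i k. prod_encode (i, k) \<in> A \<longrightarrow> prod_encode (i, k) \<in> B)"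
  by (metis prod_decode_inverse subset_iff surj_pair)

lemma eq_codes: "(A = B) \<longleftrightarrow> (\<forall>i k. prod_encode (i, k) \<in> A \<longleftrightarrow> prod_encode (i, k) \<in> B)"
  unfolding set_eq_subset subset_codes by blast

lemma copies_split: "X \<subseteq> \<Union>K0 \<Longrightarrow> copies J X = lower_copies X \<union> top_copies X"
  using pos unfolding eq_codes Un_iff mem_copies mem_top mem_lower
  by (metis One_nat_def Suc_1 Suc_leI le_antisym le_less one_le_numeral order.trans order_refl subsetD)

lemma lower_top_disjoint: "lower_copies X \<inter> top_copies Y = {}"
  unfolding eq_codes by (auto simp: mem_top mem_lower)

lemma finite_copies: "finite X \<Longrightarrow> finite (copies J X)"
proof -
  assume "finite X"
  moreover have "copies J X = (\<Union>i\<in>X. (\<lambda>k. prod_encode (i, k)) ` {1..J i})" by (auto simp: copies_def)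
  ultimately show ?thesis by simp
qed

lemma card_copies: "finite X \<Longrightarrow> card (copies J X) = (\<Sum>i\<in>X. J i)"
proof -
  assume fin: "finite X"
  have "copies J X = prod_encode ` (SIGMA i:X. {1..J i})" by (auto simp: copies_def)
  then have "card (copies J X) = card (SIGMA i:X. {1..J i})"
    by (simp add: card_image inj_prod_encode)
  then show ?thesis using fin by simp
qed

lemma card_top: "card (top_copies X) = card X"
  unfolding top_copies_def by (rule card_image) (auto simp: inj_on_def)

lemma finite_top: "finite X \<Longrightarrow> finite (top_copies X)"
  by (simp add: top_copies_def)

text \<open>A set of copies contains all copies of N, for a set N of vertices, exactly when N
  consists of full blocks; so no minimal nonface is filled iff the full blocks form a face.\<close>

lemma mem_W: "\<sigma> \<in> W \<longleftrightarrow> \<sigma> \<subseteq> copies J (\<Union>K0) \<and> full_blocks \<sigma> \<in> K0"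
proof -
  have "(\<forall>N\<in>copies J ` minimal_nonfaces K0. \<not> N \<subseteq> \<sigma>) \<longleftrightarrow> full_blocks \<sigma> \<in> K0"
  proof
    assume n: "\<forall>N\<in>copies J ` minimal_nonfaces K0. \<not> N \<subseteq> \<sigma>"
    show "full_blocks \<sigma> \<in> K0"
    proof (rule ccontr)
      assume "full_blocks \<sigma> \<notin> K0"
      moreover have "full_blocks \<sigma> \<subseteq> \<Union>K0" by (auto simp: full_blocks_def)
      ultimately obtain N where N: "N \<in> minimal_nonfaces K0" "N \<subseteq> full_blocks \<sigma>"
        using exists_minimal_nonface[of "full_blocks \<sigma>" K0] finite_subset base.finite_vertices by blast
      then have "copies J N \<subseteq> \<sigma>" by (fastforce simp: copies_def full_blocks_def)
      with n N show False by blast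
    qed
  next
    assume f: "full_blocks \<sigma> \<in> K0"
    show "\<forall>N\<in>copies J ` minimal_nonfaces K0. \<not> N \<subseteq> \<sigma>"
    proof (intro ballI notI)
      fix N assume "N \<in> copies J ` minimal_nonfaces K0" "N \<subseteq> \<sigma>"
      then obtain N0 where N0: "N0 \<in> minimal_nonfaces K0" "copies J N0 \<subseteq> \<sigma>" by blast
      then have "N0 \<subseteq> full_blocks \<sigma>" by (auto simp: copies_def full_blocks_def minimal_nonfaces_def)
      then have "N0 \<in> K0" using f base.subsimplex by blast
      with N0 show False by (auto simp: minimal_nonfaces_def)
    qed
  qed
  then show ?thesis by (simp add: multiwedge_def complex_of_nonfaces_def)
qed

lemma full_blocks_mono: "\<sigma> \<subseteq> \<tau> \<Longrightarrow> full_blocks \<sigma> \<subseteq> full_blocks \<tau>"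
  by (auto simp: full_blocks_def)

lemma vertices_W: "\<Union>W = copies J (\<Union>K0)"
proof
  show "\<Union>W \<subseteq> copies J (\<Union>K0)" using mem_W by auto
  show "copies J (\<Union>K0) \<subseteq> \<Union>W"
  proof
    fix v assume v: "v \<in> copies J (\<Union>K0)"
    then obtain i k where ik: "v = prod_encode (i, k)" "i \<in> \<Union>K0" by (auto simp: copies_def)
    have "full_blocks {v} \<subseteq> {i}"
    proof
      fix j assume "j \<in> full_blocks {v}"
      then have "j \<in> \<Union>K0" "prod_encode (j, 1) \<in> {v}" using pos[of j] by (auto simp: full_blocks_def copies_def)
      then show "j \<in> {i}" using ik by auto
    qed
    moreover obtain \<sigma> where "\<sigma> \<in> K0" "i \<in> \<sigma>" using ik by blast
    ultimately have "full_blocks {v} \<in> K0" using base.subsimplex[of \<sigma>] by blast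
    then have "{v} \<in> W" using v by (auto simp: mem_W)
    then show "v \<in> \<Union>W" by blast
  qed
qed

sublocale finite_complex W
proof
  show "finite (\<Union>W)" unfolding vertices_W by (rule finite_copies[OF base.finite_vertices])
  show "\<forall>\<sigma>\<in>W. Pow \<sigma> \<subseteq> W"
    using full_blocks_mono base.subsimplex by (fastforce simp: mem_W)
qed

text \<open>The monomial that stands for the simplex Y of the induced complex on X: with all lower
  copies taken as v, turning u into v at a first copy is the simplicial coboundary.\<close>

definition cell :: "nat set \<Rightarrow> nat set \<Rightarrow> monomial" where
  "cell X Y = (top_copies (X - Y), lower_copies X \<union> top_copies Y)"

lemma full_blocks_cell:
  assumes "X \<subseteq> \<Union>K0" "Y \<subseteq> X"
  shows "full_blocks (lower_copies X \<union> top_copies Y) = Y"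
proof
  show "full_blocks (lower_copies X \<union> top_copies Y) \<subseteq> Y"
  proof
    fix i assume i: "i \<in> full_blocks (lower_copies X \<union> top_copies Y)"
    then have "prod_encode (i, 1) \<in> lower_copies X \<union> top_copies Y"
      using pos[of i] by (auto simp: full_blocks_def subset_codes mem_copies)
    then show "i \<in> Y" by (simp add: mem_lower mem_top)
  qed
  show "Y \<subseteq> full_blocks (lower_copies X \<union> top_copies Y)"
    using assms by (auto simp: full_blocks_def subset_codes mem_copies mem_lower mem_top)
qed

lemma cell_in_R_basis:
  assumes "X \<subseteq> \<Union>K0" "Y \<subseteq> X"
  shows "cell X Y \<in> R_basis W \<longleftrightarrow> Y \<in> K0"
proof -
  have "lower_copies X \<subseteq> lower_copies (\<Union>K0)" "top_copies Y \<subseteq> top_copies (\<Union>K0)" "top_copies (X - Y) \<subseteq> top_copies (\<Union>K0)"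
    unfolding lower_copies_def top_copies_def using assms by blast+
  then have "lower_copies X \<union> top_copies Y \<subseteq> copies J (\<Union>K0)" "top_copies (X - Y) \<subseteq> copies J (\<Union>K0)"
    unfolding copies_split[OF order_refl] by blast+
  moreover have "top_copies (X - Y) \<inter> (lower_copies X \<union> top_copies Y) = {}"
    unfolding eq_codes by (auto simp: mem_lower mem_top)
  ultimately show ?thesis
    unfolding cell_def R_basis_def vertices_W by (simp add: mem_W full_blocks_cell[OF assms])
qed

lemma multidegree_cell: "\<lbrakk>X \<subseteq> \<Union>K0; Y \<subseteq> X\<rbrakk> \<Longrightarrow> multidegree (cell X Y) = copies J X"
  unfolding cell_def copies_split by (auto simp: top_copies_def)

lemma cell_inject: "\<lbrakk>cell X Y = cell X Y'; Y \<subseteq> X; Y' \<subseteq> X\<rbrakk> \<Longrightarrow> Y = Y'"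
proof -
  assume a: "cell X Y = cell X Y'" "Y \<subseteq> X" "Y' \<subseteq> X"
  then have "top_copies (X - Y) = top_copies (X - Y')" by (simp add: cell_def)
  then have "X - Y = X - Y'" unfolding eq_codes mem_top by auto
  with a show ?thesis by blast
qed

text \<open>Each copy of X contributes 2, except that the first copies of X - Y appear as u and
  contribute 1. The equation avoids subtraction of naturals.\<close>

lemma degree_cell:
  assumes "X \<subseteq> \<Union>K0" "Y \<subseteq> X"
  shows "card (fst (cell X Y)) + 2 * card (snd (cell X Y)) + card X = 2 * (\<Sum>i\<in>X. J i) + card Y"
proof -
  have fin: "finite X" "finite Y" using assms base.finite_vertices by (auto intro: finite_subset)
  have "finite (copies J X)" using fin by (simp add: finite_copies)
  then have fl: "finite (lower_copies X)" "finite (top_copies X)" using copies_split[OF assms(1)] by auto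
  have "(\<Sum>i\<in>X. J i) = card (lower_copies X) + card X"
    unfolding card_copies[OF fin(1), symmetric] copies_split[OF assms(1)]
    by (subst card_Un_disjoint[OF fl lower_top_disjoint]) (simp add: card_top)
  moreover have "card (snd (cell X Y)) = card (lower_copies X) + card Y"
    unfolding cell_def snd_conv
    by (subst card_Un_disjoint[OF fl(1) _ lower_top_disjoint]) (use fin in \<open>simp_all add: card_top finite_top\<close>)
  moreover have "card (fst (cell X Y)) = card X - card Y"
    using fin assms by (simp add: cell_def card_top card_Diff_subset)
  moreover have "card Y \<le> card X" using fin assms by (simp add: card_mono)
  ultimately show ?thesis by linarith
qed

lemma cell_insert:
  assumes "y \<in> X - Y"
  shows "(fst (cell X Y) - {prod_encode (y, 1)}, insert (prod_encode (y, 1)) (snd (cell X Y))) = cell X (insert y Y)"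
  using assms unfolding cell_def prod.inject fst_conv snd_conv eq_codes by (auto simp: mem_top mem_lower)

lemma cell_remove:
  assumes "y \<in> Y" "Y \<subseteq> X"
  shows "(insert (prod_encode (y, 1)) (fst (cell X Y)), snd (cell X Y) - {prod_encode (y, 1)}) = cell X (Y - {y})"
  using assms unfolding cell_def prod.inject fst_conv snd_conv eq_codes by (auto simp: mem_top mem_lower)

lemma R_basis_cell:
  assumes "m \<in> R_basis W" "X \<subseteq> \<Union>K0" "multidegree m = copies J X" "lower_copies X \<subseteq> snd m"
  shows "\<exists>Y. Y \<in> K0 \<and> Y \<subseteq> X \<and> m = cell X Y"
proof -
  obtain A B where m: "m = (A, B)" by (cases m)
  define Y where "Y = {i \<in> X. prod_encode (i, 1) \<in> B}"
  have disj: "A \<inter> B = {}" using assms(1) m by (auto simp: R_basis_def)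
  have AB: "A \<union> B = lower_copies X \<union> top_copies X" using assms m copies_split by simp
  have "lower_copies X \<subseteq> B" using assms m by simp
  moreover have "B = lower_copies X \<union> (B \<inter> top_copies X)" using AB calculation lower_top_disjoint by blast
  moreover have "B \<inter> top_copies X = top_copies Y" by (auto simp: Y_def top_copies_def)
  ultimately have B: "B = lower_copies X \<union> top_copies Y" by simp
  have "A = top_copies X - top_copies Y" using AB disj B lower_top_disjoint by blast
  also have "\<dots> = top_copies (X - Y)" unfolding eq_codes Diff_iff mem_top by auto
  finally have "m = cell X Y" using m B by (simp add: cell_def)
  moreover have "Y \<subseteq> X" by (auto simp: Y_def)
  ultimately show ?thesis using cell_in_R_basis[OF assms(2)] assms(1) by metis
qed

section \<open>Reducing cochains to cells\<close>

lemma toggle_partial_block: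
  assumes "B \<in> W" "v \<in> copies J {i}" "w \<in> copies J {i}" "w \<noteq> v" "w \<notin> B" "i \<in> \<Union>K0"
  shows "insert v B \<in> W"
proof -
  have "full_blocks (insert v B) \<subseteq> full_blocks B"
  proof
    fix j assume j: "j \<in> full_blocks (insert v B)"
    then have "j \<noteq> i" using assms by (auto simp: full_blocks_def)
    then have "v \<notin> copies J {j}" using assms(2) by (auto simp: copies_def)
    then show "j \<in> full_blocks B" using j by (auto simp: full_blocks_def)
  qed
  moreover have "v \<in> copies J (\<Union>K0)" using assms by (auto simp: copies_def)
  ultimately show ?thesis using assms(1) base.subsimplex by (auto simp: mem_W)
qed

text \<open>While some lower copy of i appears as u, block i is not full whatever happens to its
  first copy, which may thus be exchanged freely; this matching removes all such monomials, one
  block at a time. The condition on \<open>bd x\<close> is weaker than vanishing, because x is also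
  taken to be a primitive of the Massey value.\<close>

lemma block_reduction:
  fixes x :: "'k::comm_ring_1 cochain"
  assumes X: "X \<subseteq> \<Union>K0"
    and x: "x \<in> grade (R_alg W) d" "\<And>m. m \<in> keys x \<Longrightarrow> multidegree m = copies J X"
    and dx: "\<And>m. m \<in> keys (bd x) \<Longrightarrow> lower_copies X \<subseteq> snd m"
  shows "\<exists>y\<in>grade (R_alg W) (d - 1). keys (x - bd y) \<subseteq> cell X ` {Y \<in> K0. Y \<subseteq> X}"
proof -
  interpret A: dg_algebra "R_alg W :: ('k cochain) dga" by (rule dg_algebra_R)
  have finX: "finite X" using X base.finite_vertices by (rule finite_subset)
  have "\<exists>y\<in>grade (R_alg W) (d - 1). keys (x - bd y) \<subseteq>
      {m \<in> R_basis W. multidegree m = copies J X \<and> lower_copies F \<subseteq> snd m}" if "F \<subseteq> X" "finite F" for F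
    using that(2,1)
  proof (induction F rule: finite_induct)
    case empty
    have "keys x \<subseteq> {m \<in> R_basis W. multidegree m = copies J X \<and> lower_copies {} \<subseteq> snd m}"
      using x by (auto simp: grade_keys lower_copies_def)
    then show ?case using A.grade_0 by (intro bexI[of _ 0]) (auto simp: A.diff_0)
  next
    case (insert i F)
    let ?U = "{m \<in> R_basis W. multidegree m = copies J X \<and> lower_copies F \<subseteq> snd m}"
    let ?U1 = "{m \<in> ?U. \<not> lower_copies {i} \<subseteq> snd m}"
    let ?v = "prod_encode (i, 1)"
    obtain y where y: "y \<in> grade (R_alg W) (d - 1)" "keys (x - bd y) \<subseteq> ?U"
      using insert by auto
    have i: "i \<in> X" "i \<in> \<Union>K0" using insert.prems X by auto
    have ddy: "bd (x - bd y) = bd x"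
      by (simp add: A.diff_minus2 A.diff_diff[OF y(1)])
    have vF: "?v \<notin> lower_copies G" for G by (simp add: mem_lower)
    have v_in: "?v \<in> copies J {i}" "?v \<in> copies J X" using pos i by (auto simp: mem_copies)
    obtain z where z: "z \<in> grade (R_alg W) (d - 1)" "keys (x - bd y - bd z) \<subseteq> ?U - ?U1"
    proof (rule toggle_reduction[of "x - bd y" d ?U ?U1 ?v])
      show "x - bd y \<in> grade (R_alg W) d"
        using A.grade_minus[OF x(1)] A.grade_diff[OF y(1)] by simp
    next
      fix A B j assume "(A, B) \<in> ?U" "j \<in> A" "insert j B \<in> W"
      then show "(A - {j}, insert j B) \<in> ?U" by (auto simp: R_basis_def)
    next
      fix A B j assume "(A, B) \<in> ?U - ?U1" "j \<in> A" "insert j B \<in> W"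
      then show "(A - {j}, insert j B) \<notin> ?U1" by auto
    next
      fix A B assume "(A, B) \<in> ?U1"
      then show "?v \<in> A \<union> B" using v_in by auto
    next
      fix A B assume a: "(A, B) \<in> ?U1" "?v \<in> B"
      then have "B - {?v} \<in> W" by (auto simp: R_basis_def intro: subsimplex)
      moreover have "?v \<in> \<Union>W" using a by (auto simp: R_basis_def)
      ultimately show "(insert ?v A, B - {?v}) \<in> ?U1" using a vF by (auto simp: R_basis_def)
    next
      fix A B assume a: "(A, B) \<in> ?U1" "?v \<in> A"
      then obtain w where w: "w \<in> lower_copies {i}" "w \<notin> B" by auto
      then have "w \<in> copies J {i}" "w \<noteq> ?v" using vF[of "{i}"] by (auto simp: lower_copies_def copies_def)
      then have "insert ?v B \<in> W"
        using a w v_in i by (intro toggle_partial_block[of B ?v i w]) (auto simp: R_basis_def)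
      moreover have "\<not> lower_copies {i} \<subseteq> insert ?v B" using w \<open>w \<noteq> ?v\<close> by auto
      ultimately show "(A - {?v}, insert ?v B) \<in> ?U1" using a by (auto simp: R_basis_def)
    next
      have "lower_copies {i} \<subseteq> lower_copies X" using i by (auto simp: lower_copies_def)
      then show "keys (bd (x - bd y)) \<inter> ?U1 = {}"
        unfolding ddy using dx by blast
    qed (use y in auto)
    have "lower_copies (insert i F) = lower_copies {i} \<union> lower_copies F" by (auto simp: lower_copies_def)
    then have sub: "?U - ?U1 \<subseteq> {m \<in> R_basis W. multidegree m = copies J X \<and> lower_copies (insert i F) \<subseteq> snd m}" by auto
    have eq: "x - bd (y + z) = x - bd y - bd z"
      by (simp add: A.diff_add)
    show ?case
    proof (rule bexI)
      show "keys (x - bd (y + z)) \<subseteq>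
          {m \<in> R_basis W. multidegree m = copies J X \<and> lower_copies (insert i F) \<subseteq> snd m}"
        unfolding eq using z(2) sub by (rule order_trans)
    qed (rule A.grade_add[OF y(1) z(1)])
  qed
  from this[OF order_refl finX] obtain y where y: "y \<in> grade (R_alg W) (d - 1)"
    "keys (x - bd y) \<subseteq> {m \<in> R_basis W. multidegree m = copies J X \<and> lower_copies X \<subseteq> snd m}" by blast
  have "{m \<in> R_basis W. multidegree m = copies J X \<and> lower_copies X \<subseteq> snd m} \<subseteq> cell X ` {Y \<in> K0. Y \<subseteq> X}"
    using R_basis_cell[OF _ X] by blast
  with y show ?thesis by blast
qed

text \<open>Transfers the matchings from monomials to faces of the induced complex on X, where the
  differential can only enlarge faces. In this form the combinatorics of K(n) enters.\<close>

lemma cell_reduction: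
  fixes x :: "'k::comm_ring_1 cochain"
  assumes X: "X \<subseteq> \<Union>K0" and v: "v \<in> X"
    and x: "x \<in> grade (R_alg W) d" "keys x \<subseteq> cell X ` \<G>"
    and G: "\<G> \<subseteq> {Y \<in> K0. Y \<subseteq> X}" "\<G>1 \<subseteq> \<G>"
    and upper: "\<And>Y y. \<lbrakk>Y \<in> \<G>; y \<in> X - Y; insert y Y \<in> K0\<rbrakk> \<Longrightarrow> insert y Y \<in> \<G>"
    and upper2: "\<And>Y y. \<lbrakk>Y \<in> \<G> - \<G>1; y \<in> X - Y; insert y Y \<in> K0\<rbrakk> \<Longrightarrow> insert y Y \<notin> \<G>1"
    and toggle: "\<And>Y. Y \<in> \<G>1 \<Longrightarrow> insert v Y \<in> \<G>1 \<and> Y - {v} \<in> \<G>1"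
    and dx: "bd x = 0"
  obtains y where "y \<in> grade (R_alg W) (d - 1)" "keys (x - bd y) \<subseteq> cell X ` (\<G> - \<G>1)"
proof -
  have GX: "Y \<subseteq> X" "Y \<in> K0" if "Y \<in> \<G>" for Y using subsetD[OF G(1) that] by simp_all
  have G1X: "Y \<subseteq> X" "Y \<in> K0" if "Y \<in> \<G>1" for Y using GX[OF subsetD[OF G(2) that]] by simp_all
  have img: "Y \<in> \<H>" if H: "cell X Y \<in> cell X ` \<H>" "Y \<subseteq> X" "\<H> \<subseteq> \<G>" for Y \<H>
  proof -
    obtain Y' where Y': "cell X Y = cell X Y'" "Y' \<in> \<H>" by (rule imageE[OF H(1)])
    have "Y' \<subseteq> X" by (rule GX(1)[OF subsetD[OF H(3) Y'(2)]])
    then show ?thesis using cell_inject[OF Y'(1) H(2)] Y'(2) by simp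
  qed
  have step: "\<exists>y\<in>X - Y. j = prod_encode (y, 1) \<and> (A - {j}, insert j B) = cell X (insert y Y) \<and> insert y Y \<in> K0"
    if AB: "(A, B) = cell X Y" "Y \<subseteq> X" "j \<in> A" "insert j B \<in> W" "(A, B) \<in> R_basis W" for A B j Y
  proof -
    obtain y where y: "y \<in> X - Y" "j = prod_encode (y, 1)"
      using AB by (auto simp: cell_def top_copies_def)
    have c: "(A - {j}, insert j B) = cell X (insert y Y)"
      using cell_insert[OF y(1)] unfolding AB(1)[symmetric] y(2) by simp
    have "(A - {j}, insert j B) \<in> R_basis W" using AB by (auto simp: R_basis_def)
    then have "insert y Y \<in> K0" using cell_in_R_basis[OF X, of "insert y Y"] y AB(2) unfolding c by blast
    with y c show ?thesis by blast
  qed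
  have B: "cell X Y \<in> R_basis W" if "Y \<in> \<G>" for Y using that GX cell_in_R_basis[OF X] by blast
  obtain y where y: "y \<in> grade (R_alg W) (d - 1)" "keys (x - bd y) \<subseteq> cell X ` \<G> - cell X ` \<G>1"
  proof (rule toggle_reduction[of x d "cell X ` \<G>" "cell X ` \<G>1" "prod_encode (v, 1)"])
    show "cell X ` \<G>1 \<subseteq> cell X ` \<G>" using G by blast
    show "cell X ` \<G> \<subseteq> R_basis W" using B by blast
  next
    fix A C j assume a: "(A, C) \<in> cell X ` \<G>" "j \<in> A" "insert j C \<in> W"
    then obtain Y where Y: "Y \<in> \<G>" "(A, C) = cell X Y" by blast
    from step[OF Y(2) GX(1)[OF Y(1)] a(2,3)] B[OF Y(1)] Y(2)
    obtain y where "y \<in> X - Y" "(A - {j}, insert j C) = cell X (insert y Y)" "insert y Y \<in> K0" by auto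
    then show "(A - {j}, insert j C) \<in> cell X ` \<G>" using upper[OF Y(1)] by simp
  next
    fix A C j assume a: "(A, C) \<in> cell X ` \<G> - cell X ` \<G>1" "j \<in> A" "insert j C \<in> W"
    then obtain Y where Y: "Y \<in> \<G>" "(A, C) = cell X Y" by blast
    then have Y1: "Y \<in> \<G> - \<G>1" using a(1) by auto
    from step[OF Y(2) GX(1)[OF Y(1)] a(2,3)] B[OF Y(1)] Y(2)
    obtain y where y: "y \<in> X - Y" "(A - {j}, insert j C) = cell X (insert y Y)" "insert y Y \<in> K0" by auto
    then have "insert y Y \<notin> \<G>1" using upper2[OF Y1] by blast
    then show "(A - {j}, insert j C) \<notin> cell X ` \<G>1"
      unfolding y(2) using img[of "insert y Y" \<G>1] y(1) GX(1)[OF Y(1)] G(2) by blast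
  next
    fix A C assume "(A, C) \<in> cell X ` \<G>1"
    then obtain Y where "(A, C) = cell X Y" by blast
    then show "prod_encode (v, 1) \<in> A \<union> C" using v by (auto simp: cell_def top_copies_def)
  next
    fix A C assume a: "(A, C) \<in> cell X ` \<G>1" "prod_encode (v, 1) \<in> C"
    then obtain Y where Y: "Y \<in> \<G>1" "(A, C) = cell X Y" by blast
    then have "v \<in> Y" using a(2) by (simp add: cell_def mem_lower mem_top)
    then have "(insert (prod_encode (v, 1)) A, C - {prod_encode (v, 1)}) = cell X (Y - {v})"
      using cell_remove[of v Y X] G1X[OF Y(1)] unfolding Y(2)[symmetric] by simp
    then show "(insert (prod_encode (v, 1)) A, C - {prod_encode (v, 1)}) \<in> cell X ` \<G>1"
      using toggle[OF Y(1)] by simp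
  next
    fix A C assume a: "(A, C) \<in> cell X ` \<G>1" "prod_encode (v, 1) \<in> A"
    then obtain Y where Y: "Y \<in> \<G>1" "(A, C) = cell X Y" by blast
    then have "v \<in> X - Y" using a(2) by (simp add: cell_def mem_top)
    then have "(A - {prod_encode (v, 1)}, insert (prod_encode (v, 1)) C) = cell X (insert v Y)"
      using cell_insert[of v X Y] unfolding Y(2)[symmetric] by simp
    then show "(A - {prod_encode (v, 1)}, insert (prod_encode (v, 1)) C) \<in> cell X ` \<G>1"
      using toggle[OF Y(1)] by simp
  qed (use x dx in auto)
  have "cell X ` \<G> - cell X ` \<G>1 \<subseteq> cell X ` (\<G> - \<G>1)" by blast
  with y that show ?thesis by blast
qed

text \<open>A copy w of i outside the multidegree keeps block i from ever being full, so exchanging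
  v matches all monomials of that multidegree and nothing is left.\<close>

lemma exact_partial_block:
  fixes x :: "'k::comm_ring_1 cochain"
  assumes x: "x \<in> grade (R_alg W) d" "bd x = 0" "\<And>m. m \<in> keys x \<Longrightarrow> multidegree m = S"
    and i: "i \<in> \<Union>K0" "v \<in> copies J {i}" "v \<in> S" "w \<in> copies J {i}" "w \<notin> S"
  shows "\<exists>y\<in>grade (R_alg W) (d - 1). x = bd y"
proof -
  let ?U = "{m \<in> R_basis W. multidegree m = S}"
  obtain y where "y \<in> grade (R_alg W) (d - 1)" "keys (x - bd y) \<subseteq> ?U - ?U"
  proof (rule toggle_reduction[of x d ?U ?U v])
    show "keys x \<subseteq> ?U" using x by (auto simp: grade_keys)
  next
    fix A B j assume "(A, B) \<in> ?U" "j \<in> A" "insert j B \<in> W"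
    then show "(A - {j}, insert j B) \<in> ?U" by (auto simp: R_basis_def)
  next
    fix A B assume a: "(A, B) \<in> ?U" "v \<in> B"
    then have "B - {v} \<in> W" by (auto simp: R_basis_def intro: subsimplex)
    moreover have "v \<in> \<Union>W" using a by (auto simp: R_basis_def)
    ultimately show "(insert v A, B - {v}) \<in> ?U" using a by (auto simp: R_basis_def)
  next
    fix A B assume a: "(A, B) \<in> ?U" "v \<in> A"
    then have "insert v B \<in> W"
      using i by (intro toggle_partial_block[of B v i w]) (auto simp: R_basis_def)
    then show "(A - {v}, insert v B) \<in> ?U" using a by (auto simp: R_basis_def)
  qed (use x i in auto)
  then show ?thesis by (intro bexI[of _ y]) auto
qed

text \<open>By Hochster's decomposition only unions of blocks can carry cohomology.\<close>

lemma exact_by_cells: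
  fixes x :: "'k::comm_ring_1 cochain"
  assumes x: "x \<in> grade (R_alg W) d" "bd x = 0"
    and cells: "\<And>X (z :: 'k cochain). \<lbrakk>X \<subseteq> \<Union>K0; copies J X \<in> multidegree ` keys x;
      z \<in> grade (R_alg W) d; bd z = 0; keys z \<subseteq> cell X ` {Y \<in> K0. Y \<subseteq> X}\<rbrakk>
      \<Longrightarrow> \<exists>y\<in>grade (R_alg W) (d - 1). z = bd y"
  shows "\<exists>y\<in>grade (R_alg W) (d - 1). x = bd y"
proof (rule exact_by_multidegree[OF x])
  interpret A: dg_algebra "R_alg W :: ('k cochain) dga" by (rule dg_algebra_R)
  fix m and z :: "'k cochain"
  assume m: "m \<in> keys x" and z: "z \<in> grade (R_alg W) d" "bd z = 0"
    and mz: "\<And>m'. m' \<in> keys z \<Longrightarrow> multidegree m' = multidegree m"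
  let ?S = "multidegree m"
  have mB: "m \<in> R_basis W" using m x(1) by (auto simp: grade_keys)
  then have SV: "?S \<subseteq> copies J (\<Union>K0)" by (auto simp: R_basis_def simp flip: vertices_W)
  show "\<exists>y\<in>grade (R_alg W) (d - 1). z = bd y"
  \<comment> \<open>Either the multidegree cuts some block, or it is the union of the blocks that it
    meets.\<close>
  proof (cases "\<exists>i\<in>\<Union>K0. \<exists>v w. v \<in> copies J {i} \<and> v \<in> ?S \<and> w \<in> copies J {i} \<and> w \<notin> ?S")
    case True
    then obtain i v w where i: "i \<in> \<Union>K0" "v \<in> copies J {i}" "v \<in> ?S" "w \<in> copies J {i}" "w \<notin> ?S" by blast
    show ?thesis by (rule exact_partial_block[OF z, of ?S i v w]) fact+
  next
    case False
    define X where "X = {i \<in> \<Union>K0. copies J {i} \<subseteq> ?S}"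
    have X: "X \<subseteq> \<Union>K0" by (auto simp: X_def)
    have S: "?S = copies J X"
    proof
      show "copies J X \<subseteq> ?S"
      proof
        fix v assume "v \<in> copies J X"
        then obtain i where "i \<in> X" "v \<in> copies J {i}" by (auto simp: copies_def)
        then show "v \<in> ?S" unfolding X_def by blast
      qed
      show "?S \<subseteq> copies J X"
      proof
        fix v assume v: "v \<in> ?S"
        have "v \<in> copies J (\<Union>K0)" by (rule subsetD[OF SV v])
        then obtain i where i: "i \<in> \<Union>K0" "v \<in> copies J {i}" unfolding copies_def by blast
        have "copies J {i} \<subseteq> ?S"
        proof
          fix w assume w: "w \<in> copies J {i}"
          show "w \<in> ?S" by (rule ccontr) (use False i v w in blast)
        qed
        then have "i \<in> X" using i(1) unfolding X_def by blast
        then show "v \<in> copies J X" using i(2) unfolding copies_def by blast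
      qed
    qed
    have "\<exists>y\<in>grade (R_alg W) (d - 1). keys (z - bd y) \<subseteq> cell X ` {Y \<in> K0. Y \<subseteq> X}"
      by (rule block_reduction[OF X z(1)]) (use mz S z(2) in auto)
    then obtain y where y: "y \<in> grade (R_alg W) (d - 1)"
      "keys (z - bd y) \<subseteq> cell X ` {Y \<in> K0. Y \<subseteq> X}" by blast
    have "\<exists>u\<in>grade (R_alg W) (d - 1). z - bd y = bd u"
    proof (rule cells[OF X])
      show "copies J X \<in> multidegree ` keys x" using m S by blast
      show "z - bd y \<in> grade (R_alg W) d" using A.grade_minus[OF z(1)] A.grade_diff[OF y(1)] by simp
      show "bd (z - bd y) = 0" using z A.diff_diff[OF y(1)] by (simp add: A.diff_minus2)
    qed (rule y(2))
    then obtain u where u: "u \<in> grade (R_alg W) (d - 1)" "z - bd y = bd u" by blast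
    then have "z = bd (u + y)" by (simp add: A.diff_add algebra_simps)
    then show ?thesis using A.grade_add[OF u(1) y(1)] by blast
  qed
qed

lemma exact_if_reduced_to_zero:
  fixes x :: "'k::comm_ring_1 cochain"
  assumes "y \<in> grade (R_alg W) (d - 1)" "keys (x - bd y) \<subseteq> {}"
  shows "\<exists>y\<in>grade (R_alg W) (d - 1). x = bd y"
  using assms by (intro bexI[of _ y]) auto

end

section \<open>Vanishing of cohomology for the complexes \<open>K\<^sub>P\<^sub>(\<^sub>n\<^sub>,\<^sub>s\<^sub>)\<close>\<close>

text \<open>The bound on s lets the degree determine the number of left vertices. The bound on J
  outside 1, ..., 2n puts every cell that involves such a vertex above 2sn + 2, the largest degree
  considered.\<close>

locale massey_family = multiwedge_complex +
  fixes n s :: nat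
  assumes n: "n \<ge> 2" and s: "s > 4 * n"
    and Kn: "induced K0 {1..2 * n} = complex_Kn n"
    and J_s: "i \<in> {1..n} \<Longrightarrow> J i = s" and J_1: "i \<in> {n+1..2 * n} \<Longrightarrow> J i = 1"
    and J_large: "\<lbrakk>i \<in> \<Union>K0; i \<notin> {1..2 * n}\<rbrakk> \<Longrightarrow> J i > 2 * s * n + 2"
begin

text \<open>With p = k + i, the minimal nonfaces of K(n) are the pairs {k, n + p} with k \<le> p
  \<le> n, except {1, 2n}, which \<open>i \<le> n - 2\<close> rules out.\<close>

lemma face_iff:
  assumes "Y \<subseteq> {1..2 * n}"
  shows "Y \<in> K0 \<longleftrightarrow> (\<forall>k p. k \<in> Y \<and> n + p \<in> Y \<and> k \<le> p \<and> p \<le> n \<longrightarrow> k = 1 \<and> p = n)"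
proof -
  have "Y \<in> K0 \<longleftrightarrow> Y \<in> complex_Kn n" using assms Kn by (auto simp: induced_def)
  also have "\<dots> \<longleftrightarrow> (\<forall>k i. i \<le> n - 2 \<and> 1 \<le> k \<and> k \<le> n - i \<longrightarrow> \<not> {k, n + k + i} \<subseteq> Y)"
    using assms unfolding complex_Kn_def complex_of_nonfaces_def by blast
  also have "\<dots> \<longleftrightarrow> (\<forall>k p. k \<in> Y \<and> n + p \<in> Y \<and> k \<le> p \<and> p \<le> n \<longrightarrow> k = 1 \<and> p = n)"
  proof (intro iffI allI impI)
    fix k p
    assume a: "\<forall>k i. i \<le> n - 2 \<and> 1 \<le> k \<and> k \<le> n - i \<longrightarrow> \<not> {k, n + k + i} \<subseteq> Y"
      and kp: "k \<in> Y \<and> n + p \<in> Y \<and> k \<le> p \<and> p \<le> n"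
    then have k1: "1 \<le> k" using assms by auto
    show "k = 1 \<and> p = n"
    proof (rule ccontr)
      assume "\<not> (k = 1 \<and> p = n)"
      then have "p - k \<le> n - 2 \<and> 1 \<le> k \<and> k \<le> n - (p - k)" using kp k1 n by auto
      then have "\<not> {k, n + k + (p - k)} \<subseteq> Y" using a by blast
      then show False using kp by simp
    qed
  next
    fix k i
    assume a: "\<forall>k p. k \<in> Y \<and> n + p \<in> Y \<and> k \<le> p \<and> p \<le> n \<longrightarrow> k = 1 \<and> p = n"
      and ki: "i \<le> n - 2 \<and> 1 \<le> k \<and> k \<le> n - i"
    show "\<not> {k, n + k + i} \<subseteq> Y"
    proof
      assume "{k, n + k + i} \<subseteq> Y"
      then have "k \<in> Y \<and> n + (k + i) \<in> Y \<and> k \<le> k + i \<and> k + i \<le> n" using ki n by (auto simp: add.assoc)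
      then have "k = 1 \<and> k + i = n" using a by blast
      then show False using ki n by auto
    qed
  qed
  finally show ?thesis .
qed

lemma vertices_Kn: "{1..2 * n} \<subseteq> \<Union>K0"
proof
  fix i assume "i \<in> {1..2 * n}"
  then have "{i} \<in> K0" by (subst face_iff) auto
  then show "i \<in> \<Union>K0" by blast
qed

text \<open>
  The weight vanishes on the multidegrees of the entries of the standard defining system.  The classes
  in \<open>H\<^sup>2\<^sup>s\<^sup>k\<^sup>+\<^sup>1\<close>, \<open>1 < k < n\<close>, by which an entry could be altered all have positive weight, whereas
  \<open>H\<^sup>2\<^sup>s\<^sup>n\<^sup>+\<^sup>2\<close> has no classes of positive weight.
\<close>

definition vertex_weight :: "nat \<Rightarrow> int" where
  "vertex_weight v = (case prod_decode v of (i, k) \<Rightarrow>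
     if k = 1 \<and> i \<in> {1..n} then int (n * n) + 1 - int i
     else if k = 1 \<and> i \<in> {n+1..2 * n} then int (i - n) - (int (n * n) + 1) else 0)"

definition weight :: "monomial \<Rightarrow> int" where
  "weight m = (\<Sum>v\<in>multidegree m. vertex_weight v)"

section \<open>Left and right vertices; degree and weight of cells\<close>

definition left_part :: "nat set \<Rightarrow> nat set" where "left_part X = X \<inter> {1..n}"
definition right_part :: "nat set \<Rightarrow> nat set" where "right_part X = {p \<in> {1..n}. n + p \<in> X}"

lemma parts:
  assumes "X \<subseteq> {1..2 * n}"
  shows "X = left_part X \<union> (+) n ` right_part X" "left_part X \<inter> (+) n ` right_part X = {}"
    "finite (left_part X)" "finite (right_part X)"
proof -
  show "X = left_part X \<union> (+) n ` right_part X"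
  proof
    show "X \<subseteq> left_part X \<union> (+) n ` right_part X"
    proof
      fix i assume i: "i \<in> X"
      show "i \<in> left_part X \<union> (+) n ` right_part X"
      proof (cases "i \<le> n")
        case False
        then have "i = n + (i - n)" "i - n \<in> right_part X" using i assms by (auto simp: right_part_def)
        then show ?thesis by blast
      qed (use i assms in \<open>auto simp: left_part_def\<close>)
    qed
  qed (auto simp: left_part_def right_part_def)
qed (auto simp: left_part_def right_part_def)

lemma sum_parts:
  fixes f :: "nat \<Rightarrow> 'b::comm_monoid_add"
  assumes "X \<subseteq> {1..2 * n}"
  shows "sum f X = (\<Sum>i\<in>left_part X. f i) + (\<Sum>p\<in>right_part X. f (n + p))"
proof -
  have "sum f X = sum f (left_part X \<union> (+) n ` right_part X)" using parts(1)[OF assms] by simp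
  also have "\<dots> = sum f (left_part X) + sum f ((+) n ` right_part X)"
    using parts(2-4)[OF assms] by (intro sum.union_disjoint) auto
  also have "sum f ((+) n ` right_part X) = (\<Sum>p\<in>right_part X. f (n + p))"
    by (subst sum.reindex) auto
  finally show ?thesis .
qed

lemma card_parts: "X \<subseteq> {1..2 * n} \<Longrightarrow> card X = card (left_part X) + card (right_part X)"
  using sum_parts[of X "\<lambda>_. 1 :: nat"] by simp

lemma card_part_le: "card (left_part X) \<le> n" "card (right_part X) \<le> n"
proof -
  have "left_part X \<subseteq> {1..n}" "right_part X \<subseteq> {1..n}" by (auto simp: left_part_def right_part_def)
  then show "card (left_part X) \<le> n" "card (right_part X) \<le> n"
    using card_mono[of "{1..n}"] by fastforce+
qed

lemma sum_J: "X \<subseteq> {1..2 * n} \<Longrightarrow> (\<Sum>i\<in>X. J i) = s * card (left_part X) + card (right_part X)"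
proof -
  assume X: "X \<subseteq> {1..2 * n}"
  have "(\<Sum>i\<in>left_part X. J i) = (\<Sum>i\<in>left_part X. s)"
    by (rule sum.cong) (auto simp: left_part_def J_s)
  moreover have "(\<Sum>p\<in>right_part X. J (n + p)) = (\<Sum>p\<in>right_part X. 1)"
    by (rule sum.cong) (auto simp: right_part_def J_1)
  ultimately show ?thesis unfolding sum_parts[OF X] by simp
qed

text \<open>Only first copies carry weight, so each vertex of X counts once, however many copies it
  has.\<close>

lemma weight_copies:
  assumes "X \<subseteq> {1..2 * n}" "multidegree m = copies J X"
  shows "weight m = (int (n * n) + 1) * (int (card (left_part X)) - int (card (right_part X)))
    + int (\<Sum>(right_part X)) - int (\<Sum>(left_part X))"
proof -
  have XK: "X \<subseteq> \<Union>K0" using assms(1) vertices_Kn by blast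
  have fin: "finite (copies J X)" using assms(1) by (intro finite_copies) (auto intro: finite_subset)
  have "weight m = (\<Sum>v\<in>top_copies X. vertex_weight v)"
    unfolding weight_def assms(2)
  proof (rule sum.mono_neutral_right[OF fin])
    show "top_copies X \<subseteq> copies J X" unfolding copies_split[OF XK] by blast
    show "\<forall>v\<in>copies J X - top_copies X. vertex_weight v = 0"
      by (auto simp: copies_def mem_top vertex_weight_def split: if_splits)
  qed
  also have "\<dots> = (\<Sum>i\<in>X. vertex_weight (prod_encode (i, 1)))"
    unfolding top_copies_def by (subst sum.reindex) (auto simp: inj_on_def)
  also have "\<dots> = (\<Sum>i\<in>left_part X. int (n * n) + 1 - int i) + (\<Sum>p\<in>right_part X. int p - (int (n * n) + 1))"
    unfolding sum_parts[OF assms(1)]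
    by (intro arg_cong2[of _ _ _ _ "(+)"] sum.cong refl) (auto simp: left_part_def right_part_def vertex_weight_def)
  finally show ?thesis by (simp add: sum_subtractf algebra_simps)
qed

lemma degree_key:
  assumes "z \<in> grade (R_alg W) d" "cell X Y \<in> keys z" "X \<subseteq> {1..2 * n}" "Y \<subseteq> X"
  shows "2 * int s * int (card (left_part X)) + int (card (right_part X)) + int (card Y) = d + int (card (left_part X))"
proof -
  have "X \<subseteq> \<Union>K0" using assms(3) vertices_Kn by blast
  from degree_cell[OF this assms(4)]
  have "card (fst (cell X Y)) + 2 * card (snd (cell X Y)) + (card (left_part X) + card (right_part X)) =
      2 * (s * card (left_part X) + card (right_part X)) + card Y"
    unfolding sum_J[OF assms(3)] card_parts[OF assms(3)] .
  moreover have "int (card (fst (cell X Y)) + 2 * card (snd (cell X Y))) = d"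
    using assms(1,2) by (auto simp: grade_keys)
  ultimately have "d + int (card (left_part X) + card (right_part X)) = int (2 * (s * card (left_part X) + card (right_part X)) + card Y)"
    by linarith
  then show ?thesis by (simp add: algebra_simps)
qed

text \<open>The degree of a cell is at least the number of copies of X, and one large block already
  exceeds d.\<close>

lemma no_keys_outside:
  assumes z: "z \<in> grade (R_alg W) d" "keys z \<subseteq> cell X ` {Y \<in> K0. Y \<subseteq> X}"
    and X: "X \<subseteq> \<Union>K0" "\<not> X \<subseteq> {1..2 * n}" and d: "d \<le> int (2 * s * n + 2)"
  shows "z = 0"
proof -
  obtain i where i: "i \<in> X" "i \<notin> {1..2 * n}" using X by blast
  have fin: "finite X" using X(1) base.finite_vertices by (rule finite_subset)
  have "keys z = {}"
  proof (rule ccontr)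
    assume "keys z \<noteq> {}"
    then obtain Y where Y: "Y \<subseteq> X" "cell X Y \<in> keys z" using z(2) by blast
    have "(\<Sum>i\<in>X. 1) \<le> (\<Sum>i\<in>X. J i)" by (rule sum_mono) (rule pos[OF subsetD[OF X(1)]])
    then have "card X \<le> (\<Sum>i\<in>X. J i)" by simp
    moreover have "J i \<le> (\<Sum>i\<in>X. J i)" using fin i by (intro member_le_sum) auto
    moreover have "J i > 2 * s * n + 2" using J_large i X by blast
    moreover have "int (card (fst (cell X Y)) + 2 * card (snd (cell X Y))) = d"
      using z(1) Y by (auto simp: grade_keys)
    ultimately show False using degree_cell[OF X(1) Y(1)] d by linarith
  qed
  then show ?thesis by simp
qed

text \<open>The right vertex n + t conflicts only with left vertices k \<le> t, so a face without
  these can take or drop it. It cannot acquire the edge {1, 2n} in this way, because 1 \<le> t keeps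
  1 out of it.\<close>

lemma reduction_step1:
  fixes z :: "'k::comm_ring_1 cochain"
  assumes X: "X \<subseteq> {1..2 * n}" and t: "t \<in> right_part X" 
    and z: "z \<in> grade (R_alg W) d" "bd z = 0" "keys z \<subseteq> cell X ` {Y \<in> K0. Y \<subseteq> X}"
  obtains y where "y \<in> grade (R_alg W) (d - 1)"
    "keys (z - bd y) \<subseteq> cell X ` {Y \<in> K0. Y \<subseteq> X \<and> (1 \<in> Y \<and> 2 * n \<in> Y \<or> (\<exists>k\<in>Y. k \<le> t))}"
proof -
  have XK: "X \<subseteq> \<Union>K0" using X vertices_Kn by blast
  have t1: "1 \<le> t" "t \<le> n" "n + t \<in> X" using t by (auto simp: right_part_def)
  let ?G = "{Y \<in> K0. Y \<subseteq> X}"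
  let ?G1 = "{Y \<in> K0. Y \<subseteq> X \<and> \<not> (1 \<in> Y \<and> 2 * n \<in> Y) \<and> (\<forall>k\<in>Y. t < k)}"
  obtain y where y: "y \<in> grade (R_alg W) (d - 1)" "keys (z - bd y) \<subseteq> cell X ` (?G - ?G1)"
  proof (rule cell_reduction[OF XK t1(3) z(1,3) _ _ _ _ _ z(2)])
    fix Y assume Y: "Y \<in> ?G1"
    have Yn: "Y \<subseteq> {1..2 * n}" using Y X by blast
    have f: "k = 1 \<and> p = n" if "k \<in> Y" "n + p \<in> Y" "k \<le> p" "p \<le> n" for k p
      using Y that unfolding face_iff[OF Yn] mem_Collect_eq by blast
    have "insert (n + t) Y \<in> K0"
    proof (subst face_iff)
      show "insert (n + t) Y \<subseteq> {1..2 * n}" using Yn t1 by auto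
      show "\<forall>k p. k \<in> insert (n + t) Y \<and> n + p \<in> insert (n + t) Y \<and> k \<le> p \<and> p \<le> n \<longrightarrow> k = 1 \<and> p = n"
      proof (intro allI impI)
        fix k p assume kp: "k \<in> insert (n + t) Y \<and> n + p \<in> insert (n + t) Y \<and> k \<le> p \<and> p \<le> n"
        then have k: "k \<in> Y" using t1 by auto
        then have "t < k" using Y by blast
        then have "n + p \<in> Y" using kp by auto
        then show "k = 1 \<and> p = n" using f k kp by blast
      qed
    qed
    moreover have "1 \<notin> Y" using Y t1 by auto
    ultimately have "insert (n + t) Y \<in> ?G1" using Y t1 n by auto
    moreover have "Y - {n + t} \<in> ?G1" using Y base.subsimplex[of Y "Y - {n + t}"] by auto
    ultimately show "insert (n + t) Y \<in> ?G1 \<and> Y - {n + t} \<in> ?G1" ..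
  qed auto
  have "?G - ?G1 \<subseteq> {Y \<in> K0. Y \<subseteq> X \<and> (1 \<in> Y \<and> 2 * n \<in> Y \<or> (\<exists>k\<in>Y. k \<le> t))}"
    unfolding not_le[symmetric] by blast
  then have "cell X ` (?G - ?G1) \<subseteq> cell X ` {Y \<in> K0. Y \<subseteq> X \<and> (1 \<in> Y \<and> 2 * n \<in> Y \<or> (\<exists>k\<in>Y. k \<le> t))}" by (rule image_mono)
  with y show ?thesis by (intro that[of y]) auto
qed

text \<open>A face with some k \<le> t has no right vertex n + p, because k \<le> t \<le> p and the
  edge {1, 2n} is excluded. Left vertices span a simplex, so a can be added or dropped, and t < a
  ensures that k remains.\<close>

lemma reduction_step2:
  fixes z :: "'k::comm_ring_1 cochain"
  assumes X: "X \<subseteq> {1..2 * n}" and t: "\<And>p. p \<in> right_part X \<Longrightarrow> t \<le> p" and a: "a \<in> left_part X" "t < a"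
    and z: "z \<in> grade (R_alg W) d" "bd z = 0"
      "keys z \<subseteq> cell X ` {Y \<in> K0. Y \<subseteq> X \<and> (1 \<in> Y \<and> 2 * n \<in> Y \<or> (\<exists>k\<in>Y. k \<le> t))}"
  obtains y where "y \<in> grade (R_alg W) (d - 1)"
    "keys (z - bd y) \<subseteq> cell X ` {Y \<in> K0. Y \<subseteq> X \<and> 1 \<in> Y \<and> 2 * n \<in> Y}"
proof -
  have XK: "X \<subseteq> \<Union>K0" using X vertices_Kn by blast
  have aX: "a \<in> X" "1 \<le> a" "a \<le> n" using a by (auto simp: left_part_def)
  let ?G = "{Y \<in> K0. Y \<subseteq> X \<and> (1 \<in> Y \<and> 2 * n \<in> Y \<or> (\<exists>k\<in>Y. k \<le> t))}"
  let ?G1 = "{Y \<in> K0. Y \<subseteq> X \<and> \<not> (1 \<in> Y \<and> 2 * n \<in> Y) \<and> (\<exists>k\<in>Y. k \<le> t)}"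
  obtain y where y: "y \<in> grade (R_alg W) (d - 1)" "keys (z - bd y) \<subseteq> cell X ` (?G - ?G1)"
  proof (rule cell_reduction[OF XK aX(1) z(1,3) _ _ _ _ _ z(2)])
    fix Y assume Y: "Y \<in> ?G1"
    then obtain k where k: "k \<in> Y" "k \<le> t" by blast
    have Yn: "Y \<subseteq> {1..2 * n}" using Y X by blast
    have f: "k = 1 \<and> p = n" if "k \<in> Y" "n + p \<in> Y" "k \<le> p" "p \<le> n" for k p
      using Y that unfolding face_iff[OF Yn] mem_Collect_eq by blast
    have small: "u \<le> n" if u: "u \<in> Y" for u
    proof (rule ccontr)
      assume "\<not> u \<le> n"
      define p where "p = u - n"
      have p: "u = n + p" "1 \<le> p" using \<open>\<not> u \<le> n\<close> by (auto simp: p_def)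
      have "p \<le> n" using subsetD[OF Yn u] p(1) by simp
      moreover have "n + p \<in> X" using u p(1) Y by blast
      ultimately have "p \<in> right_part X" using p(2) by (simp add: right_part_def)
      then have "k \<le> p" using t[of p] k(2) by simp
      then have "k = 1 \<and> p = n" using f k u p \<open>p \<le> n\<close> by blast
      then have "1 \<in> Y" "2 * n \<in> Y" using k(1) u p(1) by (auto simp: mult_2)
      then show False using Y by blast
    qed
    have "insert a Y \<in> K0"
    proof (subst face_iff)
      show "insert a Y \<subseteq> {1..2 * n}" using Yn aX by auto
      show "\<forall>k p. k \<in> insert a Y \<and> n + p \<in> insert a Y \<and> k \<le> p \<and> p \<le> n \<longrightarrow> k = 1 \<and> p = n"
      proof (intro allI impI)
        fix k p assume kp: "k \<in> insert a Y \<and> n + p \<in> insert a Y \<and> k \<le> p \<and> p \<le> n"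
        then have "p = 0" using small[of "n + p"] aX by auto
        moreover have "k \<ge> 1" using kp aX Yn by auto
        ultimately show "k = 1 \<and> p = n" using kp by simp
      qed
    qed
    moreover have "2 * n \<notin> insert a Y" using small[of "2 * n"] aX n by auto
    ultimately have "insert a Y \<in> ?G1" using Y aX by auto
    moreover have "Y - {a} \<in> K0" using Y base.subsimplex[of Y "Y - {a}"] by auto
    then have "Y - {a} \<in> ?G1" using Y k a(2) by auto
    ultimately show "insert a Y \<in> ?G1 \<and> Y - {a} \<in> ?G1" ..
  qed auto
  have "?G - ?G1 \<subseteq> {Y \<in> K0. Y \<subseteq> X \<and> 1 \<in> Y \<and> 2 * n \<in> Y}" by auto
  then have "cell X ` (?G - ?G1) \<subseteq> cell X ` {Y \<in> K0. Y \<subseteq> X \<and> 1 \<in> Y \<and> 2 * n \<in> Y}" by (rule image_mono)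
  with y show ?thesis by (intro that[of y]) auto
qed

text \<open>After both matchings only faces containing {1, 2n} are left; in each application a count
  of vertices excludes these.\<close>

lemma edge_cell_reduction:
  fixes z :: "'k::comm_ring_1 cochain"
  assumes X: "X \<subseteq> {1..2 * n}" and t: "t \<in> right_part X" "\<And>p. p \<in> right_part X \<Longrightarrow> t \<le> p" and a: "a \<in> left_part X" "t < a"
    and z: "z \<in> grade (R_alg W) d" "bd z = 0" "keys z \<subseteq> cell X ` {Y \<in> K0. Y \<subseteq> X}"
  obtains y where "y \<in> grade (R_alg W) (d - 1)"
    "keys (z - bd y) \<subseteq> cell X ` {Y \<in> K0. Y \<subseteq> X \<and> 1 \<in> Y \<and> 2 * n \<in> Y}"
    "z - bd y \<in> grade (R_alg W) d"
proof -
  interpret A: dg_algebra "R_alg W :: ('k cochain) dga" by (rule dg_algebra_R)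
  obtain y where y: "y \<in> grade (R_alg W) (d - 1)"
    "keys (z - bd y) \<subseteq> cell X ` {Y \<in> K0. Y \<subseteq> X \<and> (1 \<in> Y \<and> 2 * n \<in> Y \<or> (\<exists>k\<in>Y. k \<le> t))}"
    by (rule reduction_step1[OF X t(1) z])
  have g: "z - bd y \<in> grade (R_alg W) d" using A.grade_minus[OF z(1)] A.grade_diff[OF y(1)] by simp
  have c: "bd (z - bd y) = 0" using z A.diff_diff[OF y(1)] by (simp add: A.diff_minus2)
  obtain u where u: "u \<in> grade (R_alg W) (d - 1)"
    "keys (z - bd y - bd u) \<subseteq> cell X ` {Y \<in> K0. Y \<subseteq> X \<and> 1 \<in> Y \<and> 2 * n \<in> Y}"
    by (rule reduction_step2[OF X t(2) a g c y(2)])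
  have eq: "z - bd (y + u) = z - bd y - bd u" by (simp add: A.diff_add)
  show ?thesis
  proof (rule that[of "y + u"])
    show "y + u \<in> grade (R_alg W) (d - 1)" by (rule A.grade_add[OF y(1) u(1)])
    then show "z - bd (y + u) \<in> grade (R_alg W) d"
      using A.grade_minus[OF z(1)] A.grade_diff[of "y + u" "d - 1"] by simp
    show "keys (z - bd (y + u)) \<subseteq> cell X ` {Y \<in> K0. Y \<subseteq> X \<and> 1 \<in> Y \<and> 2 * n \<in> Y}"
      unfolding eq by (rule u(2))
  qed
qed

text \<open>Since s > 4n, the terms other than the multiples of 2s add up to less than 2s in
  modulus, so these multiples agree.\<close>

lemma left_card_eq:
  fixes a \<tau> e k :: nat
  assumes "2 * int s * int a + int \<tau> + int e = 2 * int s * int k + c + int a" "c \<in> {1, 2}"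
    and "a \<le> n" "\<tau> \<le> n" "e \<le> 2 * n"
  shows "a = k"
proof (rule ccontr)
  assume "a \<noteq> k"
  then consider "a + 1 \<le> k" | "k + 1 \<le> a" by linarith
  then show False
  proof cases
    case 1
    then have "int s * (int a + 1) \<le> int s * int k" by (intro mult_left_mono) auto
    then have "2 * int s * int a + 2 * int s \<le> 2 * int s * int k" by (simp add: algebra_simps)
    then show False using assms s by auto
  next
    case 2
    then have "int s * (int k + 1) \<le> int s * int a" by (intro mult_left_mono) auto
    then have "2 * int s * int k + 2 * int s \<le> 2 * int s * int a" by (simp add: algebra_simps)
    then show False using assms s n by auto
  qed
qed

text \<open>The degree leaves k left vertices A and |T| + |Y| = k + 1, with T the right vertices;
  the weight excludes |T| < k. For |T| = k + 1 only the empty face occurs, and it is matched with a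
  vertex. For |T| = k a pair t < a exists, and the reduction leaves faces with at least two
  vertices, whereas |Y| = 1.\<close>

lemma low_weight_exact:
  fixes x :: "'k::comm_ring_1 cochain"
  assumes k: "2 \<le> k" "k < n" and x: "x \<in> grade (R_alg W) (2 * int s * int k + 1)" "bd x = 0"
    and w: "\<And>m. m \<in> keys x \<Longrightarrow> weight m \<le> 0"
  shows "\<exists>y\<in>grade (R_alg W) (2 * int s * int k + 1 - 1). x = bd y"
proof (rule exact_by_cells[OF x])
  interpret A: dg_algebra "R_alg W :: ('k cochain) dga" by (rule dg_algebra_R)
  let ?d = "2 * int s * int k + 1"
  fix X and z :: "'k cochain"
  assume XK: "X \<subseteq> \<Union>K0" and XS: "copies J X \<in> multidegree ` keys x"
    and z: "z \<in> grade (R_alg W) ?d" "bd z = 0" "keys z \<subseteq> cell X ` {Y \<in> K0. Y \<subseteq> X}"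
  have "2 * int s * int k \<le> 2 * int s * int n" using k by (intro mult_left_mono) auto
  then have d: "?d \<le> int (2 * s * n + 2)" by simp
  show "\<exists>y\<in>grade (R_alg W) (?d - 1). z = bd y"
  proof (cases "z = 0")
    case True
    then show ?thesis using A.grade_0 A.diff_0 by (intro bexI[of _ 0]) auto
  next
    case False
    then have X: "X \<subseteq> {1..2 * n}" using no_keys_outside[OF z(1,3) XK _ d] by blast
    let ?A = "left_part X" and ?T = "right_part X"
    note fin = parts(3,4)[OF X]
    have deg: "2 * int s * int (card ?A) + int (card ?T) + int (card Y) = ?d + int (card ?A)"
      if "cell X Y \<in> keys u" "Y \<subseteq> X" "u \<in> grade (R_alg W) ?d" for Y and u :: "'k cochain"
      using degree_key[OF that(3,1) X that(2)] .
    have "keys z \<noteq> {}" using False by simp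
    then obtain Y0 where Y0: "cell X Y0 \<in> keys z" "Y0 \<subseteq> X" using z(3) by blast
    have "card Y0 \<le> card X" using Y0 X by (intro card_mono) (auto intro: finite_subset)
    then have A: "card ?A = k"
      using left_card_eq[OF deg[OF Y0 z(1)]] card_part_le[of X] card_parts[OF X] by simp
    have cY: "int (card ?T) + int (card Y) = int k + 1"
      if "cell X Y \<in> keys u" "Y \<subseteq> X" "u \<in> grade (R_alg W) ?d" for Y and u :: "'k cochain"
      using deg[OF that] A by simp
    obtain m where "m \<in> keys x" "multidegree m = copies J X" using XS by force
    then have w0: "(int (n * n) + 1) * (int k - int (card ?T)) + int (\<Sum>?T) - int (\<Sum>?A) \<le> 0"
      using weight_copies[OF X] w A by metis
    have "\<Sum>?A \<le> (\<Sum>i\<in>?A. n)" by (rule sum_mono) (auto simp: left_part_def)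
    also have "\<dots> \<le> n * n" using card_part_le by simp
    finally have SA: "\<Sum>?A \<le> n * n" .
    \<comment> \<open>For |T| < k the constant n^2 + 1 would outweigh \<Sum>A \<le> n^2 and make the
      weight positive.\<close>
    have T: "k \<le> card ?T"
    proof (rule ccontr)
      assume "\<not> k \<le> card ?T"
      then have "(int (n * n) + 1) * 1 \<le> (int (n * n) + 1) * (int k - int (card ?T))"
        by (intro mult_left_mono) auto
      moreover have "c \<le> y" if "c * 1 \<le> c * d" "c * d + x - y \<le> 0" "0 \<le> x" for c d x y :: int
        using that by linarith
      ultimately have "int (n * n) + 1 \<le> int (\<Sum>?A)" using w0 of_nat_0_le_iff by blast
      then show False using SA by linarith
    qed
    show ?thesis
    proof (cases "card ?T = k")
      case True
      have "int (\<Sum>?T) - int (\<Sum>?A) \<le> 0" using w0 unfolding True diff_self mult_zero_right add_0 .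
      then have ST: "\<Sum>?T \<le> \<Sum>?A" by (simp only: diff_le_0_iff_le of_nat_le_iff)
      have ne: "?A \<noteq> {}" "?T \<noteq> {}" using A True k by auto
      define a t where "a = Max ?A" and "t = Min ?T"
      have a: "a \<in> ?A" and t: "t \<in> ?T" using fin ne by (auto simp: a_def t_def)
      have tmin: "t \<le> p" if "p \<in> ?T" for p using that fin by (simp add: t_def)
      \<comment> \<open>Otherwise max A \<le> min T. As k \<ge> 2, A has an element below its
        maximum, so \<Sum>A < k max A \<le> \<Sum>T.\<close>
      have "t < a"
      proof (rule ccontr)
        assume "\<not> t < a"
        then have at: "a \<le> t" by simp
        have "\<not> ?A \<subseteq> {a}" using A k card_mono[of "{a}" ?A] by auto
        then obtain b where b: "b \<in> ?A" "b \<noteq> a" by blast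
        have "b < a" using Max_ge[OF fin(1) b(1)] b(2) by (simp add: a_def)
        then have "\<Sum>?A < (\<Sum>i\<in>?A. a)"
          using b fin by (intro sum_strict_mono_ex1) (auto simp: a_def)
        also have "\<dots> = (\<Sum>i\<in>?T. a)" using A True by simp
        also have "\<dots> \<le> \<Sum>?T" by (rule sum_mono) (rule order_trans[OF at tmin])
        finally show False using ST by simp
      qed
      obtain y where y: "y \<in> grade (R_alg W) (?d - 1)"
        "keys (z - bd y) \<subseteq> cell X ` {Y \<in> K0. Y \<subseteq> X \<and> 1 \<in> Y \<and> 2 * n \<in> Y}"
        "z - bd y \<in> grade (R_alg W) ?d"
        by (rule edge_cell_reduction[OF X t tmin a \<open>t < a\<close> z])
      have "keys (z - bd y) = {}"
      proof (rule ccontr)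
        assume "\<not> ?thesis"
        then obtain Y where Y: "cell X Y \<in> keys (z - bd y)" "Y \<subseteq> X" "1 \<in> Y" "2 * n \<in> Y"
          using y(2) by blast
        have "card {1, 2 * n} \<le> card Y" using Y X by (intro card_mono) (auto intro: finite_subset)
        then have "2 \<le> card Y" using n by simp
        then show False using cY[OF Y(1,2) y(3)] True by simp
      qed
      then show ?thesis using exact_if_reduced_to_zero[OF y(1)] by simp
    next
      case False
      then have c0: "card ?T = k + 1" using T cY[OF Y0 z(1)] by linarith
      then obtain p where p: "p \<in> ?T" by fastforce
      then have v: "n + p \<in> X" by (auto simp: right_part_def)
      have empty: "Y = {}" if "cell X Y \<in> keys z" "Y \<subseteq> X" for Y
        using cY[OF that z(1)] c0 finite_subset[OF that(2) finite_subset[OF X]] by simp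
      \<comment> \<open>This matching removes the empty face, the only one that the degree
        admits.\<close>
      let ?G1 = "{{}, {n + p}}"
      have vK: "{n + p} \<in> K0" using v XK base.subsimplex by blast
      obtain y where y: "y \<in> grade (R_alg W) (?d - 1)"
        "keys (z - bd y) \<subseteq> cell X ` ({Y \<in> K0. Y \<subseteq> X} - ?G1)"
        by (rule cell_reduction[OF XK v z(1,3) _ _ _ _ _ z(2), of ?G1]) (use vK v nonempty in auto)
      have "z - bd y \<in> grade (R_alg W) ?d"
        using A.grade_minus[OF z(1)] A.grade_diff[OF y(1)] by simp
      note cYy = cY[OF _ _ this]
      have "keys (z - bd y) = {}"
      proof (rule ccontr)
        assume "\<not> ?thesis"
        then obtain Y where Y: "cell X Y \<in> keys (z - bd y)" "Y \<subseteq> X" "Y \<noteq> {}"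
          using y(2) by blast
        then show False using cYy[OF Y(1,2)] c0 finite_subset[OF Y(2) finite_subset[OF X]] by simp
      qed
      then show ?thesis using exact_if_reduced_to_zero[OF y(1)] by simp
    qed
  qed
qed

text \<open>The degree forces A = {1..n} and |T| + |Y| = n + 2. For |T| = n the weight would be 0,
  so |T| < n and |Y| \<ge> 3. The reduction leaves faces containing {1, 2n}, but in K(n) no larger
  face contains this edge.\<close>

lemma top_weight_exact:
  fixes x :: "'k::comm_ring_1 cochain"
  assumes x: "x \<in> grade (R_alg W) (2 * int s * int n + 2)" "bd x = 0"
    and w: "\<And>m. m \<in> keys x \<Longrightarrow> weight m > 0"
  shows "\<exists>y\<in>grade (R_alg W) (2 * int s * int n + 2 - 1). x = bd y"
proof (rule exact_by_cells[OF x])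
  interpret A: dg_algebra "R_alg W :: ('k cochain) dga" by (rule dg_algebra_R)
  let ?d = "2 * int s * int n + 2"
  fix X and z :: "'k cochain"
  assume XK: "X \<subseteq> \<Union>K0" and XS: "copies J X \<in> multidegree ` keys x"
    and z: "z \<in> grade (R_alg W) ?d" "bd z = 0" "keys z \<subseteq> cell X ` {Y \<in> K0. Y \<subseteq> X}"
  have d: "?d \<le> int (2 * s * n + 2)" by simp
  show "\<exists>y\<in>grade (R_alg W) (?d - 1). z = bd y"
  proof (cases "z = 0")
    case True
    then show ?thesis using A.grade_0 A.diff_0 by (intro bexI[of _ 0]) auto
  next
    case False
    then have X: "X \<subseteq> {1..2 * n}" using no_keys_outside[OF z(1,3) XK _ d] by blast
    let ?A = "left_part X" and ?T = "right_part X"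
    note fin = parts(3,4)[OF X]
    have finX: "finite X" using X by (auto intro: finite_subset)
    have deg: "2 * int s * int (card ?A) + int (card ?T) + int (card Y) = ?d + int (card ?A)"
      if "cell X Y \<in> keys u" "Y \<subseteq> X" "u \<in> grade (R_alg W) ?d" for Y and u :: "'k cochain"
      using degree_key[OF that(3,1) X that(2)] .
    have "keys z \<noteq> {}" using False by simp
    then obtain Y0 where Y0: "cell X Y0 \<in> keys z" "Y0 \<subseteq> X" "Y0 \<in> K0" using z(3) by blast
    have Y0X: "card Y0 \<le> card X" using Y0 finX by (intro card_mono) auto
    have A: "card ?A = n"
      using left_card_eq[OF deg[OF Y0(1,2) z(1)]] card_part_le[of X] card_parts[OF X] Y0X by simp
    then have A': "?A = {1..n}" by (intro card_subset_eq) (auto simp: left_part_def)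
    have cY: "int (card ?T) + int (card Y) = int n + 2"
      if "cell X Y \<in> keys u" "Y \<subseteq> X" "u \<in> grade (R_alg W) ?d" for Y and u :: "'k cochain"
      using deg[OF that] A by simp
    obtain m where "m \<in> keys x" "multidegree m = copies J X" using XS by force
    then have w0: "(int (n * n) + 1) * (int n - int (card ?T)) + int (\<Sum>?T) - int (\<Sum>?A) > 0"
      using weight_copies[OF X] w A by metis
    have T: "card ?T < n"
    proof (rule ccontr)
      assume "\<not> card ?T < n"
      then have c: "card ?T = n" using card_part_le[of X] by simp
      then have "?T = {1..n}" by (intro card_subset_eq) (auto simp: right_part_def)
      then show False using w0 A' c by simp
    qed
    \<comment> \<open>Otherwise |Y| = n + 2 would exceed |X| = n.\<close>
    have "?T \<noteq> {}"
    proof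
      assume "?T = {}"
      then show False using cY[OF Y0(1,2) z(1)] Y0X card_parts[OF X] A by simp
    qed
    define t where "t = Min ?T"
    have t: "t \<in> ?T" using fin \<open>?T \<noteq> {}\<close> by (auto simp: t_def)
    have tmin: "t \<le> p" if "p \<in> ?T" for p using that fin by (simp add: t_def)
    \<comment> \<open>For T = {n} the count gives Y = X, so X would be a face, although {2, 2n} is
      not.\<close>
    have "t < n"
    proof (rule ccontr)
      assume "\<not> t < n"
      then have "?T = {n}" using tmin t by (force simp: right_part_def)
      then have "card Y0 = card X" using cY[OF Y0(1,2) z(1)] card_parts[OF X] A by simp
      then have "Y0 = X" by (rule card_subset_eq[OF finX Y0(2)])
      then have "X \<in> K0" using Y0(3) by simp
      have "2 \<in> ?A" unfolding A' using n by simp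
      then have "2 \<in> X" unfolding left_part_def by (rule IntD1)
      moreover have "n \<in> ?T" using \<open>?T = {n}\<close> by blast
      then have "n + n \<in> X" unfolding right_part_def by blast
      ultimately have "(2::nat) = 1 \<and> n = n"
        using \<open>X \<in> K0\<close> n order_refl[of n] unfolding face_iff[OF X] by blast
      then show False by simp
    qed
    have nA: "n \<in> ?A" using A' n by simp
    obtain y where y: "y \<in> grade (R_alg W) (?d - 1)"
      "keys (z - bd y) \<subseteq> cell X ` {Y \<in> K0. Y \<subseteq> X \<and> 1 \<in> Y \<and> 2 * n \<in> Y}"
      "z - bd y \<in> grade (R_alg W) ?d"
      by (rule edge_cell_reduction[OF X t tmin nA \<open>t < n\<close> z])
    have "keys (z - bd y) = {}"
    proof (rule ccontr)
      assume "\<not> ?thesis"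
      then obtain Y where Y: "cell X Y \<in> keys (z - bd y)" "Y \<subseteq> X" "1 \<in> Y" "2 * n \<in> Y" "Y \<in> K0"
        using y(2) by blast
      have Yn: "Y \<subseteq> {1..2 * n}" using Y X by blast
      have f: "k = 1 \<and> p = n" if "k \<in> Y" "n + p \<in> Y" "k \<le> p" "p \<le> n" for k p
        using Y(5) that unfolding face_iff[OF Yn] by blast
      \<comment> \<open>A left vertex joined to 2n is 1, and a right vertex joined to 1 is
        2n.\<close>
      have "Y \<subseteq> {1, 2 * n}"
      proof
        fix u assume u: "u \<in> Y"
        then have u1: "1 \<le> u" "u \<le> 2 * n" using Yn by auto
        show "u \<in> {1, 2 * n}"
        proof (cases "u \<le> n")
          case True
          have "n + n \<in> Y" using Y(4) by (simp add: mult_2)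
          from f[OF u this True order_refl] show ?thesis by simp
        next
          case False
          then have "1 \<le> u - n" "u - n \<le> n" "n + (u - n) \<in> Y" using u u1 by auto
          from f[OF Y(3) this(3,1,2)] have "u - n = n" ..
          then show ?thesis using False by auto
        qed
      qed
      then have "card Y \<le> card {1, 2 * n}" by (intro card_mono) auto
      then have "card Y \<le> 2" using n by simp
      then show False using cY[OF Y(1,2) y(3)] T by simp
    qed
    then show ?thesis using exact_if_reduced_to_zero[OF y(1)] by simp
  qed
qed

end

section \<open>The Massey product\<close>

lemma (in finite_complex) keys_mult_R:
  assumes "m \<in> keys (mult (R_alg K) x (y :: 'k::comm_ring_1 cochain))"
  shows "\<exists>p\<in>keys x. \<exists>q\<in>keys y. compatible p q \<and> m = monomial_union p q"
proof -
  have "keys (mult (R_alg K) x y) \<subseteq>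
      (\<Union>p\<in>keys x. \<Union>q\<in>keys y. keys
        (scale (lookup x p * lookup y q) (monomial_mult K p q)))"
    unfolding R_alg_def dga.simps by (rule order_trans[OF keys_sum_subset UN_mono[OF order_refl keys_sum_subset]])
  then obtain p q where pq: "p \<in> keys x" "q \<in> keys y"
    "m \<in> keys (scale (lookup x p * lookup y q) (monomial_mult K p q))"
    using assms by blast
  have "m \<in> keys (single (monomial_union p q)
      (lookup x p * lookup y q * mult_coeff p q))"
    using pq(3) unfolding monomial_mult_eq scale_single .
  then have "m = monomial_union p q" "mult_coeff p q \<noteq> (0 :: 'k)" by (auto split: if_splits)
  then show ?thesis using pq(1,2) by (auto simp: mult_coeff_def split: if_splits)
qed

context multiwedge_complex
begin

lemma cell_product:
  fixes r r' :: "'k::comm_ring_1"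
  assumes "X \<subseteq> \<Union>K0" "X' \<subseteq> \<Union>K0" "X \<inter> X' = {}" "Y \<subseteq> X" "Y' \<subseteq> X'"
  shows "mult (R_alg W) (single (cell X Y) r) (single (cell X' Y') r') =
    (if Y \<union> Y' \<in> K0 then single (cell (X \<union> X') (Y \<union> Y'))
      (r * r' * shuffle_sign (top_copies (X - Y)) (top_copies (X' - Y'))) else 0)"
proof -
  have u: "monomial_union (cell X Y) (cell X' Y') = cell (X \<union> X') (Y \<union> Y')"
    unfolding monomial_union_def cell_def fst_conv snd_conv prod.inject eq_codes
    using assms by (auto simp: mem_top mem_lower)
  have "fst (cell X Y) \<inter> fst (cell X' Y') = {}" "snd (cell X Y) \<inter> snd (cell X' Y') = {}"
    unfolding cell_def fst_conv snd_conv eq_codes using assms by (auto simp: mem_top mem_lower)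
  then have "compatible (cell X Y) (cell X' Y') \<longleftrightarrow> Y \<union> Y' \<in> K0"
    unfolding compatible_def u using cell_in_R_basis[of "X \<union> X'" "Y \<union> Y'"] assms by blast
  then show ?thesis
    by (simp add: mult_single_single u mult_coeff_def) (simp add: cell_def)
qed

lemma diff_cell:
  fixes r :: "'k::comm_ring_1"
  assumes "X \<subseteq> \<Union>K0" "Y \<subseteq> X" "Y \<in> K0"
  shows "bd (single (cell X Y) r) =
    (\<Sum>y\<in>X - Y. if insert y Y \<in> K0 then single (cell X (insert y Y))
      (r * shuffle_sign {prod_encode (y, 1)} (top_copies (X - Y))) else 0)"
proof -
  have "bd (single (cell X Y) r) =
      (\<Sum>j\<in>top_copies (X - Y). single (fst (cell X Y) - {j}, insert j (snd (cell X Y)))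
        (r * diff_coeff j (fst (cell X Y)) (snd (cell X Y))))"
    unfolding cell_def fst_conv snd_conv by (rule diff_single)
  also have "\<dots> = (\<Sum>y\<in>X - Y. single
      (fst (cell X Y) - {prod_encode (y, 1)}, insert (prod_encode (y, 1)) (snd (cell X Y)))
        (r * diff_coeff (prod_encode (y, 1)) (fst (cell X Y)) (snd (cell X Y))))"
    unfolding top_copies_def by (subst sum.reindex) (auto simp: inj_on_def)
  also have "\<dots> = (\<Sum>y\<in>X - Y. if insert y Y \<in> K0 then single (cell X (insert y Y))
      (r * shuffle_sign {prod_encode (y, 1)} (top_copies (X - Y))) else 0)"
  proof (rule sum.cong[OF refl])
    fix y assume y: "y \<in> X - Y"
    let ?j = "prod_encode (y, 1)"
    have c: "(fst (cell X Y) - {?j}, insert ?j (snd (cell X Y))) = cell X (insert y Y)" by (rule cell_insert[OF y])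
    have "insert ?j (snd (cell X Y)) \<in> W \<longleftrightarrow> insert y Y \<in> K0"
    proof
      assume "insert ?j (snd (cell X Y)) \<in> W"
      moreover have "cell X Y \<in> R_basis W" using cell_in_R_basis[OF assms(1,2)] assms(3) by blast
      ultimately have "cell X (insert y Y) \<in> R_basis W" unfolding c[symmetric] R_basis_def by auto
      then show "insert y Y \<in> K0" using cell_in_R_basis[OF assms(1), of "insert y Y"] y assms(2) by blast
    next
      assume "insert y Y \<in> K0"
      then have "cell X (insert y Y) \<in> R_basis W" using cell_in_R_basis[OF assms(1), of "insert y Y"] y assms(2) by blast
      then show "insert ?j (snd (cell X Y)) \<in> W" unfolding c[symmetric] R_basis_def by auto
    qed
    then show "single (fst (cell X Y) - {?j}, insert ?j (snd (cell X Y)))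
        (r * diff_coeff ?j (fst (cell X Y)) (snd (cell X Y))) =
      (if insert y Y \<in> K0 then single (cell X (insert y Y)) (r * shuffle_sign {?j} (top_copies (X - Y))) else 0)"
      unfolding c diff_coeff_def by (simp add: cell_def)
  qed
  finally show ?thesis .
qed

end

lemma square_one_nonzero: "e * e = 1 \<Longrightarrow> e \<noteq> (0 :: 'k::comm_ring_1)"
  by auto

section \<open>The standard defining system and its value\<close>

context massey_family
begin

abbreviation vertex :: "nat \<Rightarrow> nat" where "vertex i \<equiv> prod_encode (i, 1)"

lemma pair_block:
  assumes "j \<in> {1..n}"
  shows "{j, n + j} \<subseteq> {1..2 * n}" "{j, n + j} \<subseteq> \<Union>K0" "left_part {j, n + j} = {j}" "right_part {j, n + j} = {j}"
proof -
  show 1: "{j, n + j} \<subseteq> {1..2 * n}" using assms by auto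
  show "{j, n + j} \<subseteq> \<Union>K0" by (rule order_trans[OF 1 vertices_Kn])
  show "left_part {j, n + j} = {j}" "right_part {j, n + j} = {j}"
    using assms by (auto simp: left_part_def right_part_def)
qed

definition z_elem :: "nat \<Rightarrow> 'k::comm_ring_1 cochain" where
  "z_elem i = single (cell {i, n + i} {i}) 1"

text \<open>Chosen so that \<open>z_elem j\<close> occurs in the differential of
  \<open>y_elem j\<close> with coefficient 1.\<close>

definition y_sign :: "nat \<Rightarrow> 'k::comm_ring_1" where
  "y_sign j = shuffle_sign {vertex j} (top_copies {j, n + j})"

definition y_elem :: "nat \<Rightarrow> 'k::comm_ring_1 cochain" where
  "y_elem j = single (cell {j, n + j} {}) (y_sign j)"

text \<open>The other term in the differential of \<open>y_elem j\<close>, where u at n + j becomes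
  v. It is an error term, which multiplication by an entry annihilates except in the corner.\<close>

definition r_elem :: "nat \<Rightarrow> 'k::comm_ring_1 cochain" where
  "r_elem j = single (cell {j, n + j} {n + j})
     (y_sign j * shuffle_sign {vertex (n + j)} (top_copies {j, n + j}))"

primrec chain :: "nat \<Rightarrow> nat \<Rightarrow> 'k::comm_ring_1 cochain" where
  "chain i 0 = z_elem i"
| "chain i (Suc m) = mult (R_alg W) (chain i m) (y_elem (i + Suc m))"

text \<open>In the notation of the paper, \<open>entry i j\<close> is \<open>\<plusminus> v\<^sub>i\<^sub>1 \<dots> v\<^sub>i\<^sub>s u\<^sub>n\<^sub>+\<^sub>i \<Prod> (u\<^sub>q\<^sub>1 v\<^sub>q\<^sub>2 \<dots> v\<^sub>q\<^sub>s u\<^sub>n\<^sub>+\<^sub>q)\<close> with \<open>q\<close> running over \<open>i < q < j\<close>.\<close>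

definition entry :: "nat \<Rightarrow> nat \<Rightarrow> 'k::comm_ring_1 cochain" where
  "entry i j = (if i < j then chain i (j - i - 1) else 0)"

lemma entry_Suc_self: "entry i (Suc i) = z_elem i"
  by (simp add: entry_def)

lemma entry_Suc: "i < j \<Longrightarrow> entry i (Suc j) = mult (R_alg W) (entry i j) (y_elem j)"
proof -
  assume "i < j"
  then obtain m where "j = i + Suc m" using less_imp_Suc_add by (metis add_Suc_right)
  then show ?thesis by (simp add: entry_def)
qed

lemma single_face: "i \<in> {1..2 * n} \<Longrightarrow> {i} \<in> K0"
  by (subst face_iff) auto

lemma edge_iff: "\<lbrakk>i \<in> {1..n}; p \<in> {1..n}\<rbrakk> \<Longrightarrow> {i, n + p} \<in> K0 \<longleftrightarrow> \<not> (i \<le> p \<and> \<not> (i = 1 \<and> p = n))"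
  by (subst face_iff) auto

lemma diff_z: "i \<in> {1..n} \<Longrightarrow> bd (z_elem i :: 'k::comm_ring_1 cochain) = 0"
proof -
  assume i: "i \<in> {1..n}"
  have "{i, n + i} - {i} = {n + i}" using i n by auto
  moreover have "insert (n + i) {i} \<notin> K0" using edge_iff[OF i i] i n by (auto simp: insert_commute)
  ultimately show ?thesis
    unfolding z_elem_def by (subst diff_cell) (use pair_block(2)[OF i] single_face[of i] i in auto)
qed

lemma diff_y: "j \<in> {1..n} \<Longrightarrow> bd (y_elem j :: 'k::comm_ring_1 cochain) = z_elem j + r_elem j"
proof -
  assume j: "j \<in> {1..n}"
  have "{j} \<in> K0" "{n + j} \<in> K0" using single_face j by auto
  moreover have "j \<noteq> n + j" using n by simp
  moreover have "shuffle_sign {prod_encode (j, Suc 0)} (top_copies {j, n + j}) *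
      shuffle_sign {prod_encode (j, Suc 0)} (top_copies {j, n + j}) = (1 :: 'k)" by (rule shuffle_sign_square)
  ultimately show ?thesis
    unfolding y_elem_def z_elem_def r_elem_def
    by (subst diff_cell) (use pair_block(2)[OF j] nonempty in \<open>auto simp: y_sign_def\<close>)
qed

lemma degree_pair:
  assumes "j \<in> {1..n}" "Y \<subseteq> {j, n + j}" "Y \<in> K0"
  shows "single (cell {j, n + j} Y) r \<in> grade (R_alg W) (2 * int s + int (card Y))"
proof -
  have "card {j, n + j} = 2" using n by simp
  moreover have "(\<Sum>i\<in>{j, n + j}. J i) = s + 1" unfolding sum_J[OF pair_block(1)[OF assms(1)]] pair_block(3,4)[OF assms(1)] by simp
  ultimately have "card (fst (cell {j, n + j} Y)) + 2 * card (snd (cell {j, n + j} Y)) = 2 * s + card Y"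
    using degree_cell[OF pair_block(2)[OF assms(1)] assms(2)] by simp
  then have "int (card (fst (cell {j, n + j} Y)) + 2 * card (snd (cell {j, n + j} Y))) = 2 * int s + int (card Y)"
    by linarith
  moreover have "cell {j, n + j} Y \<in> R_basis W"
    using cell_in_R_basis[OF pair_block(2)[OF assms(1)] assms(2)] assms(3) by blast
  ultimately show ?thesis unfolding grade_keys by (auto split: if_splits)
qed

text \<open>The vertices whose copies make up the multidegree of \<open>entry i j\<close>.\<close>

definition span :: "nat \<Rightarrow> nat \<Rightarrow> nat set" where
  "span i j = {i..<j} \<union> (+) n ` {i..<j}"

lemma span_props:
  assumes "1 \<le> i" "j \<le> n + 1"
  shows "span i j \<subseteq> {1..2 * n}" "span i j \<subseteq> \<Union>K0" "left_part (span i j) = {i..<j}" "right_part (span i j) = {i..<j}"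
proof -
  show 1: "span i j \<subseteq> {1..2 * n}" using assms by (auto simp: span_def)
  show "span i j \<subseteq> \<Union>K0" by (rule order_trans[OF 1 vertices_Kn])
  show "left_part (span i j) = {i..<j}" "right_part (span i j) = {i..<j}"
    using assms by (auto simp: span_def left_part_def right_part_def)
qed

lemma span_Suc: "i \<le> j \<Longrightarrow> span i (Suc j) = span i j \<union> {j, n + j}"
  by (auto simp: span_def atLeastLessThanSuc)

lemma span_disjoint: "\<lbrakk>1 \<le> i; j \<le> n\<rbrakk> \<Longrightarrow> span i j \<inter> {j, n + j} = {}"
  by (auto simp: span_def)

text \<open>Of the sign only its invertibility matters; \<open>e * e = 1\<close> records this and is
  stable under further signs.\<close>

lemma entry_monomial:
  assumes "1 \<le> i" "i < j" "j \<le> n + 1"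
  shows "\<exists>e. e * e = 1 \<and> entry i j = single (cell (span i j) {i}) (e :: 'k::comm_ring_1)"
  using assms(2,3)
proof (induction j)
  case (Suc j)
  show ?case
  proof (cases "i = j")
    case True
    have "span j (Suc j) = {j, n + j}" by (auto simp: span_def)
    then show ?thesis using True by (intro exI[of _ 1]) (simp add: entry_Suc_self z_elem_def)
  next
    case False
    then have ij: "i < j" using Suc.prems by simp
    then obtain e :: 'k where e: "e * e = 1" "entry i j = single (cell (span i j) {i}) e"
      using Suc by auto
    have j: "j \<in> {1..n}" using ij Suc.prems by auto
    have "i \<in> span i j" using ij by (simp add: span_def)
    then have p: "mult (R_alg W) (entry i j) (y_elem j) = single (cell (span i j \<union> {j, n + j}) {i})
        (e * y_sign j * shuffle_sign (top_copies (span i j - {i})) (top_copies {j, n + j}))"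
      unfolding e(2) y_elem_def
      by (subst cell_product) (use span_props(2)[OF assms(1)] pair_block(2)[OF j] span_disjoint[OF assms(1)] j single_face[of i] assms(1) ij Suc.prems in auto)
    let ?f = "e * y_sign j * shuffle_sign (top_copies (span i j - {i})) (top_copies {j, n + j})"
    have "?f * ?f = (e * e) * (y_sign j * y_sign j) *
        (shuffle_sign (top_copies (span i j - {i})) (top_copies {j, n + j}) * shuffle_sign (top_copies (span i j - {i})) (top_copies {j, n + j}))"
      by (simp add: mult_ac)
    also have "\<dots> = 1" by (simp add: e(1) y_sign_def shuffle_sign_square)
    finally show ?thesis
      using p ij by (intro exI[of _ ?f]) (simp add: entry_Suc span_Suc)
  qed
qed simp

lemma entry_grade:
  assumes "1 \<le> i" "i < j" "j \<le> n + 1"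
  shows "(entry i j :: 'k::comm_ring_1 cochain) \<in> grade (R_alg W) (2 * int s * int (j - i) + 1)"
  using assms(2,3)
proof (induction j)
  case (Suc j)
  interpret A: dg_algebra "R_alg W :: ('k cochain) dga" by (rule dg_algebra_R)
  show ?case
  proof (cases "i = j")
    case True
    then have j: "j \<in> {1..n}" using assms Suc.prems by auto
    then have "z_elem j \<in> grade (R_alg W :: ('k cochain) dga) (2 * int s + int (card {j}))"
      unfolding z_elem_def by (intro degree_pair single_face) auto
    then show ?thesis using True by (simp add: entry_Suc_self)
  next
    case False
    then have ij: "i < j" using Suc.prems by simp
    then have j: "j \<in> {1..n}" using Suc.prems by auto
    have "y_elem j \<in> grade (R_alg W :: ('k cochain) dga) (2 * int s + int (card ({} :: nat set)))"
      unfolding y_elem_def by (intro degree_pair nonempty j) auto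
    then have m: "mult (R_alg W) (entry i j) (y_elem j :: 'k cochain) \<in> grade (R_alg W) (2 * int s * int (j - i) + 1 + (2 * int s + int (card ({} :: nat set))))"
      using Suc ij by (intro A.grade_mult) auto
    have "int (Suc j - i) = int (j - i) + 1" using ij by simp
    then have eq: "2 * int s * int (j - i) + 1 + (2 * int s + int (card ({} :: nat set))) = 2 * int s * int (Suc j - i) + 1"
      by (simp only: card.empty) (simp add: algebra_simps)
    show ?thesis unfolding entry_Suc[OF ij] using m unfolding eq .
  qed
qed simp

text \<open>The product would carry the pair {i, n + j} with i < j, a nonface unless it is {1,
  2n}.\<close>

lemma entry_r_zero:
  assumes "1 \<le> i" "i < j" "j \<le> n" "\<not> (i = 1 \<and> j = n)"
  shows "mult (R_alg W) (entry i j) (r_elem j) = (0 :: 'k::comm_ring_1 cochain)"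
proof -
  obtain e :: 'k where e: "entry i j = single (cell (span i j) {i}) e"
    using entry_monomial[of i j] assms by auto
  have j: "j \<in> {1..n}" using assms by auto
  have "{i, n + j} \<notin> K0" using edge_iff[of i j] assms by auto
  then have "{i} \<union> {n + j} \<notin> K0" by (simp add: insert_commute)
  then show ?thesis
    unfolding e r_elem_def
    by (subst cell_product) (use span_props(2)[of i j] pair_block(2)[OF j] span_disjoint[of i j] assms in \<open>auto simp: span_def\<close>)
qed

text \<open>Induction on j by the Leibniz rule for \<open>entry i j\<close> times
  \<open>y_elem j\<close>, with a minus sign as entries have odd degree. The first term reproduces
  the sum with j + 1 for j, \<open>z_elem j\<close> supplies the new summand t = j, and
  \<open>r_elem j\<close> contributes only in the corner.\<close>

lemma diff_entry:
  assumes "1 \<le> i" "i < j" "j \<le> n + 1"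
  shows "bd (entry i j :: 'k::comm_ring_1 cochain) =
    - (\<Sum>t\<in>{i<..<j}. mult (R_alg W) (entry i t) (entry t j)) -
    (if i = 1 \<and> j = n + 1 then mult (R_alg W) (entry 1 n) (r_elem n) else 0)"
  using assms(2,3)
proof (induction j)
  case (Suc j)
  interpret A: dg_algebra "R_alg W :: ('k cochain) dga" by (rule dg_algebra_R)
  show ?case
  proof (cases "i = j")
    case True
    moreover have "\<not> (j = 1 \<and> Suc j = n + 1)" using n by auto
    moreover have "{j<..<Suc j} = {}" by auto
    ultimately show ?thesis using Suc.prems assms by (auto simp: entry_Suc_self diff_z)
  next
    case False
    then have ij: "i < j" using Suc.prems by simp
    have j: "j \<in> {1..n}" using ij Suc.prems by auto
    have jn: "j \<le> n" using j by simp
    have y: "y_elem j \<in> grade (R_alg W :: ('k cochain) dga) (2 * int s + int (card ({} :: nat set)))"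
      unfolding y_elem_def by (intro degree_pair nonempty j) auto
    have IH: "bd (entry i j :: 'k cochain) = - (\<Sum>t\<in>{i<..<j}. mult (R_alg W) (entry i t) (entry t j))"
      using Suc.IH ij jn by simp
    have "bd (entry i (Suc j) :: 'k cochain) =
        mult (R_alg W) (bd (entry i j)) (y_elem j) - mult (R_alg W) (entry i j) (z_elem j + r_elem j)"
      unfolding entry_Suc[OF ij]
      by (subst A.Leibniz[OF entry_grade y]) (use assms(1) ij jn in \<open>auto simp: diff_y[OF j] bar_def\<close>)
    also have "mult (R_alg W) (bd (entry i j)) (y_elem j :: 'k cochain) =
        - (\<Sum>t\<in>{i<..<j}. mult (R_alg W) (entry i t) (entry t (Suc j)))"
      unfolding IH A.mult_minus_left A.mult_sum_left A.mult_assoc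
      by (intro arg_cong[of _ _ uminus] sum.cong refl) (simp add: entry_Suc)
    also have "mult (R_alg W) (entry i j) (z_elem j + r_elem j :: 'k cochain) =
        mult (R_alg W) (entry i j) (entry j (Suc j)) + mult (R_alg W) (entry i j) (r_elem j)"
      by (simp add: A.mult_add_right entry_Suc_self)
    also have "mult (R_alg W) (entry i j) (r_elem j :: 'k cochain) =
        (if i = 1 \<and> Suc j = n + 1 then mult (R_alg W) (entry 1 n) (r_elem n) else 0)"
      using entry_r_zero[OF assms(1) ij jn] by auto
    finally have "bd (entry i (Suc j) :: 'k cochain) =
      - (\<Sum>t\<in>{i<..<j}. mult (R_alg W) (entry i t) (entry t (Suc j))) -
      (mult (R_alg W) (entry i j) (entry j (Suc j)) + (if i = 1 \<and> Suc j = n + 1 then mult (R_alg W) (entry 1 n) (r_elem n) else 0))" .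
    moreover have "{i<..<Suc j} = insert j {i<..<j}" using ij by auto
    ultimately show ?thesis by simp
  qed
qed simp

definition degrees :: "nat \<Rightarrow> int" where "degrees _ = 2 * int s + 1"

lemma entry_degree_degrees:
  "i \<le> j \<Longrightarrow> entry_degree degrees i j = 2 * int s * int (j - i) + 1"
  by (simp add: entry_degree_def degrees_def algebra_simps of_nat_diff)

definition massey_value :: "'k::comm_ring_1 cochain" where
  "massey_value = - mult (R_alg W) (entry 1 n) (r_elem n)"

definition classes :: "nat \<Rightarrow> ('k::comm_ring_1 cochain) set" where
  "classes i = coh_class (R_alg W) (degrees i) (z_elem i)"

lemma z_cocycle: "i \<in> {1..n} \<Longrightarrow> (z_elem i :: 'k::comm_ring_1 cochain) \<in> cocycles (R_alg W) (degrees i)"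
  using entry_grade[of i "Suc i"] diff_z[of i] by (auto simp: cocycles_def degrees_def entry_Suc_self)

lemma classes_cohomology:
  "i \<in> {1..n} \<Longrightarrow> (classes i :: ('k::comm_ring_1 cochain) set) \<in> cohomology (R_alg W) (degrees i)"
  unfolding classes_def cohomology_def using z_cocycle by blast

text \<open>All entries have odd degree, so \<open>bar\<close> is negation and
  \<open>diff_entry\<close> is the defining equation; its surplus term in the corner is the
  value.\<close>

lemma standard_system:
  "defining_system (R_alg W :: ('k::comm_ring_1 cochain) dga) n degrees classes entry massey_value"
proof -
  interpret A: dg_algebra "R_alg W :: ('k cochain) dga" by (rule dg_algebra_R)
  show ?thesis
    unfolding A.defining_system_iff
  proof (intro conjI ballI impI)
    fix i j assume "i \<in> {1..n+1}" "j \<in> {1..n+1}"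
    then show "if j \<le> i then entry i j = (0 :: 'k cochain) else (entry i j :: 'k cochain) \<in> grade (R_alg W) (entry_degree degrees i j)"
      using entry_grade[of i j] entry_degree_degrees[of i j] by (auto simp: entry_def)
  next
    fix i assume "i \<in> {1..n}"
    then show "entry i (i + 1) \<in> (classes i :: ('k cochain) set)"
      using A.coh_class_self[OF z_cocycle] by (simp add: classes_def entry_Suc_self)
  next
    fix i j assume ij: "i \<in> {1..n+1}" "j \<in> {1..n+1}" "i < j"
    have "(\<Sum>t\<in>{i<..<j}. mult (R_alg W) (bar (entry_degree degrees i t) (entry i t)) (entry t j :: 'k cochain)) =
      (\<Sum>t\<in>{i<..<j}. - mult (R_alg W) (entry i t) (entry t j))"
      by (rule sum.cong[OF refl]) (auto simp: entry_degree_degrees bar_def A.mult_minus_left)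
    moreover have "bd (entry i j :: 'k cochain) =
        - (\<Sum>t\<in>{i<..<j}. mult (R_alg W) (entry i t) (entry t j)) -
        (if i = 1 \<and> j = n + 1 then mult (R_alg W) (entry 1 n) (r_elem n) else 0)"
      by (rule diff_entry) (use ij in auto)
    ultimately show "(if i = 1 \<and> j = n + 1 then massey_value else 0) = bd (entry i j :: 'k cochain) -
        (\<Sum>t\<in>{i<..<j}. mult (R_alg W) (bar (entry_degree degrees i t) (entry i t)) (entry t j))"
      by (simp only: massey_value_def sum_negf) (simp split: if_split)
  next
    assume "n = 0"
    then show "massey_value = (0 :: 'k cochain)" using n by simp
  qed
qed

lemma edge_face: "{1, 2 * n} \<in> K0"
  using edge_iff[of 1 n] n by (simp add: mult_2)

text \<open>The two factors use disjoint sets of vertices that exhaust 1, ..., 2n, and their faces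
  {1} and {2n} join to the exceptional edge.\<close>

lemma massey_value_monomial:
  "\<exists>e. e * e = 1 \<and> massey_value = single (cell {1..2 * n} {1, 2 * n}) (e :: 'k::comm_ring_1)"
proof -
  obtain e :: 'k where e: "e * e = 1" "entry 1 n = single (cell (span 1 n) {1}) e"
    using entry_monomial[of 1 n] n by auto
  have nn: "n \<in> {1..n}" using n by simp
  have "span 1 n \<union> {n, n + n} = {1..2 * n}"
  proof
    show "{1..2 * n} \<subseteq> span 1 n \<union> {n, n + n}"
    proof
      fix i assume i: "i \<in> {1..2 * n}"
      show "i \<in> span 1 n \<union> {n, n + n}"
      proof (cases "i \<le> n")
        case False
        then have "i = n + (i - n)" by simp
        then show ?thesis using i False by (cases "i - n < n") (auto simp: span_def)
      qed (use i in \<open>auto simp: span_def\<close>)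
    qed
  qed (use n in \<open>auto simp: span_def\<close>)
  moreover have "{1} \<union> {n + n} = {1, 2 * n}" by (auto simp: mult_2)
  ultimately have p: "mult (R_alg W) (entry 1 n) (r_elem n :: 'k cochain) = single (cell {1..2 * n} {1, 2 * n})
      (e * (y_sign n * shuffle_sign {vertex (n + n)} (top_copies {n, n + n})) *
       shuffle_sign (top_copies (span 1 n - {1})) (top_copies ({n, n + n} - {n + n})))" (is "_ = single _ (e * (?a * ?b) * ?c)")
    unfolding e(2) r_elem_def
    by (subst cell_product) (use span_props(2)[of 1 n] pair_block(2)[OF nn] span_disjoint[of 1 n] edge_face n in \<open>auto simp: span_def\<close>)
  have "(e * (?a * ?b) * ?c) * (e * (?a * ?b) * ?c) = (e * e) * (?a * ?a) * (?b * ?b) * (?c * ?c)" by (simp add: mult_ac)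
  also have "\<dots> = 1" by (simp add: e(1) y_sign_def shuffle_sign_square)
  finally show ?thesis
    unfolding massey_value_def p by (intro exI[of _ "- (e * (?a * ?b) * ?c)"]) (simp add: single_uminus)
qed

end

section \<open>Nonexactness and uniqueness of the value\<close>

context massey_family
begin

text \<open>The left and right parts of a span are the same interval of indices, so the
  contributions cancel.\<close>

lemma weight_span:
  assumes "1 \<le> i" "j \<le> n + 1" "Y \<subseteq> span i j"
  shows "weight (cell (span i j) Y) = 0"
  unfolding weight_copies[OF span_props(1)[OF assms(1,2)] multidegree_cell[OF span_props(2)[OF assms(1,2)] assms(3)]]
    span_props(3,4)[OF assms(1,2)] by simp

lemma weight_union:
  assumes "compatible p q"
  shows "weight (monomial_union p q) = weight p + weight q"
proof -
  have B: "(fst p \<union> fst q, snd p \<union> snd q) \<in> R_basis W" and d: "fst p \<inter> fst q = {}" "snd p \<inter> snd q = {}"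
    using assms by (auto simp: compatible_def monomial_union_def)
  have "(fst p \<union> fst q) \<inter> (snd p \<union> snd q) = {}" using B by (auto simp: R_basis_def)
  then have "multidegree p \<inter> multidegree q = {}" using d by blast
  moreover have "finite (multidegree p)" "finite (multidegree q)" using R_basis_finite[OF B] by auto
  moreover have "multidegree (monomial_union p q) = multidegree p \<union> multidegree q"
    by (auto simp: monomial_union_def)
  ultimately show ?thesis unfolding weight_def by (simp add: sum.union_disjoint)
qed

text \<open>
  The restriction of a cochain to the edges of \<open>K(n)\<close>: a coboundary that vanishes on the edges of the
  path \<open>1, 2, n + 1, 2n\<close> also vanishes on the edge \<open>{1, 2n}\<close>.
\<close>

lemma coefficient_on_edge:
  fixes y :: "'k::comm_ring_1 cochain"
  defines "F \<equiv> {1..2 * n}"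
  defines "g \<equiv> \<lambda>v. shuffle_sign {vertex v} (top_copies F - {vertex v}) * lookup y (cell F {v})"
  assumes y: "keys y \<subseteq> cell F ` {Y \<in> K0. Y \<subseteq> F}"
    and uv: "u \<in> F" "v \<in> F" "vertex u < vertex v" "{u, v} \<in> K0"
  shows "lookup (bd y) (cell F {u, v}) = 0 \<longleftrightarrow> g u = g v"
proof -
  let ?l = "lookup"
  have FK: "F \<subseteq> \<Union>K0" unfolding F_def by (rule vertices_Kn)
  have neq: "u \<noteq> v" using uv by auto
  have sub: "{u, v} \<subseteq> F" using uv by simp
  define J0 where "J0 = top_copies (F - {u, v})"
  define I where "I = lower_copies F \<union> top_copies {u, v}"
  have c: "cell F {u, v} = (J0, I)" by (simp add: cell_def J0_def I_def)
  have B: "(J0, I) \<in> R_basis W" using cell_in_R_basis[OF FK sub] uv(4) c by simp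
  have kB: "keys y \<subseteq> R_basis W" using y cell_in_R_basis[OF FK] by blast
  have fin: "finite J0" "finite I" using R_basis_finite[OF B] by auto
  have notin: "vertex u \<notin> J0" "vertex v \<notin> J0" by (auto simp: J0_def mem_top)
  \<comment> \<open>The support of y consists of monomials with v at all lower copies, so only the
    two first copies contribute to the coefficient.\<close>
  have low: "?l y (A, I - {j}) = 0" if "j \<in> lower_copies F" for A j
  proof (rule ccontr)
    assume "?l y (A, I - {j}) \<noteq> 0"
    then have "(A, I - {j}) \<in> keys y" by (simp add: in_keys_iff)
    then have "lower_copies F \<subseteq> I - {j}" using y by (auto simp: cell_def)
    then show False using that by blast
  qed
  have tops: "top_copies {u, v} = {vertex u, vertex v}" by (simp add: top_copies_def)
  have "?l (bd y) (cell F {u, v}) = (\<Sum>j\<in>I. shuffle_sign {j} J0 * ?l y (insert j J0, I - {j}))"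
    unfolding c by (rule lookup_diff[OF kB B])
  also have "\<dots> = (\<Sum>j\<in>{vertex u, vertex v}. shuffle_sign {j} J0 * ?l y (insert j J0, I - {j}))"
  proof (rule sum.mono_neutral_right[OF fin(2)])
    show "{vertex u, vertex v} \<subseteq> I" by (auto simp: I_def tops)
    show "\<forall>j\<in>I - {vertex u, vertex v}. shuffle_sign {j} J0 * ?l y (insert j J0, I - {j}) = 0"
    proof
      fix j assume "j \<in> I - {vertex u, vertex v}"
      then have "j \<in> lower_copies F" unfolding I_def tops by blast
      from low[OF this] show "shuffle_sign {j} J0 * ?l y (insert j J0, I - {j}) = 0" by simp
    qed
  qed
  also have "\<dots> = shuffle_sign {vertex u} J0 * ?l y (cell F {v}) + shuffle_sign {vertex v} J0 * ?l y (cell F {u})"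
  proof -
    have "(insert (vertex u) J0, I - {vertex u}) = cell F ({u, v} - {u})"
      using cell_remove[OF _ sub, of u] unfolding c by simp
    moreover have "(insert (vertex v) J0, I - {vertex v}) = cell F ({u, v} - {v})"
      using cell_remove[OF _ sub, of v] unfolding c by simp
    moreover have "{u, v} - {u} = {v}" "{u, v} - {v} = {u}" using neq by auto
    ultimately have e: "(insert (vertex u) J0, I - {vertex u}) = cell F {v}" "(insert (vertex v) J0, I - {vertex v}) = cell F {u}"
      by simp_all
    show ?thesis using e neq by simp
  qed
  finally have L: "?l (bd y) (cell F {u, v}) =
      shuffle_sign {vertex u} J0 * ?l y (cell F {v}) + shuffle_sign {vertex v} J0 * ?l y (cell F {u})" .
  have eu: "top_copies F - {vertex u} = insert (vertex v) J0"
    unfolding J0_def eq_codes using uv neq by (auto simp: mem_top)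
  have su: "shuffle_sign {vertex u} (top_copies F - {vertex u}) = (shuffle_sign {vertex u} J0 :: 'k)"
    unfolding eu shuffle_sign_single_insert[OF fin(1) notin(2)] using uv(3) by auto
  have ev: "top_copies F - {vertex v} = insert (vertex u) J0"
    unfolding J0_def eq_codes using uv neq by (auto simp: mem_top)
  \<comment> \<open>This minus sign, absent from \<open>su\<close> because u comes first, makes the
    coefficient a difference of values of g, up to a sign.\<close>
  have sv: "shuffle_sign {vertex v} (top_copies F - {vertex v}) = (- shuffle_sign {vertex v} J0 :: 'k)"
    unfolding ev shuffle_sign_single_insert[OF fin(1) notin(1)] using uv(3) by auto
  define a b p q where "a = (shuffle_sign {vertex u} J0 :: 'k)" and "b = (shuffle_sign {vertex v} J0 :: 'k)"
    and "p = ?l y (cell F {u})" and "q = ?l y (cell F {v})"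
  have sq: "a * a = 1" "b * b = 1" by (simp_all add: a_def b_def shuffle_sign_square)
  \<comment> \<open>Multiplication by a b turns each equation into the other, as a and b square to
    1.\<close>
  have "a * q + b * p = 0 \<longleftrightarrow> a * p = - b * q"
  proof
    assume "a * q + b * p = 0"
    then have "(a * b) * (a * q + b * p) = 0" by simp
    also have "(a * b) * (a * q + b * p) = (a * a) * (b * q) + (b * b) * (a * p)" by (simp add: algebra_simps)
    finally show "a * p = - b * q" using sq by (simp add: eq_neg_iff_add_eq_0 add.commute)
  next
    assume "a * p = - b * q"
    then have "a * p + b * q = 0" by simp
    then have "(a * b) * (a * p + b * q) = 0" by simp
    also have "(a * b) * (a * p + b * q) = (a * a) * (b * p) + (b * b) * (a * q)" by (simp add: algebra_simps)
    finally show "a * q + b * p = 0" using sq by (simp add: add.commute)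
  qed
  then show ?thesis unfolding L g_def su sv a_def b_def p_def q_def by simp
qed

text \<open>A primitive can be restricted to the multidegree of all 2n blocks and then reduced to
  cells. The signed coefficients g at its vertices are constant along the path, so its coboundary
  cannot have the nonzero coefficient e at {1, 2n}.\<close>

lemma massey_value_not_exact:
  "\<not> (\<exists>y\<in>grade (R_alg W) (2 * int s * int n + 1). (massey_value :: 'k::comm_ring_1 cochain) = bd y)"
proof
  interpret A: dg_algebra "R_alg W :: ('k cochain) dga" by (rule dg_algebra_R)
  define F where "F = {1..2 * n}"
  have FK: "F \<subseteq> \<Union>K0" unfolding F_def by (rule vertices_Kn)
  have sub: "{1, 2 * n} \<subseteq> F" using n by (auto simp: F_def)
  obtain e :: 'k where e: "e * e = 1" "massey_value = single (cell F {1, 2 * n}) e"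
    using massey_value_monomial unfolding F_def by blast
  have e0: "e \<noteq> 0" using e(1) by (rule square_one_nonzero)
  assume "\<exists>y\<in>grade (R_alg W) (2 * int s * int n + 1). (massey_value :: 'k cochain) = bd y"
  then obtain y0 where y0: "y0 \<in> grade (R_alg W) (2 * int s * int n + 1)"
    "(massey_value :: 'k cochain) = bd y0" by blast
  define y1 where "y1 = restrict_keys (\<lambda>m. multidegree m = copies J F) y0"
  have y1: "y1 \<in> grade (R_alg W) (2 * int s * int n + 1)"
    using y0(1) by (auto simp: grade_keys y1_def keys_restrict_keys)
  have dy1: "bd y1 = single (cell F {1, 2 * n}) e"
    unfolding y1_def restrict_keys_diff[where Q = "\<lambda>S. S = copies J F"] y0(2)[symmetric] e(2)
      restrict_keys_single multidegree_cell[OF FK sub] by simp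
  have "\<exists>u\<in>grade (R_alg W) (2 * int s * int n + 1 - 1). keys (y1 - bd u) \<subseteq> cell F ` {Y \<in> K0. Y \<subseteq> F}"
  proof (rule block_reduction[OF FK y1])
    show "multidegree m = copies J F" if "m \<in> keys y1" for m
      using that by (simp add: y1_def keys_restrict_keys)
    show "lower_copies F \<subseteq> snd m" if "m \<in> keys (bd y1)" for m
      using that unfolding dy1 by (auto simp: cell_def split: if_splits)
  qed
  then obtain u where u: "u \<in> grade (R_alg W) (2 * int s * int n + 1 - 1)"
    "keys (y1 - bd u) \<subseteq> cell F ` {Y \<in> K0. Y \<subseteq> F}" by blast
  define y where "y = y1 - bd u"
  have dy: "bd y = single (cell F {1, 2 * n}) e"
    unfolding y_def A.diff_minus2 A.diff_diff[OF u(1)] dy1 by simp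
  define g where "g v = shuffle_sign {vertex v} (top_copies F - {vertex v}) * lookup y (cell F {v})" for v
  have edge: "lookup (bd y) (cell F {a, b}) = 0 \<longleftrightarrow> g a = g b"
    if ab: "a \<in> F" "b \<in> F" "a \<noteq> b" "{a, b} \<in> K0" for a b
  proof -
    have "vertex a \<noteq> vertex b" using ab by simp
    then consider "vertex a < vertex b" | "vertex b < vertex a" by linarith
    then show ?thesis
    proof cases
      case 1
      then show ?thesis
        using coefficient_on_edge[of y a b] u(2) ab unfolding y_def[symmetric] F_def[symmetric] g_def by blast
    next
      case 2
      then have "lookup (bd y) (cell F {b, a}) = 0 \<longleftrightarrow> g b = g a"
        using coefficient_on_edge[of y b a] u(2) ab unfolding y_def[symmetric] F_def[symmetric] g_def
        by (simp add: insert_commute)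
      then show ?thesis by (auto simp: insert_commute)
    qed
  qed
  have path: "g a = g b" if ab: "a \<in> F" "b \<in> F" "a \<noteq> b" "{a, b} \<in> K0" "{a, b} \<noteq> {1, 2 * n}" for a b
  proof -
    have "cell F {a, b} \<noteq> cell F {1, 2 * n}"
      using cell_inject[of F "{a, b}" "{1, 2 * n}"] ab sub by auto
    then have "lookup (bd y) (cell F {a, b}) = 0"
      unfolding dy by (simp add: lookup_single_not_eq)
    then show ?thesis using edge[OF ab(1-4)] by blast
  qed
  have faces: "{1, 2} \<in> K0" "{2, n + 1} \<in> K0" "{n + 1, 2 * n} \<in> K0"
    using n by (subst face_iff; force)+
  have inF: "1 \<in> F" "2 \<in> F" "n + 1 \<in> F" "2 * n \<in> F" using n by (auto simp: F_def)
  have neq: "(1::nat) \<noteq> 2" "2 \<noteq> n + 1" "n + 1 \<noteq> 2 * n" "1 \<noteq> 2 * n" using n by auto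
  have "{1, 2} \<noteq> {1, 2 * n}" "{2, n + 1} \<noteq> {1, 2 * n}" "{n + 1, 2 * n} \<noteq> {1, 2 * n}"
    using n by (auto simp: doubleton_eq_iff)
  then have "g 1 = g 2" "g 2 = g (n + 1)" "g (n + 1) = g (2 * n)"
    using path[OF inF(1,2) neq(1) faces(1)] path[OF inF(2,3) neq(2) faces(2)] path[OF inF(3,4) neq(3) faces(3)]
    by blast+
  then have "lookup (bd y) (cell F {1, 2 * n}) = 0"
    using edge[OF inF(1,4) neq(4) edge_face] by simp
  then show False unfolding dy using e0 by simp
qed

definition positive_part :: "('k::comm_ring_1 cochain) set" where
  "positive_part = {x. \<forall>m\<in>keys x. weight m > 0}"

text \<open>Weights add under products and are 0 on the standard entries, so the positive part
  absorbs multiplication by entries and by itself. The two vanishing conditions come from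
  \<open>low_weight_exact\<close> and \<open>top_weight_exact\<close>.\<close>

lemma massey_value_unique:
  assumes ds: "defining_system (R_alg W :: ('k::comm_ring_1 cochain) dga) n degrees classes c a"
  shows "\<exists>b\<in>grade (R_alg W) (2 * int s * int n + 1). a - massey_value = bd b"
proof -
  interpret A: dg_algebra "R_alg W :: ('k cochain) dga" by (rule dg_algebra_R)
  have N_mult: "mult (R_alg W) x y \<in> positive_part"
    if "\<And>p q. \<lbrakk>p \<in> keys x; q \<in> keys y\<rbrakk> \<Longrightarrow> weight p + weight q > 0" for x y :: "'k cochain"
    unfolding positive_part_def using keys_mult_R[of _ x y] weight_union that by fastforce
  have top_degree: "entry_degree degrees 1 (n + 1) = 2 * int s * int n + 1"
    using entry_degree_degrees[of 1 "n + 1"] by simp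
  have "\<exists>b\<in>grade (R_alg W) (entry_degree degrees 1 (n + 1)). a - massey_value = bd b"
  proof (rule A.massey_unique_modulo[OF standard_system ds _ n, where N = positive_part])
    show "classes i \<in> cohomology (R_alg W :: ('k cochain) dga) (degrees i)" if "i \<in> {1..n}" for i
      using that by (rule classes_cohomology)
    show "0 \<in> (positive_part :: ('k cochain) set)" by (simp add: positive_part_def)
    show "x + y \<in> positive_part" if "x \<in> positive_part" "y \<in> positive_part" for x y :: "'k cochain"
      using that Poly_Mapping.keys_add[of x y] unfolding positive_part_def by blast
    show "- x \<in> positive_part" if "x \<in> positive_part" for x :: "'k cochain"
      using that by (simp add: positive_part_def)
    show "mult (R_alg W) x y \<in> positive_part" if "x \<in> positive_part" "y \<in> positive_part" for x y :: "'k cochain"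
      using that by (intro N_mult) (fastforce simp: positive_part_def)
    show "mult (R_alg W) (entry i j) x \<in> positive_part \<and> mult (R_alg W) x (entry i j) \<in> positive_part"
      if ij: "1 \<le> i" "i < j" "j \<le> n + 1" and x: "x \<in> positive_part" for i j and x :: "'k cochain"
    proof -
      obtain e :: 'k where "entry i j = single (cell (span i j) {i}) e"
        using entry_monomial[OF ij] by blast
      moreover have "weight (cell (span i j) {i}) = 0"
        by (rule weight_span) (use ij in \<open>auto simp: span_def\<close>)
      ultimately have we: "weight m = 0" if "m \<in> keys (entry i j :: 'k cochain)" for m
        using that by (auto split: if_splits)
      have wx: "weight m > 0" if "m \<in> keys x" for m using x that by (simp add: positive_part_def)
      show ?thesis
      proof
        show "mult (R_alg W) (entry i j) x \<in> positive_part" by (rule N_mult) (use we wx in force)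
        show "mult (R_alg W) x (entry i j) \<in> positive_part" by (rule N_mult) (use we wx in force)
      qed
    qed
  next
    fix i j and x :: "'k cochain"
    assume ij: "1 \<le> i" "i + 1 < j" "j \<le> n + 1" "\<not> (i = 1 \<and> j = n + 1)"
      and x: "x \<in> grade (R_alg W) (entry_degree degrees i j)" "bd x \<in> positive_part"
    have k: "2 \<le> j - i" "j - i < n" using ij by auto
    have e: "entry_degree degrees i j = 2 * int s * int (j - i) + 1" using ij by (intro entry_degree_degrees) simp
    \<comment> \<open>The weight depends on the multidegree alone, so the differential respects it:
      the part of weight at most 0 is a cocycle, hence exact, and what remains of x is
      positive.\<close>
    define x0 where "x0 = restrict_keys (\<lambda>m. weight m \<le> 0) x"
    have "bd x0 = restrict_keys (\<lambda>m. weight m \<le> 0) (bd x)"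
      unfolding x0_def weight_def by (rule restrict_keys_diff)
    also have "\<dots> = 0"
    proof (rule poly_mapping_eqI)
      fix m
      have "lookup (bd x) m = 0" if "weight m \<le> 0"
      proof (rule ccontr)
        assume "lookup (bd x) m \<noteq> 0"
        then have "m \<in> keys (bd x)" by (simp add: in_keys_iff)
        then show False using x(2) that by (auto simp: positive_part_def)
      qed
      then show "lookup (restrict_keys (\<lambda>m. weight m \<le> 0) (bd x)) m = lookup 0 m"
        by (simp add: lookup_restrict_keys)
    qed
    finally have "bd x0 = 0" .
    moreover have "x0 \<in> grade (R_alg W) (2 * int s * int (j - i) + 1)"
      using x(1) unfolding e by (auto simp: grade_keys x0_def keys_restrict_keys)
    moreover have "weight m \<le> 0" if "m \<in> keys x0" for m
      using that by (simp add: x0_def keys_restrict_keys)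
    ultimately obtain b where b: "b \<in> grade (R_alg W) (2 * int s * int (j - i) + 1 - 1)" "x0 = bd b"
      using low_weight_exact[OF k] by blast
    have "x - bd b = restrict_keys (\<lambda>m. weight m > 0) x"
      unfolding b(2)[symmetric] x0_def by (rule poly_mapping_eqI) (simp add: lookup_minus lookup_restrict_keys)
    then have "x - bd b \<in> positive_part" by (simp add: positive_part_def keys_restrict_keys)
    then show "\<exists>b\<in>grade (R_alg W) (entry_degree degrees i j - 1). x - bd b \<in> positive_part"
      using b(1) unfolding e by blast
  next
    fix x :: "'k cochain"
    assume x: "x \<in> positive_part" "x \<in> grade (R_alg W) (entry_degree degrees 1 (n + 1) + 1)" "bd x = 0"
    have eqs: "entry_degree degrees 1 (n + 1) + 1 = 2 * int s * int n + 2" "2 * int s * int n + 2 - 1 = entry_degree degrees 1 (n + 1)"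
      by (simp_all only: top_degree)
    have "\<exists>y\<in>grade (R_alg W) (2 * int s * int n + 2 - 1). x = bd y"
      by (rule top_weight_exact) (use x in \<open>simp_all only: eqs positive_part_def mem_Collect_eq\<close>)
    then show "\<exists>b\<in>grade (R_alg W) (entry_degree degrees 1 (n + 1)). x = bd b"
      unfolding eqs(2) .
  qed
  then show ?thesis unfolding top_degree .
qed

theorem strictly_defined_nontrivial:
  "strictly_defined (R_alg W :: ('k::comm_ring_1 cochain) dga) n degrees classes"
  "\<not> trivial_massey (R_alg W :: ('k cochain) dga) n degrees classes"
proof -
  interpret A: dg_algebra "R_alg W :: ('k cochain) dga" by (rule dg_algebra_R)
  let ?D = "(\<Sum>t=1..n. degrees t) - int n + 2"
  \<comment> \<open>n classes of degree 2s + 1 have a product in degree 2sn + 2.\<close>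
  have D: "?D - 1 = 2 * int s * int n + 1" by (simp add: degrees_def algebra_simps)
  have same: "massey_class (R_alg W) n degrees a = massey_class (R_alg W) n degrees (massey_value :: 'k cochain)"
    if "defining_system (R_alg W) n degrees classes c a" for c and a :: "'k cochain"
    using massey_value_unique[OF that] A.coh_class_shift[of a massey_value _ ?D] unfolding massey_class_def D by blast
  show "strictly_defined (R_alg W :: ('k cochain) dga) n degrees classes"
    unfolding strictly_defined_def massey_product_def
  proof (intro exI conjI)
    show "{massey_class (R_alg W) n degrees a |c a. defining_system (R_alg W) n degrees classes c a} =
        {massey_class (R_alg W) n degrees (massey_value :: 'k cochain)}"
      using same standard_system[where 'k = 'k] by blast
  qed (rule standard_system)
  show "\<not> trivial_massey (R_alg W :: ('k cochain) dga) n degrees classes"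
  proof
    assume "trivial_massey (R_alg W :: ('k cochain) dga) n degrees classes"
    then obtain c and a :: "'k cochain" where "defining_system (R_alg W) n degrees classes c a"
      "massey_class (R_alg W) n degrees a = massey_class (R_alg W) n degrees 0"
      unfolding trivial_massey_def by blast
    then have "coh_class (R_alg W) ?D (massey_value :: 'k cochain) = coh_class (R_alg W) ?D 0"
      using same[of c a] by (simp add: massey_class_def)
    moreover have "(massey_value :: 'k cochain) \<in> cocycles (R_alg W) ?D"
    proof -
      have n1: "n \<ge> 1" using n by simp
      have "entry_degree degrees 1 (n + 1) + 1 = ?D" using D entry_degree_degrees[of 1 "n + 1"] by simp
      with A.defining_system_cocycle[OF standard_system n1] show ?thesis
        unfolding cocycles_def by (simp only: mem_Collect_eq)
    qed
    ultimately have "(massey_value :: 'k cochain) \<in> coh_class (R_alg W) ?D 0"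
      using A.coh_class_self by blast
    then have "\<exists>y\<in>grade (R_alg W) (?D - 1). (massey_value :: 'k cochain) = bd y"
      by (auto simp: coh_class_def)
    then show False using massey_value_not_exact unfolding D by blast
  qed
qed

text \<open>A nonface contains all copies of a pair {k, n + p}, which are s + 1 in number, or all
  copies of a vertex outside 1, ..., 2n, which are more than s. The bound serves both the
  connectivity and the admissibility of the tuple.\<close>

lemma card_nonface:
  assumes "\<sigma> \<subseteq> \<Union>W" "\<sigma> \<notin> W"
  shows "card \<sigma> \<ge> s + 1"
proof -
  define N where "N = full_blocks \<sigma>"
  have NK: "N \<subseteq> \<Union>K0" "N \<notin> K0" using assms unfolding vertices_W mem_W N_def by (auto simp: full_blocks_def)
  have finN: "finite N" using NK(1) base.finite_vertices by (rule finite_subset)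
  have "copies J N \<subseteq> \<sigma>" by (fastforce simp: N_def copies_def full_blocks_def)
  moreover have "finite \<sigma>" using assms(1) finite_vertices by (rule finite_subset)
  ultimately have "card (copies J N) \<le> card \<sigma>" by (intro card_mono) auto
  then have le: "sum J N \<le> card \<sigma>" using card_copies[OF finN] by simp
  show ?thesis
  proof (cases "N \<subseteq> {1..2 * n}")
    case True
    then obtain k p where kp: "k \<in> N" "n + p \<in> N" "k \<le> p" "p \<le> n" using NK(2) unfolding face_iff[OF True] by blast
    have "1 \<le> k" using kp(1) True by auto
    then have "k \<in> {1..n}" "n + p \<in> {n+1..2 * n}" "k \<noteq> n + p" using kp by auto
    then have "sum J {k, n + p} = s + 1" using J_s J_1 by simp
    moreover have "sum J {k, n + p} \<le> sum J N" using kp finN by (intro sum_mono2) auto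
    ultimately show ?thesis using le by simp
  next
    case False
    then obtain i where i: "i \<in> N" "i \<notin> {1..2 * n}" by blast
    have "J i \<le> sum J N" using i finN by (intro member_le_sum) auto
    moreover have "J i > 2 * s * n + 2" using J_large i NK(1) by blast
    moreover have "2 * s * n \<ge> s" using n by simp
    ultimately show ?thesis using le by linarith
  qed
qed

end

section \<open>Choice of the member of the family\<close>

lemma nerve_finite_complex: "finite_complex (nerve d hs)"
proof
  show "finite (\<Union>(nerve d hs))"
    by (rule finite_subset[of _ "{1..length hs}"]) (auto simp: nerve_def)
  show "\<forall>\<sigma>\<in>nerve d hs. Pow \<sigma> \<subseteq> nerve d hs"
    by (auto simp: nerve_def)
qed

theorem theorem3p6:
  fixes P :: "nat \<Rightarrow> halfspace list" and l r :: nat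
  assumes coeff: "coefficient_ring TYPE('k::{comm_ring_1, ring_char_0})"
    and P: "\<And>n. n \<ge> 2 \<Longrightarrow> is_polytope_Pn n (P n)"
    and l: "l \<ge> 2" and r: "r \<ge> 2"
  shows "\<exists>K\<in>nerves_of_family P. n_connected l (moment_angle K) \<and>
    (\<exists>ns \<alpha>. (\<forall>i\<in>{1..r}. \<alpha> i \<in> cohomology (R_alg K :: (monomial \<Rightarrow>\<^sub>0 'k) dga) (ns i)) \<and>
       strictly_defined (R_alg K) r ns \<alpha> \<and> \<not> trivial_massey (R_alg K) r ns \<alpha>)"
proof -
  define K0 where "K0 = nerve r (P r)"
  \<comment> \<open>More than 4r for the degree count, and at least l + 1, so that every set of at
    most l + 1 vertices is a simplex.\<close>
  define s where "s = l + 4 * r + 1"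
  \<comment> \<open>\<open>2 * s * r + 3\<close> is the least value above the bound that keeps the
    remaining facets out of the degrees considered.\<close>
  define J where "J i = (if i \<in> {1..r} then s else if i \<in> {r+1..2 * r} then 1 else 2 * s * r + 3)" for i
  interpret base: finite_complex K0 unfolding K0_def by (rule nerve_finite_complex)
  have Kn: "induced K0 {1..2 * r} = complex_Kn r"
    using P[OF r] by (simp add: is_polytope_Pn_def K0_def)
  have "{} \<in> complex_Kn r" by (auto simp: complex_Kn_def complex_of_nonfaces_def)
  then have "{} \<in> K0" unfolding Kn[symmetric] induced_def by blast
  then interpret massey_family K0 J r s
    using Kn r by unfold_locales (auto simp: J_def s_def)
  show ?thesis
  proof (intro bexI conjI exI ballI)
    show "n_connected l (moment_angle W)"
    proof (rule n_connected_moment_angle[OF down_closed finite_vertices])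
      fix \<sigma> assume "\<sigma> \<subseteq> \<Union>W" "card \<sigma> \<le> l + 1"
      then show "\<sigma> \<in> W" using card_nonface[of \<sigma>] by (force simp: s_def)
    qed
    show "classes i \<in> cohomology (R_alg W :: (monomial \<Rightarrow>\<^sub>0 'k) dga) (degrees i)" if "i \<in> {1..r}" for i
      using that by (rule classes_cohomology)
    show "strictly_defined (R_alg W :: (monomial \<Rightarrow>\<^sub>0 'k) dga) r degrees classes"
      "\<not> trivial_massey (R_alg W :: (monomial \<Rightarrow>\<^sub>0 'k) dga) r degrees classes"
      by (rule strictly_defined_nontrivial)+
    have "admissible_tuple K0 r s J"
      unfolding admissible_tuple_def
    proof (intro conjI ballI)
      fix I assume "I \<in> minimal_nonfaces W"
      then show "s + 1 \<le> card I" by (intro card_nonface) (auto simp: minimal_nonfaces_def)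
    qed (use r in \<open>auto simp: J_def s_def\<close>)
    then show "W \<in> nerves_of_family P"
      unfolding nerves_of_family_def mem_Collect_eq K0_def
      by - (rule exI[of _ r], rule exI[of _ s], rule exI[of _ J], use r in \<open>simp add: s_def\<close>)
  qed
qed

end
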